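(* Let $F$ be a quadratic extension of a complex (i.e. imaginary) quadratic number field. Then the function $h^0$ on the Arakelov class group $\mathrm{Pic}_F^0$ has its unique global maximum at the trivial class $D_0=(O_F,1)$; that is, $h^0(D)<h^0(D_0)$ for every class $D\in \mathrm{Pic}_F^0$ different from the class of $D_0$.
   Context: $F$ is a totally complex quartic field with ring of integers $O_F$. It has two infinite primes $\sigma,\sigma'$, both complex; $F$ is embedded in $F_{\mathbb R}=F\otimes_{\mathbb Q}\mathbb R\simeq\mathbb C^2$ via $f\mapsto(\sigma(f),\sigma'(f))$, and $F_{\mathbb R}$ has the Euclidean norm $\|(x_1,x_2)\|^2=2|x_1|^2+2|x_2|^2$. For $u=(u_1,u_2)\in(\mathbb R_{>0})^2$ put $N(u)=u_1^2u_2^2$. An Arakelov divisor of $F$ is a pair $D=(I,u)$ with $I$ a (nonzero) fractional ideal of $F$ and $u\in(\mathbb R_{>0})^2$; divisors form a group under componentwise multiplication (written additively). The degree is $\deg(D)=\log(N(u)N(I))$, so degree $0$ means $N(u)N(I)=1$. For $f\in F^*$ the principal divisor is $(f)=(f^{-1}O_F,(|\sigma(f)|,|\sigma'(f)|))$, which has degree $0$. $\mathrm{Pic}_F^0$ is the group of degree $0$ Arakelov divisors modulo principal divisors. For $D=(I,u)$ and $f\in I$ put $\|f\|_D^2=\|uf\|^2=2u_1^2|\sigma(f)|^2+2u_2^2|\sigma'(f)|^2$, and $$k^0(D)=\sum_{f\in I}e^{-\pi\|f\|_D^2},\qquad h^0(D)=\log k^0(D).$$ These depend only on the class of $D$ in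 $\mathrm{Pic}_F^0$. $D_0=(O_F,1)$ with $1=(1,1)$. *)

theory Defs
  imports
    "HOL-Analysis.Analysis"
    "HOL-Algebra.Coset"
    "HOL-Computational_Algebra.Polynomial"
begin

section \<open>Field extensions and rings of integers\<close>

text \<open>A number field is represented by a type of class \<^class>\<open>field_char_0\<close>, and an extension
  of fields by a unital ring homomorphism between two such types (automatically injective).\<close>

definition field_embedding :: "('k::field \<Rightarrow> 'a::field) \<Rightarrow> bool" where
  "field_embedding \<phi> \<longleftrightarrow>
     \<phi> 1 = 1 \<and> (\<forall>x y. \<phi> (x + y) = \<phi> x + \<phi> y) \<and> (\<forall>x y. \<phi> (x * y) = \<phi> x * \<phi> y)"

text \<open>The degree of the target over the source. By the convention for \<^const>\<open>vector_space.dim\<close>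
  it is 0 if the extension is infinite, so a positive value includes finiteness. The degree of
  \<open>'a\<close> over the rationals is the case \<open>\<phi> = of_rat\<close>.\<close>

definition extension_degree :: "('k::field \<Rightarrow> 'a::field) \<Rightarrow> nat" where
  "extension_degree \<phi> = vector_space.dim (\<lambda>c x. \<phi> c * x) (UNIV :: 'a set)"

definition ring_of_integers :: "'a::field_char_0 set" where
  "ring_of_integers = {x. algebraic_int x}"


section \<open>Fractional ideals\<close>

definition fractional_ideal :: "'a::field_char_0 set \<Rightarrow> bool" where
  "fractional_ideal I \<longleftrightarrow>
     0 \<in> I \<and> (\<forall>x\<in>I. \<forall>y\<in>I. x + y \<in> I) \<and> (\<forall>a\<in>ring_of_integers. \<forall>x\<in>I. a * x \<in> I) \<and>
     I \<noteq> {0} \<and> (\<exists>d\<in>ring_of_integers. d \<noteq> 0 \<and> (*) d ` I \<subseteq> ring_of_integers)"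

definition ideal_product :: "'a::field_char_0 set \<Rightarrow> 'a set \<Rightarrow> 'a set" where
  "ideal_product I J = {\<Sum>k<n. x k * y k | (n::nat) x y. \<forall>k<n. x k \<in> I \<and> y k \<in> J}"

text \<open>The norm of an integral ideal is the number of its cosets in the ring of integers.\<close>

definition integral_ideal_norm :: "'a::field_char_0 set \<Rightarrow> nat" where
  "integral_ideal_norm J = card ((\<lambda>x. (+) x ` J) ` ring_of_integers)"

text \<open>The multiplicative extension to fractional ideals: \<open>N(I) = N(dI) / N(dO)\<close> for any nonzero
  integral \<open>d\<close> with \<open>dI\<close> integral; the value does not depend on the choice of \<open>d\<close>.\<close>

definition ideal_norm :: "'a::field_char_0 set \<Rightarrow> real" where
  "ideal_norm I =
     (let d = (SOME d. d \<in> ring_of_integers \<and> d \<noteq> 0 \<and> (*) d ` I \<subseteq> ring_of_integers)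
      in real (integral_ideal_norm ((*) d ` I)) /
         real (integral_ideal_norm ((*) d ` ring_of_integers)))"


section \<open>Arakelov divisors of a totally complex quartic field\<close>

text \<open>Throughout, \<open>\<sigma>\<close> and \<open>\<sigma>'\<close> are embeddings into the complex numbers representing the two
  infinite primes. A divisor \<open>(I, u)\<close> is encoded as \<open>(I, u\<^sub>1, u\<^sub>2)\<close>.\<close>

type_synonym 'a divisor = "'a set \<times> real \<times> real"

fun degree_divisor :: "'a::field_char_0 divisor \<Rightarrow> real" where
  "degree_divisor (I, u1, u2) = ln ((u1\<^sup>2 * u2\<^sup>2) * ideal_norm I)"

fun divisor_mult :: "'a::field_char_0 divisor \<Rightarrow> 'a divisor \<Rightarrow> 'a divisor" where
  "divisor_mult (I, u1, u2) (J, v1, v2) = (ideal_product I J, u1 * v1, u2 * v2)"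

definition trivial_divisor :: "'a::field_char_0 divisor" where
  "trivial_divisor = (ring_of_integers, 1, 1)"

definition arakelov_divisors :: "'a::field_char_0 divisor monoid" where
  "arakelov_divisors =
     \<lparr>carrier = {(I, u1, u2). fractional_ideal I \<and> u1 > 0 \<and> u2 > 0},
      mult = divisor_mult, one = trivial_divisor\<rparr>"

definition arakelov_divisors0 :: "'a::field_char_0 divisor monoid" where
  "arakelov_divisors0 =
     arakelov_divisors\<lparr>carrier := {D \<in> carrier arakelov_divisors. degree_divisor D = 0}\<rparr>"

definition principal_divisor ::
  "('a::field_char_0 \<Rightarrow> complex) \<Rightarrow> ('a \<Rightarrow> complex) \<Rightarrow> 'a \<Rightarrow> 'a divisor" where
  "principal_divisor \<sigma> \<sigma>' f = ((*) (inverse f) ` ring_of_integers, cmod (\<sigma> f), cmod (\<sigma>' f))"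

definition principal_divisors ::
  "('a::field_char_0 \<Rightarrow> complex) \<Rightarrow> ('a \<Rightarrow> complex) \<Rightarrow> 'a divisor set" where
  "principal_divisors \<sigma> \<sigma>' = principal_divisor \<sigma> \<sigma>' ` {f. f \<noteq> 0}"

definition Pic0 ::
  "('a::field_char_0 \<Rightarrow> complex) \<Rightarrow> ('a \<Rightarrow> complex) \<Rightarrow> 'a divisor set monoid" where
  "Pic0 \<sigma> \<sigma>' = arakelov_divisors0 Mod principal_divisors \<sigma> \<sigma>'"

definition divisor_class ::
  "('a::field_char_0 \<Rightarrow> complex) \<Rightarrow> ('a \<Rightarrow> complex) \<Rightarrow> 'a divisor \<Rightarrow> 'a divisor set" where
  "divisor_class \<sigma> \<sigma>' D = principal_divisors \<sigma> \<sigma>' #>\<^bsub>arakelov_divisors0\<^esub> D"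


section \<open>The function $h^0$\<close>

text \<open>The norm of the Arakelov setting on \<open>F \<otimes> \<real> = \<complex>\<^sup>2\<close>; note the weights 2, which the library
  norm on pairs lacks.\<close>

definition FR_norm :: "complex \<times> complex \<Rightarrow> real" where
  "FR_norm x = sqrt (2 * (cmod (fst x))\<^sup>2 + 2 * (cmod (snd x))\<^sup>2)"

fun divisor_norm ::
  "('a::field_char_0 \<Rightarrow> complex) \<Rightarrow> ('a \<Rightarrow> complex) \<Rightarrow> 'a divisor \<Rightarrow> 'a \<Rightarrow> real" where
  "divisor_norm \<sigma> \<sigma>' (I, u1, u2) f =
     FR_norm (complex_of_real u1 * \<sigma> f, complex_of_real u2 * \<sigma>' f)"

definition k0 ::
  "('a::field_char_0 \<Rightarrow> complex) \<Rightarrow> ('a \<Rightarrow> complex) \<Rightarrow> 'a divisor \<Rightarrow> real" where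
  "k0 \<sigma> \<sigma>' D = (\<Sum>\<^sub>\<infinity>f\<in>fst D. exp (- pi * (divisor_norm \<sigma> \<sigma>' D f)\<^sup>2))"

definition h0 ::
  "('a::field_char_0 \<Rightarrow> complex) \<Rightarrow> ('a \<Rightarrow> complex) \<Rightarrow> 'a divisor \<Rightarrow> real" where
  "h0 \<sigma> \<sigma>' D = ln (k0 \<sigma> \<sigma>' D)"

text \<open>The induced function on classes: \<^const>\<open>h0\<close> is constant on a class, and its value there is
  the value at any representative; see \<open>h0_Pic_divisor_class\<close> below.\<close>

definition h0_Pic ::
  "('a::field_char_0 \<Rightarrow> complex) \<Rightarrow> ('a \<Rightarrow> complex) \<Rightarrow> 'a divisor set \<Rightarrow> real" where
  "h0_Pic \<sigma> \<sigma>' C = the_elem (h0 \<sigma> \<sigma>' ` C)"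

lemma carrier_Pic0: "carrier (Pic0 \<sigma> \<sigma>') = divisor_class \<sigma> \<sigma>' ` carrier arakelov_divisors0"
  by (simp add: Pic0_def divisor_class_def[abs_def] carrier_FactGroup)

lemma one_in_ring_of_integers: "1 \<in> ring_of_integers"
  by (simp add: ring_of_integers_def)

lemma ideal_product_principal:
  assumes zero: "0 \<in> I" and add: "\<forall>x\<in>I. \<forall>y\<in>I. x + y \<in> I"
    and scale: "\<forall>a\<in>ring_of_integers. \<forall>x\<in>I. a * x \<in> I"
  shows "ideal_product ((*) g ` ring_of_integers) I = (*) g ` I"
proof (intro equalityI subsetI)
  fix z assume "z \<in> ideal_product ((*) g ` ring_of_integers) I"
  then obtain n :: nat and x y where z: "z = (\<Sum>k<n. x k * y k)"
    and xy: "\<forall>k<n. x k \<in> (*) g ` ring_of_integers \<and> y k \<in> I"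
    unfolding ideal_product_def by blast
  have "(\<Sum>k<m. x k * y k) \<in> (*) g ` I" if "m \<le> n" for m
    using that
  proof (induction m)
    case 0
    then show ?case using zero by force
  next
    case (Suc m)
    then obtain s where s: "s \<in> I" "(\<Sum>k<m. x k * y k) = g * s" by auto
    obtain a where a: "a \<in> ring_of_integers" "x m = g * a"
      using xy Suc.prems by (metis Suc_le_lessD image_iff)
    have "s + a * y m \<in> I" using s a xy Suc.prems add scale by auto
    moreover have "(\<Sum>k<Suc m. x k * y k) = g * (s + a * y m)"
      using s a by (simp add: algebra_simps)
    ultimately show ?case by blast
  qed
  then show "z \<in> (*) g ` I" using z by blast
next
  fix z assume "z \<in> (*) g ` I"
  then obtain s where s: "s \<in> I" "z = g * s" by auto
  have "g \<in> (*) g ` ring_of_integers"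
    using one_in_ring_of_integers by force
  then show "z \<in> ideal_product ((*) g ` ring_of_integers) I"
    unfolding ideal_product_def using s
    by (intro CollectI exI[of _ "Suc 0"] exI[of _ "\<lambda>_. g"] exI[of _ "\<lambda>_. s"]) auto
qed

lemma divisor_class_eq:
  assumes "(I, u1, u2) \<in> carrier arakelov_divisors0"
  shows "divisor_class \<sigma> \<sigma>' (I, u1, u2) =
    (\<lambda>f. ((*) (inverse f) ` I, cmod (\<sigma> f) * u1, cmod (\<sigma>' f) * u2)) ` {f. f \<noteq> 0}"
proof -
  have "fractional_ideal I"
    using assms by (simp add: arakelov_divisors0_def arakelov_divisors_def)
  then have "ideal_product ((*) g ` ring_of_integers) I = (*) g ` I" for g
    by (intro ideal_product_principal) (auto simp: fractional_ideal_def)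
  then show ?thesis
    by (auto simp: divisor_class_def r_coset_def principal_divisors_def principal_divisor_def
        arakelov_divisors0_def arakelov_divisors_def image_iff)
qed

lemma field_embedding_nonzero:
  assumes "field_embedding \<phi>" "x \<noteq> 0"
  shows "\<phi> x \<noteq> 0" "\<phi> (inverse x * y) = \<phi> y / \<phi> x"
proof -
  have "\<phi> x * \<phi> (inverse x) = 1"
    using assms by (metis field_embedding_def right_inverse)
  moreover have "\<phi> (inverse x * y) = \<phi> (inverse x) * \<phi> y"
    using assms by (simp add: field_embedding_def)
  ultimately show "\<phi> x \<noteq> 0" "\<phi> (inverse x * y) = \<phi> y / \<phi> x"
    by (auto simp: divide_inverse inverse_unique)
qed

lemma h0_principal_shift:
  assumes "field_embedding \<sigma>" "field_embedding \<sigma>'" "f \<noteq> 0"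
  shows "h0 \<sigma> \<sigma>' ((*) (inverse f) ` I, cmod (\<sigma> f) * u1, cmod (\<sigma>' f) * u2) =
    h0 \<sigma> \<sigma>' (I, u1, u2)"
proof -
  have inj: "inj_on ((*) (inverse f)) I" using assms(3) by (auto simp: inj_on_def)
  have "cmod (\<sigma> f) \<noteq> 0" "cmod (\<sigma>' f) \<noteq> 0"
    using field_embedding_nonzero(1)[OF _ assms(3)] assms(1,2) by auto
  then have "divisor_norm \<sigma> \<sigma>' (J, cmod (\<sigma> f) * u1, cmod (\<sigma>' f) * u2) (inverse f * g) =
      divisor_norm \<sigma> \<sigma>' (I, u1, u2) g" for g J
    using field_embedding_nonzero(2)[OF assms(1,3), of g] field_embedding_nonzero(2)[OF assms(2,3), of g]
    by (simp add: FR_norm_def norm_mult norm_divide)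
  then show ?thesis
    by (simp add: h0_def k0_def infsum_reindex[OF inj] o_def del: divisor_norm.simps)
qed

lemma h0_Pic_divisor_class:
  assumes "field_embedding \<sigma>" "field_embedding \<sigma>'" "D \<in> carrier arakelov_divisors0"
  shows "h0_Pic \<sigma> \<sigma>' (divisor_class \<sigma> \<sigma>' D) = h0 \<sigma> \<sigma>' D"
proof -
  obtain I u1 u2 where D: "D = (I, u1, u2)" by (cases D) auto
  have "h0 \<sigma> \<sigma>' ` divisor_class \<sigma> \<sigma>' D = (\<lambda>f. h0 \<sigma> \<sigma>' D) ` {f::'a. f \<noteq> 0}"
    unfolding D divisor_class_eq[OF assms(3)[unfolded D]] image_image
    by (intro image_cong refl h0_principal_shift) (use assms in auto)
  also have "\<dots> = {h0 \<sigma> \<sigma>' D}" using image_constant[of "1::'a" "{f. f \<noteq> 0}"] by simp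
  finally show ?thesis by (simp add: h0_Pic_def)
qed

lemma one_Pic0: "\<one>\<^bsub>Pic0 \<sigma> \<sigma>'\<^esub> = principal_divisors \<sigma> \<sigma>'"
  by (simp add: Pic0_def)

end

theory Submission
  imports Defs "Jordan_Normal_Form.Char_Poly"
begin

text \<open>Up to the common factor \<open>exp (- 4 \<pi>)\<close>, which is the term of the shortest vectors of the trivial
  divisor, \<open>k\<^sup>0\<close> of \<open>(I, u)\<close> exceeds 1 by the sum of \<open>exp (- 2 \<pi> (Q x - 2))\<close> over \<open>x \<noteq> 0\<close> in \<open>I\<close>, where
  \<open>Q x = u\<^sub>1\<^sup>2 |\<sigma> x|\<^sup>2 + u\<^sub>2\<^sup>2 |\<sigma>' x|\<^sup>2 \<ge> 2\<close> by the arithmetic-geometric mean inequality. At most 30 vectors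
  have \<open>Q < 4\<close> (reduce modulo \<open>2I\<close>), and similar counts modulo \<open>mI\<close> make the rest negligible. If
  \<open>Q \<ge> 5/2\<close> throughout, this is already too small. Otherwise a shortest vector \<open>f\<close> has index less than 2 in
  \<open>I\<close>, so \<open>I = f O\<close>, and the divisor may be taken to be \<open>(O, (p, 1/p)\<^sup>1\<^sup>/\<^sup>2)\<close> with 1 a shortest vector.

  The subfield enters through the involution \<open>\<tau>\<close> of \<open>F\<close> over \<open>K\<close>, which exchanges the two primes: averaging
  over \<open>\<tau>\<close> cancels the effect of \<open>p\<close> to first order in \<open>ln p\<close>, and it remains to compare, with
  \<open>p + 1/p = 2 (1 + d)\<close>, the loss \<open>1 - exp (- 4 \<pi> d)\<close> of each root of unity with the gains of the other
  short elements. Since \<open>K\<close> is imaginary quadratic, a unit of infinite order has trace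
  \<open>A = |\<sigma> x|\<^sup>2 + |\<sigma>' x|\<^sup>2\<close> equal to \<open>(1 + \<surd>13)/2\<close> (and then there are six roots of unity), \<open>1 + \<surd>2\<close>, or
  at least 2.56, so that the gain of a fundamental unit and its inverse never outweighs that loss.\<close>

section \<open>Algebraic integers\<close>

text \<open>To leading order in \<open>d\<close> a root of unity loses 4 pi d, while a unit of trace
  A and its inverse gain (4 pi^2 (A^2 - 4) - 2 pi A) exp(-2 pi (A - 2)) d each. At A = (1 + sqrt 13)
  / 2 the two gains come to about 11.0 against 12.6, which leaves about 1.5 d per root of unity to
  pay for all other elements. Two roots of unity would not cover the counts used here; the six that
  accompany this A do. These margins dictate the precision of the constants. The cut at
  \<open>d\<close> = 3/100 separates the range where only bounds proportional to \<open>d\<close>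
  can succeed from the one where the loss exceeds a fixed amount. For the two smallest traces
  \<open>d\<close> cannot be large, since minimality of 1 against a unit of trace A forces 4 (1 +
  d)^2 \<le> A + 2. The lattice counts rest on exact indices. Packing and covering by four
  independent integers give these up to a constant factor, and multiplicativity under powers removes
  the factor.\<close>

lemma algebraic_int_eigenvalue:
  fixes x :: "'a::field_char_0" and v :: "nat \<Rightarrow> 'a" and A :: "nat \<Rightarrow> nat \<Rightarrow> int"
  assumes v: "\<exists>i<n. v i \<noteq> 0"
    and A: "\<And>i. i < n \<Longrightarrow> x * v i = (\<Sum>j<n. of_int (A i j) * v j)"
  shows "algebraic_int x"
proof -
  define M where "M = mat n n (\<lambda>(i, j). A i j)"
  define M' where "M' = map_mat (of_int :: int \<Rightarrow> 'a) M"
  define w where "w = vec n v"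
  have M: "M \<in> carrier_mat n n" and M': "M' \<in> carrier_mat n n"
    by (auto simp: M_def M'_def)
  have "M' *\<^sub>v w = x \<cdot>\<^sub>v w"
    by (rule eq_vecI)
      (use A in \<open>auto simp: M'_def M_def w_def scalar_prod_def lessThan_atLeast0 intro!: sum.cong\<close>)
  moreover have "w \<noteq> 0\<^sub>v n"
    using v by (auto simp: w_def vec_eq_iff)
  ultimately have "eigenvalue M' x"
    unfolding eigenvalue_def eigenvector_def using M'
    by (intro exI[of _ w]) (auto simp: w_def)
  then have "poly (char_poly M') x = 0"
    using eigenvalue_root_char_poly[OF M'] by simp
  moreover have "char_poly M' = map_poly of_int (char_poly M)"
    unfolding M'_def using of_int_hom.char_poly_hom[OF M] by simp
  moreover have "lead_coeff (char_poly M) = 1"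
    using degree_monic_char_poly[OF M] by simp
  ultimately show ?thesis
    unfolding algebraic_int_altdef_ipoly by metis
qed

text \<open>Multiplication by \<open>x\<close> maps the Z-span of the finite family \<open>v\<close>
  into itself. For a fixed family this is closed under sums and products, which is how sums and
  products of algebraic integers are reached.\<close>

definition acts_integrally :: "'i set \<Rightarrow> ('i \<Rightarrow> 'a::comm_ring_1) \<Rightarrow> 'a \<Rightarrow> bool" where
  "acts_integrally I v x \<longleftrightarrow> (\<exists>A. \<forall>i\<in>I. x * v i = (\<Sum>j\<in>I. of_int (A i j) * v j))"

lemma acts_integrally_imp_algebraic_int:
  fixes x :: "'a::field_char_0"
  assumes "finite I" "i0 \<in> I" "v i0 \<noteq> 0" "acts_integrally I v x"
  shows "algebraic_int x"
proof -
  obtain A where A: "\<And>i. i \<in> I \<Longrightarrow> x * v i = (\<Sum>j\<in>I. of_int (A i j) * v j)"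
    using assms(4) by (auto simp: acts_integrally_def)
  obtain h where h: "bij_betw h {..<card I} I"
    using ex_bij_betw_nat_finite[OF assms(1)] by (auto simp: lessThan_atLeast0)
  show ?thesis
  proof (rule algebraic_int_eigenvalue[of "card I" "v \<circ> h" x "\<lambda>i j. A (h i) (h j)"])
    show "\<exists>i<card I. (v \<circ> h) i \<noteq> 0"
      using assms(2,3) bij_betw_imp_surj_on[OF h] by (metis comp_apply imageE lessThan_iff)
    show "x * (v \<circ> h) i = (\<Sum>j<card I. of_int (A (h i) (h j)) * (v \<circ> h) j)" if "i < card I" for i
      using A[of "h i"] that h sum.reindex_bij_betw[OF h, of "\<lambda>j. of_int (A (h i) j) * v j"]
      by (auto simp: bij_betw_def)
  qed
qed

lemma acts_integrally_add:
  assumes "acts_integrally I v x" "acts_integrally I v y"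
  shows "acts_integrally I v (x + y)"
proof -
  obtain A B where "\<And>i. i \<in> I \<Longrightarrow> x * v i = (\<Sum>j\<in>I. of_int (A i j) * v j)"
    "\<And>i. i \<in> I \<Longrightarrow> y * v i = (\<Sum>j\<in>I. of_int (B i j) * v j)"
    using assms by (auto simp: acts_integrally_def)
  then show ?thesis
    unfolding acts_integrally_def
    by (intro exI[of _ "\<lambda>i j. A i j + B i j"]) (auto simp: algebra_simps sum.distrib)
qed

lemma acts_integrally_mult:
  assumes "acts_integrally I v x" "acts_integrally I v y"
  shows "acts_integrally I v (x * y)"
proof -
  obtain A B where A: "\<And>i. i \<in> I \<Longrightarrow> x * v i = (\<Sum>j\<in>I. of_int (A i j) * v j)"
    and B: "\<And>i. i \<in> I \<Longrightarrow> y * v i = (\<Sum>j\<in>I. of_int (B i j) * v j)"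
    using assms by (auto simp: acts_integrally_def)
  have "x * y * v i = (\<Sum>k\<in>I. of_int (\<Sum>j\<in>I. B i j * A j k) * v k)" if "i \<in> I" for i
  proof -
    have "x * y * v i = (\<Sum>j\<in>I. of_int (B i j) * (x * v j))"
      using B[OF that] by (simp add: mult.assoc sum_distrib_left) (simp add: algebra_simps)
    also have "\<dots> = (\<Sum>j\<in>I. \<Sum>k\<in>I. of_int (B i j * A j k) * v k)"
      using A by (auto simp: sum_distrib_left mult.assoc intro!: sum.cong)
    also have "\<dots> = (\<Sum>k\<in>I. of_int (\<Sum>j\<in>I. B i j * A j k) * v k)"
      by (subst sum.swap) (simp add: sum_distrib_right)
    finally show ?thesis .
  qed
  then show ?thesis
    unfolding acts_integrally_def by (intro exI[of _ "\<lambda>i k. \<Sum>j\<in>I. B i j * A j k"]) auto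
qed

text \<open>Only the exponent of \<open>x\<close> must be reduced, by the monic equation of
  \<open>x\<close>, so any number \<open>k\<close> of powers of \<open>y\<close> can be carried
  along. The two orders of the index pair allow the result to be applied to \<open>x\<close> and to
  \<open>y\<close> on one common family x^i y^j.\<close>

lemma acts_integrally_powers:
  fixes x y :: "'a::field_char_0"
  assumes "algebraic_int x"
  obtains m where "m > 0"
    "\<And>k. acts_integrally ({..<m} \<times> {..<k::nat}) (\<lambda>(i, j). x ^ i * y ^ j) x"
    "\<And>k. acts_integrally ({..<k::nat} \<times> {..<m}) (\<lambda>(i, j). y ^ i * x ^ j) x"
proof -
  obtain p where p: "poly (map_poly of_int p) x = 0" "lead_coeff p = 1"
    using assms algebraic_int_altdef_ipoly by blast
  define m where "m = degree p"
  have deg: "degree (map_poly of_int p :: 'a poly) = m"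
    unfolding m_def by (simp add: degree_map_poly)
  have m: "m > 0"
  proof (rule ccontr)
    assume "\<not> m > 0"
    then have "p = 1" using p(2) m_def by (metis degree_eq_zeroE gr0I lead_coeff_pCons(2) one_pCons)
    then show False using p(1) by (simp add: map_poly_1)
  qed
  have top: "x ^ m = (\<Sum>l<m. of_int (- coeff p l) * x ^ l)"
  proof -
    have "0 = (\<Sum>l\<le>m. of_int (coeff p l) * x ^ l)"
      using p(1) by (simp add: poly_altdef degree_map_poly coeff_map_poly m_def)
    also have "\<dots> = (\<Sum>l<m. of_int (coeff p l) * x ^ l) + x ^ m"
      using p(2) by (simp add: lessThan_Suc_atMost[symmetric] m_def)
    finally show ?thesis by (simp add: sum_negf eq_neg_iff_add_eq_0 add.commute)
  qed
  \<comment> \<open>The companion matrix of \<open>p\<close>: a shift, except in the last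
    row.\<close>
  define c where "c i l = (if Suc i < m then if l = Suc i then 1 else 0 else - coeff p l)" for i l
  have step: "x * x ^ i = (\<Sum>l<m. of_int (c i l) * x ^ l)" if "i < m" for i
  proof (cases "Suc i < m")
    case True
    then have "(\<Sum>l<m. of_int (c i l) * x ^ l) = (\<Sum>l<m. if l = Suc i then x ^ l else 0)"
      by (intro sum.cong) (auto simp: c_def)
    then show ?thesis using True by simp
  next
    case False
    then have "x * x ^ i = x ^ m" using that by (metis Suc_lessI power_Suc)
    then show ?thesis using False top by (simp add: c_def)
  qed
  have "x * (x ^ i * y ^ j) =
      (\<Sum>(l, j')\<in>{..<m} \<times> {..<k}. of_int (if j' = j then c i l else 0) * (x ^ l * y ^ j'))"
    if "i < m" "j < k" for i j k
  proof -
    have "(\<Sum>(l, j')\<in>{..<m} \<times> {..<k}. of_int (if j' = j then c i l else 0) * (x ^ l * y ^ j')) =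
        (\<Sum>l<m. \<Sum>j'<k. if j' = j then of_int (c i l) * (x ^ l * y ^ j') else 0)"
      by (subst sum.cartesian_product[symmetric]) (intro sum.cong refl, simp)
    also have "\<dots> = (\<Sum>l<m. of_int (c i l) * x ^ l) * y ^ j"
      using that by (simp add: sum_distrib_right mult.assoc)
    finally show ?thesis using step[OF that(1)] by (simp add: mult.assoc)
  qed
  note X = this
  have "x * (y ^ j * x ^ i) =
      (\<Sum>(j', l)\<in>{..<k} \<times> {..<m}. of_int (if j' = j then c i l else 0) * (y ^ j' * x ^ l))"
    if "i < m" "j < k" for i j k
  proof -
    have "(\<Sum>(j', l)\<in>{..<k} \<times> {..<m}. of_int (if j' = j then c i l else 0) * (y ^ j' * x ^ l)) =
        (\<Sum>j'<k. \<Sum>l<m. of_int (if j' = j then c i l else 0) * (y ^ j' * x ^ l))"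
      by (subst sum.cartesian_product[symmetric]) (auto intro!: sum.cong)
    also have "\<dots> = (\<Sum>l<m. \<Sum>j'<k. if j' = j then of_int (c i l) * (y ^ j' * x ^ l) else 0)"
      by (subst sum.swap) (auto intro!: sum.cong)
    also have "\<dots> = (\<Sum>l<m. of_int (c i l) * x ^ l) * y ^ j"
      using that by (simp add: sum_distrib_left mult_ac)
    finally show ?thesis using step[OF that(1)] by (simp add: mult_ac)
  qed
  note Y = this
  show thesis
  proof (rule that[OF m])
    show "acts_integrally ({..<m} \<times> {..<k::nat}) (\<lambda>(i, j). x ^ i * y ^ j) x" for k
      unfolding acts_integrally_def
      by (rule exI[of _ "\<lambda>(i, j) (l, j'). if j' = j then c i l else 0"])
        (use X in \<open>auto simp: case_prod_unfold cong: if_cong\<close>)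
    show "acts_integrally ({..<k::nat} \<times> {..<m}) (\<lambda>(i, j). y ^ i * x ^ j) x" for k
      unfolding acts_integrally_def
      by (rule exI[of _ "\<lambda>(j, i) (j', l). if j' = j then c i l else 0"])
        (use Y in \<open>auto simp: case_prod_unfold cong: if_cong\<close>)
  qed
qed

lemma
  fixes x y :: "'a::field_char_0"
  assumes "algebraic_int x" "algebraic_int y"
  shows algebraic_int_add: "algebraic_int (x + y)"
    and algebraic_int_mult: "algebraic_int (x * y)"
proof -
  obtain m where m: "m > 0"
    "\<And>k. acts_integrally ({..<m} \<times> {..<k::nat}) (\<lambda>(i, j). x ^ i * y ^ j) x"
    using acts_integrally_powers[OF assms(1)] by metis
  obtain k where k: "k > 0"
    "\<And>m. acts_integrally ({..<m::nat} \<times> {..<k}) (\<lambda>(i, j). x ^ i * y ^ j) y"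
    using acts_integrally_powers[OF assms(2)] by metis
  have fin: "finite ({..<m} \<times> {..<k})" "(0, 0) \<in> {..<m} \<times> {..<k}"
    "(\<lambda>(i, j). x ^ i * y ^ j) (0, 0) \<noteq> 0"
    using m k by auto
  note xy = m(2)[of k] k(2)[of m]
  show "algebraic_int (x + y)" "algebraic_int (x * y)"
    using acts_integrally_imp_algebraic_int[OF fin acts_integrally_add[OF xy]]
      acts_integrally_imp_algebraic_int[OF fin acts_integrally_mult[OF xy]] by auto
qed

section \<open>The quadratic extension and its involution\<close>

lemma field_embedding_simps:
  fixes \<phi> :: "'k::field \<Rightarrow> 'a::field"
  assumes "field_embedding \<phi>"
  shows "\<phi> 0 = 0" "\<phi> 1 = 1" "\<phi> (x + y) = \<phi> x + \<phi> y" "\<phi> (x * y) = \<phi> x * \<phi> y"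
    "\<phi> (- x) = - \<phi> x" "\<phi> (x - y) = \<phi> x - \<phi> y" "\<phi> (inverse x) = inverse (\<phi> x)"
    "\<phi> (x ^ n) = \<phi> x ^ n" "\<phi> x = 0 \<longleftrightarrow> x = 0" "\<phi> x = \<phi> y \<longleftrightarrow> x = y"
    "\<phi> (of_nat m) = of_nat m" "\<phi> (of_int z) = of_int z" "\<phi> (numeral k) = numeral k"
proof -
  have add: "\<phi> (x + y) = \<phi> x + \<phi> y" and mult: "\<phi> (x * y) = \<phi> x * \<phi> y" and 1: "\<phi> 1 = 1" for x y
    using assms by (auto simp: field_embedding_def)
  have 0: "\<phi> 0 = 0" by (metis add add_0_right add_cancel_right_right)
  have neg: "\<phi> (- x) = - \<phi> x" for x
    using add[of x "- x"] 0 by (simp add: eq_neg_iff_add_eq_0 add.commute)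
  have diff: "\<phi> (x - y) = \<phi> x - \<phi> y" for x y
    using add[of x "- y"] neg by simp
  have zero: "\<phi> x = 0 \<longleftrightarrow> x = 0" for x
    using field_embedding_nonzero(1)[OF assms, of x] 0 by auto
  have nat: "\<phi> (of_nat n) = of_nat n" for n
    by (induction n) (auto simp: 0 1 add)
  show "\<phi> (x + y) = \<phi> x + \<phi> y" "\<phi> (x * y) = \<phi> x * \<phi> y" "\<phi> 1 = 1" "\<phi> 0 = 0"
    "\<phi> (- x) = - \<phi> x" "\<phi> (x - y) = \<phi> x - \<phi> y" "\<phi> x = 0 \<longleftrightarrow> x = 0" "\<phi> (of_nat m) = of_nat m"
    by (fact add mult 1 0 neg diff zero nat)+
  show "\<phi> x = \<phi> y \<longleftrightarrow> x = y" using zero[of "x - y"] diff[of x y] by auto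
  show "\<phi> (inverse x) = inverse (\<phi> x)"
  proof (cases "x = 0")
    case False
    then have "\<phi> x * \<phi> (inverse x) = 1" using mult[of x "inverse x"] 1 by simp
    then show ?thesis by (metis inverse_unique)
  qed (simp add: 0)
  show "\<phi> (x ^ n) = \<phi> x ^ n" by (induction n) (auto simp: 1 mult)
  show "\<phi> (of_int z) = of_int z"
    by (cases z) (auto simp: nat neg 1 add simp flip: of_nat_Suc)
  show "\<phi> (numeral k) = numeral k" using nat[of "numeral k"] by simp
qed

lemma algebraic_int_embedding:
  fixes \<phi> :: "'a::field_char_0 \<Rightarrow> 'b::field_char_0"
  assumes "field_embedding \<phi>"
  shows "algebraic_int (\<phi> x) \<longleftrightarrow> algebraic_int x"
proof -
  note E = field_embedding_simps[OF assms]
  have sum: "\<phi> (\<Sum>i\<in>S. g i) = (\<Sum>i\<in>S. \<phi> (g i))" if "finite S" for S :: "nat set" and g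
    using that by (induction S rule: finite_induct) (auto simp: E(1,3))
  have "\<phi> (poly (map_poly of_int p) x) = poly (map_poly of_int p) (\<phi> x)" for p
    by (simp add: poly_altdef degree_map_poly coeff_map_poly sum E(4,8,12))
  then show ?thesis
    unfolding algebraic_int_altdef_ipoly by (metis E(9))
qed

lemma field_embedding_of_rat: "field_embedding (of_rat :: rat \<Rightarrow> 'a::field_char_0)"
  by (simp add: field_embedding_def of_rat_add of_rat_mult)

lemma field_embedding_rat:
  fixes \<phi> :: "'k::field_char_0 \<Rightarrow> 'a::field_char_0"
  assumes "field_embedding \<phi>"
  shows "\<phi> (of_rat q) = of_rat q"
proof (cases q)
  case (Fract a b)
  then show ?thesis
    using field_embedding_simps[OF assms] by (simp add: of_rat_rat divide_inverse)
qed

text \<open>Any element outside the base field generates; completing the square removes the linear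
  term of its equation, so that changing the sign of the generator becomes an automorphism.\<close>

lemma quadratic_extension_generator:
  fixes \<phi> :: "'k::field_char_0 \<Rightarrow> 'a::field_char_0"
  assumes emb: "field_embedding \<phi>" and deg: "extension_degree \<phi> = 2"
  obtains \<theta> d where "\<theta> \<notin> range \<phi>" "\<theta>\<^sup>2 = \<phi> d" "\<And>x. \<exists>p q. x = \<phi> p + \<phi> q * \<theta>"
proof -
  note [simp] = field_embedding_simps[OF emb]
  interpret V: vector_space "\<lambda>c x. \<phi> c * x"
    by unfold_locales (auto simp: algebra_simps)
  have dim: "V.dim (UNIV :: 'a set) = 2"
    using deg by (simp add: extension_degree_def)
  obtain B where B: "V.independent B" "V.span B = UNIV" "card B = 2"
    using V.basis_exists[of UNIV] dim by (metis top.extremum_uniqueI)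
  have finB: "finite B" using B(3) by (auto intro: card_ge_0_finite)
  have span1: "V.span {1} = range \<phi>"
    using V.span_singleton[of 1] by (auto simp: image_def)
  have "range \<phi> \<noteq> UNIV"
  proof
    assume "range \<phi> = UNIV"
    then have "V.dim (UNIV :: 'a set) \<le> card {1::'a}"
      by (intro V.dim_le_card) (use span1 in auto)
    then show False using dim by simp
  qed
  then obtain \<theta>0 where \<theta>0: "\<theta>0 \<notin> range \<phi>" by auto
  have "1 \<in> range \<phi>" by (metis \<open>\<phi> 1 = 1\<close> rangeI)
  then have ne: "\<theta>0 \<noteq> 1" using \<theta>0 by auto
  have ind: "V.independent {\<theta>0, 1}"
    by (intro V.independent_insertI) (use \<theta>0 span1 in \<open>auto simp: V.independent_empty\<close>)
  \<comment> \<open>A vector outside this span would make three independent vectors in a space with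
    a basis of two.\<close>
  have all: "x \<in> V.span {\<theta>0, 1}" for x
  proof (rule ccontr)
    assume x: "x \<notin> V.span {\<theta>0, 1}"
    then have "V.independent {x, \<theta>0, 1}" using ind by (rule V.independent_insertI)
    then have "card {x, \<theta>0, 1} \<le> card B"
      using V.independent_span_bound[OF finB, of "{x, \<theta>0, 1}"] B(2) by auto
    moreover have "x \<notin> {\<theta>0, 1}" using x V.span_base by blast
    ultimately show False using ne B(3) by auto
  qed
  have gen: "\<exists>p q. x = \<phi> p + \<phi> q * \<theta>0" for x
  proof -
    obtain k where "x - \<phi> k * \<theta>0 \<in> V.span {1}"
      using all[of x] V.span_breakdown_eq[of x \<theta>0 "{1}"] by auto
    then obtain p where "x - \<phi> k * \<theta>0 = \<phi> p" using span1 by auto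
    then show ?thesis by (metis add.commute diff_add_cancel add.commute)
  qed
  obtain p q where pq: "\<theta>0\<^sup>2 = \<phi> p + \<phi> q * \<theta>0" using gen by blast
  define \<theta> where "\<theta> = \<theta>0 - \<phi> (q / 2)"
  have q2: "\<phi> q = 2 * \<phi> (q / 2)"
    using \<open>\<And>x y. \<phi> (x * y) = \<phi> x * \<phi> y\<close>[of 2 "q / 2"] by simp
  show thesis
  proof
    show "\<theta> \<notin> range \<phi>"
    proof
      assume "\<theta> \<in> range \<phi>"
      then obtain c where "\<theta>0 - \<phi> (q / 2) = \<phi> c" by (auto simp: \<theta>_def)
      then have "\<theta>0 = \<phi> (c + q / 2)" by (simp add: algebra_simps)
      then show False using \<theta>0 by blast
    qed
    have "\<theta>\<^sup>2 = \<theta>0\<^sup>2 - 2 * \<phi> (q / 2) * \<theta>0 + \<phi> (q / 2) * \<phi> (q / 2)"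
      by (simp add: \<theta>_def power2_eq_square algebra_simps)
    also have "\<dots> = \<phi> (p + q / 2 * (q / 2))"
      by (simp only: field_embedding_simps(3,4)[OF emb] pq q2) (simp add: algebra_simps)
    finally show "\<theta>\<^sup>2 = \<phi> (p + q / 2 * (q / 2))" .
    show "\<exists>p q. x = \<phi> p + \<phi> q * \<theta>" for x
    proof -
      obtain a b where "x = \<phi> a + \<phi> b * \<theta>0" using gen by blast
      then have "x = \<phi> (a + b * (q / 2)) + \<phi> b * \<theta>"
        by (simp only: \<theta>_def field_embedding_simps(3,4)[OF emb]) (simp add: algebra_simps)
      then show ?thesis by blast
    qed
  qed
qed

lemma quadratic_extension_unique:
  fixes \<phi> :: "'k::field_char_0 \<Rightarrow> 'a::field_char_0"
  assumes emb: "field_embedding \<phi>" and \<theta>: "\<theta> \<notin> range \<phi>"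
    and eq: "\<phi> p + \<phi> q * \<theta> = \<phi> p' + \<phi> q' * \<theta>"
  shows "p = p'" "q = q'"
proof -
  note [simp] = field_embedding_simps[OF emb]
  show "q = q'"
  proof (rule ccontr)
    assume "q \<noteq> q'"
    moreover have "(\<phi> q - \<phi> q') * \<theta> = \<phi> p' - \<phi> p"
      using eq by (simp add: algebra_simps)
    ultimately have "\<theta> = (\<phi> p' - \<phi> p) * inverse (\<phi> q - \<phi> q')"
      by (simp add: field_simps)
    then have "\<theta> = \<phi> ((p' - p) * inverse (q - q'))"
      by (simp only: field_embedding_simps[OF emb])
    then show False using \<theta> by blast
  qed
  then show "p = p'" using eq by simp
qed

text \<open>The generator has a rational square and a nonreal image, so its image is purely
  imaginary, and complex conjugation acts on the image of K as the sign change of the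
  generator.\<close>

lemma imaginary_quadratic_conjugation:
  fixes \<rho> :: "'k::field_char_0 \<Rightarrow> complex"
  assumes deg: "extension_degree (of_rat :: rat \<Rightarrow> 'k) = 2"
    and emb: "field_embedding \<rho>" and nonreal: "\<not> range \<rho> \<subseteq> \<real>"
  obtains \<eta> r where "\<eta> \<notin> range of_rat" "\<eta>\<^sup>2 = of_rat r" "\<And>x. \<exists>p q. x = of_rat p + of_rat q * \<eta>"
    "\<And>p q. cnj (\<rho> (of_rat p + of_rat q * \<eta>)) = \<rho> (of_rat p - of_rat q * \<eta>)"
proof -
  note [simp] = field_embedding_simps[OF emb] field_embedding_rat[OF emb]
  obtain \<eta> r where \<eta>: "\<eta> \<notin> range (of_rat :: rat \<Rightarrow> 'k)" "\<eta>\<^sup>2 = of_rat r"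
    "\<And>x. \<exists>p q. x = of_rat p + of_rat q * \<eta>"
    using quadratic_extension_generator[OF field_embedding_of_rat deg] by metis
  have [simp]: "complex_of_real (real_of_rat q) = of_rat q" for q
    by (cases q) (simp add: of_rat_rat)
  have cr: "cnj (of_rat q) = of_rat q" for q
    by (metis complex_cnj_complex_of_real \<open>\<And>q. complex_of_real (real_of_rat q) = of_rat q\<close>)
  have sq: "(\<rho> \<eta>)\<^sup>2 = complex_of_real (of_rat r)"
    using \<eta>(2) by (metis \<open>\<And>q. complex_of_real (real_of_rat q) = of_rat q\<close> emb field_embedding_rat field_embedding_simps(8))
  have notreal: "\<rho> \<eta> \<notin> \<real>"
  proof
    assume real: "\<rho> \<eta> \<in> \<real>"
    have "\<rho> x \<in> \<real>" for x
    proof -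
      obtain p q where "x = of_rat p + of_rat q * \<eta>" using \<eta>(3) by blast
      then have "\<rho> x = complex_of_real (of_rat p) + complex_of_real (of_rat q) * \<rho> \<eta>" by simp
      then show ?thesis using real by (metis Reals_add Reals_mult Reals_of_real)
    qed
    then show False using nonreal by auto
  qed
  have "Im ((\<rho> \<eta>)\<^sup>2) = 0" by (simp only: sq Im_complex_of_real)
  then have "Re (\<rho> \<eta>) = 0"
    using notreal by (auto simp: power2_eq_square complex_is_Real_iff)
  then have "cnj (\<rho> \<eta>) = - \<rho> \<eta>" by (simp add: complex_eq_iff)
  then have "cnj (\<rho> (of_rat p + of_rat q * \<eta>)) = \<rho> (of_rat p - of_rat q * \<eta>)" for p q
    by (simp add: cr)
  then show thesis using that \<eta> by blast
qed

text \<open>Composing \<sigma> with \<tau> gives the second prime only up to complex conjugation;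
  hence \<open>cmod_\<sigma>'\<close> speaks of absolute values. \<open>integral_basis\<close>
  provides four integers that form a basis of F over the rationals; they may generate a proper
  subgroup of the ring of integers.\<close>

locale quadratic_over_imaginary_quadratic =
  fixes \<iota> :: "'k::field_char_0 \<Rightarrow> 'a::field_char_0"
    and \<sigma> \<sigma>' :: "'a \<Rightarrow> complex" and \<tau> :: "'a \<Rightarrow> 'a"
  assumes emb: "field_embedding \<iota>" "field_embedding \<sigma>" "field_embedding \<sigma>'" "field_embedding \<tau>"
    and \<tau>_\<tau>: "\<tau> (\<tau> x) = x" and \<tau>_\<iota>: "\<tau> (\<iota> c) = \<iota> c"
    and trace_in: "x + \<tau> x \<in> range \<iota>" and norm_in: "x * \<tau> x \<in> range \<iota>"
    and cmod_\<sigma>': "cmod (\<sigma>' x) = cmod (\<sigma> (\<tau> x))"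
    and cnj_in: "\<exists>c'. \<sigma> (\<iota> c') = cnj (\<sigma> (\<iota> c))"
    and abs_rat: "(cmod (\<sigma> (\<iota> c)))\<^sup>2 \<in> \<rat>" and Re_rat: "2 * Re (\<sigma> (\<iota> c)) \<in> \<rat>"
    and integral_basis: "\<exists>b::nat \<Rightarrow> 'a. (\<forall>i<4. algebraic_int (b i)) \<and>
      (\<forall>x. \<exists>q::nat \<Rightarrow> rat. x = (\<Sum>i<4. of_rat (q i) * b i)) \<and>
      (\<forall>z::nat \<Rightarrow> int. (\<Sum>i<4. of_int (z i) * b i) = 0 \<longrightarrow> (\<forall>i<4. z i = 0))"

lemma algebraic_int_denominator_rat: "\<exists>m::nat. m > 0 \<and> of_nat m * (of_rat q :: 'a::field_char_0) \<in> \<int>"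
proof (cases q)
  case (Fract a b)
  then have "of_nat (nat b) * (of_rat q :: 'a) = of_int a"
    by (simp add: of_rat_rat)
  then show ?thesis using Fract(2) by (intro exI[of _ "nat b"]) auto
qed

lemma algebraic_int_of_square:
  fixes x :: "'a::field_char_0"
  assumes "algebraic_int (x\<^sup>2)" shows "algebraic_int x"
proof (rule algebraic_int_root[OF assms])
  show "poly (monom 1 2) x = x\<^sup>2" by (simp add: poly_monom)
  show "\<forall>i. coeff (monom (1::'a) 2) i \<in> \<int>" by (simp add: coeff_monom)
  show "lead_coeff (monom (1::'a) 2) = 1" "degree (monom (1::'a) 2) > 0"
    by (simp_all add: degree_monom_eq)
qed

theorem quadratic_over_imaginary_quadratic_exists:
  fixes \<iota> :: "'k::field_char_0 \<Rightarrow> 'a::field_char_0"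
    and \<sigma> \<sigma>' :: "'a \<Rightarrow> complex"
  assumes K_quadratic: "extension_degree (of_rat :: rat \<Rightarrow> 'k) = 2"
    and K_complex: "\<And>\<tau> :: 'k \<Rightarrow> complex. field_embedding \<tau> \<Longrightarrow> \<not> range \<tau> \<subseteq> \<real>"
    and F_over_K: "field_embedding \<iota>" "extension_degree \<iota> = 2"
    and infinite_primes: "field_embedding \<sigma>" "field_embedding \<sigma>'" "\<sigma>' \<noteq> \<sigma>" "\<sigma>' \<noteq> cnj \<circ> \<sigma>"
  shows "\<exists>\<tau>. quadratic_over_imaginary_quadratic \<iota> \<sigma> \<sigma>' \<tau>"
proof -
  note I = field_embedding_simps[OF F_over_K(1)] field_embedding_rat[OF F_over_K(1)]
  note S = field_embedding_simps[OF infinite_primes(1)] field_embedding_rat[OF infinite_primes(1)]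
  note S' = field_embedding_simps[OF infinite_primes(2)] field_embedding_rat[OF infinite_primes(2)]
  have emb\<rho>: "field_embedding (\<lambda>x. \<sigma> (\<iota> x))"
    by (simp add: field_embedding_def S I)
  obtain \<eta> r where \<eta>: "\<eta> \<notin> range (of_rat :: rat \<Rightarrow> 'k)" "\<eta>\<^sup>2 = of_rat r"
    "\<And>x. \<exists>p q. x = of_rat p + of_rat q * \<eta>"
    "\<And>p q. cnj (\<sigma> (\<iota> (of_rat p + of_rat q * \<eta>))) = \<sigma> (\<iota> (of_rat p - of_rat q * \<eta>))"
    using imaginary_quadratic_conjugation[OF K_quadratic emb\<rho> K_complex[OF emb\<rho>]] by metis
  obtain \<theta> d where \<theta>: "\<theta> \<notin> range \<iota>" "\<theta>\<^sup>2 = \<iota> d" "\<And>x. \<exists>p q. x = \<iota> p + \<iota> q * \<theta>"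
    using quadratic_extension_generator[OF F_over_K] by metis
  obtain P Q where PQ: "\<And>x. x = \<iota> (P x) + \<iota> (Q x) * \<theta>" using \<theta>(3) by metis
  define \<tau> where "\<tau> x = \<iota> (P x) - \<iota> (Q x) * \<theta>" for x
  have \<tau>: "\<tau> (\<iota> p + \<iota> q * \<theta>) = \<iota> p - \<iota> q * \<theta>" for p q
    using quadratic_extension_unique[OF F_over_K(1) \<theta>(1) PQ[of "\<iota> p + \<iota> q * \<theta>"]]
    by (simp add: \<tau>_def)
  have \<tau>\<iota>: "\<tau> (\<iota> c) = \<iota> c" for c using \<tau>[of c 0] by (simp add: I)
  have \<tau>\<tau>: "\<tau> (\<tau> x) = x" for x
    using \<tau>[of "P x" "- Q x"] PQ[of x] by (simp add: I \<tau>_def[of x])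
  have mult: "(\<iota> p + \<iota> q * \<theta>) * (\<iota> p' + \<iota> q' * \<theta>) =
      \<iota> (p * p' + q * q' * d) + \<iota> (p * q' + q * p') * \<theta>" for p q p' q'
  proof -
    have "(\<iota> p + \<iota> q * \<theta>) * (\<iota> p' + \<iota> q' * \<theta>) =
        \<iota> p * \<iota> p' + \<iota> q * \<iota> q' * \<theta>\<^sup>2 + (\<iota> p * \<iota> q' + \<iota> q * \<iota> p') * \<theta>"
      by (simp add: power2_eq_square algebra_simps)
    then show ?thesis by (simp add: \<theta>(2) I)
  qed
  have mult': "(\<iota> p - \<iota> q * \<theta>) * (\<iota> p' - \<iota> q' * \<theta>) =
      \<iota> (p * p' + q * q' * d) - \<iota> (p * q' + q * p') * \<theta>" for p q p' q'
    using mult[of p "- q" p' "- q'"] by (simp add: I algebra_simps)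
  have add: "\<iota> p + \<iota> q * \<theta> + (\<iota> p' + \<iota> q' * \<theta>) = \<iota> (p + p') + \<iota> (q + q') * \<theta>" for p q p' q'
    by (simp add: I algebra_simps)
  have emb\<tau>: "field_embedding \<tau>"
    unfolding field_embedding_def
  proof (intro conjI allI)
    show "\<tau> 1 = 1" using \<tau>\<iota>[of 1] by (simp add: I)
    fix x y
    obtain p q p' q' where xy: "x = \<iota> p + \<iota> q * \<theta>" "y = \<iota> p' + \<iota> q' * \<theta>" using \<theta>(3) by metis
    show "\<tau> (x * y) = \<tau> x * \<tau> y" unfolding xy mult \<tau> mult' ..
    show "\<tau> (x + y) = \<tau> x + \<tau> y" unfolding xy add \<tau> by (simp add: I algebra_simps)
  qed
  have trace: "x + \<tau> x \<in> range \<iota>" for x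
  proof -
    have "x + \<tau> x = \<iota> (P x + P x)" by (subst PQ[of x]) (simp add: I \<tau>_def)
    then show ?thesis by blast
  qed
  have norm: "x * \<tau> x \<in> range \<iota>" for x
  proof -
    have "x * \<tau> x = \<iota> (P x * P x - Q x * Q x * d)"
      using mult[of "P x" "Q x" "P x" "- Q x"] PQ[of x] by (simp add: I \<tau>_def)
    then show ?thesis by blast
  qed
  have cmod': "cmod (\<sigma>' x) = cmod (\<sigma> (\<tau> x))" for x
  proof -
    \<comment> \<open>An embedding that agrees with \<sigma> on K sends the square root \<theta> to
      plus or minus its image under \<sigma>; the minus sign is composition with \<tau>.\<close>
    have twist: "\<rho> = (\<lambda>x. \<sigma> (\<tau> x))"
      if "field_embedding \<rho>" "\<rho> \<noteq> \<sigma>" "\<And>c. \<rho> (\<iota> c) = \<sigma> (\<iota> c)" for \<rho>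
    proof -
      note R = field_embedding_simps[OF that(1)]
      have "(\<rho> \<theta>)\<^sup>2 = (\<sigma> \<theta>)\<^sup>2"
        using that(3)[of d] by (metis R(8) S(8) \<theta>(2))
      then have "\<rho> \<theta> = \<sigma> \<theta> \<or> \<rho> \<theta> = - \<sigma> \<theta>" by (simp add: power2_eq_iff)
      moreover have "\<rho> \<theta> \<noteq> \<sigma> \<theta>"
      proof
        assume "\<rho> \<theta> = \<sigma> \<theta>"
        then have "\<rho> x = \<sigma> x" for x
          by (subst (1 2) PQ[of x]) (simp add: R S that(3))
        then show False using that(2) by auto
      qed
      ultimately have neg: "\<rho> \<theta> = - \<sigma> \<theta>" by simp
      have "\<rho> x = \<sigma> (\<tau> x)" for x
        by (subst PQ[of x]) (simp add: R S that(3) neg \<tau>_def)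
      then show ?thesis by auto
    qed
    have "(\<sigma>' (\<iota> \<eta>))\<^sup>2 = (\<sigma> (\<iota> \<eta>))\<^sup>2"
      using \<eta>(2) by (metis I(8) S(8) S'(8) I(14) S(14) S'(14))
    then consider "\<sigma>' (\<iota> \<eta>) = \<sigma> (\<iota> \<eta>)" | "\<sigma>' (\<iota> \<eta>) = - \<sigma> (\<iota> \<eta>)" by (auto simp: power2_eq_iff)
    then show ?thesis
    proof cases
      case 1
      have "\<sigma>' (\<iota> c) = \<sigma> (\<iota> c)" for c
        using \<eta>(3)[of c] 1 by (auto simp: I S S')
      then have "\<sigma>' = (\<lambda>x. \<sigma> (\<tau> x))" using twist infinite_primes by blast
      then show ?thesis by simp
    next
      case 2
      \<comment> \<open>Here \<sigma>' restricts to the conjugate of \<sigma> on K, so it is the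
        conjugate of \<sigma>' that equals \<sigma> composed with \<tau>.\<close>
      have "(cnj \<circ> \<sigma>') (\<iota> c) = \<sigma> (\<iota> c)" for c
      proof -
        obtain p q where c: "c = of_rat p + of_rat q * \<eta>" using \<eta>(3) by blast
        have "\<sigma>' (\<iota> c) = cnj (\<sigma> (\<iota> c))"
          unfolding c \<eta>(4) by (simp add: I S S' 2)
        then show ?thesis by simp
      qed
      moreover have "field_embedding (cnj \<circ> \<sigma>')"
        by (simp add: field_embedding_def S')
      moreover have "cnj \<circ> \<sigma>' \<noteq> \<sigma>" using infinite_primes(4) by (auto simp: comp_def)
      ultimately have "cnj \<circ> \<sigma>' = (\<lambda>x. \<sigma> (\<tau> x))" using twist by blast
      then show ?thesis by (metis comp_apply complex_mod_cnj)
    qed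
  qed
  have cnj_in: "\<exists>c'. \<sigma> (\<iota> c') = cnj (\<sigma> (\<iota> c))" for c
    using \<eta>(3)[of c] \<eta>(4) by metis
  have rat: "x \<in> \<rat>" if x: "complex_of_real x \<in> \<rat>" for x
  proof -
    obtain q where "complex_of_real x = of_rat q" using x by (elim Rats_cases)
    also have "\<dots> = complex_of_real (of_rat q)" by (cases q) (simp add: of_rat_rat)
    finally show ?thesis by (simp only: of_real_eq_iff Rats_of_rat)
  qed
  have KR: "(cmod (\<sigma> (\<iota> c)))\<^sup>2 \<in> \<rat> \<and> 2 * Re (\<sigma> (\<iota> c)) \<in> \<rat>" for c
  proof -
    obtain p q where c: "c = of_rat p + of_rat q * \<eta>" using \<eta>(3) by blast
    have "of_real ((cmod (\<sigma> (\<iota> c)))\<^sup>2) = \<sigma> (\<iota> c) * cnj (\<sigma> (\<iota> c))"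
      using complex_norm_square[of "\<sigma> (\<iota> c)"] by simp
    also have "\<dots> = \<sigma> (\<iota> (of_rat p * of_rat p - of_rat q * of_rat q * \<eta>\<^sup>2))"
      unfolding c \<eta>(4) by (simp add: I S power2_eq_square algebra_simps)
    also have "\<dots> = of_rat (p * p - q * q * r)"
      unfolding \<eta>(2) by (simp add: I S of_rat_mult of_rat_diff)
    finally have 1: "complex_of_real ((cmod (\<sigma> (\<iota> c)))\<^sup>2) \<in> \<rat>" by simp
    have "complex_of_real (2 * Re (\<sigma> (\<iota> c))) = \<sigma> (\<iota> c) + cnj (\<sigma> (\<iota> c))"
      by (simp add: complex_eq_iff)
    also have "\<dots> = of_rat (p + p)"
      unfolding c \<eta>(4) of_rat_add by (simp add: I S)
    finally have 2: "complex_of_real (2 * Re (\<sigma> (\<iota> c))) \<in> \<rat>" by (metis Rats_of_rat)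
    show ?thesis using rat[OF 1] rat[OF 2] by blast
  qed
  \<comment> \<open>Used for the radicand \<open>d\<close> and for \<eta>: if m d is integral, so is
    (m \<theta>)^2 = m (m d), and with it m \<theta>.\<close>
  have scaleK: "\<exists>m::nat. m > 0 \<and> algebraic_int (of_nat m * c)" for c :: 'k
  proof -
    obtain p q where c: "c = of_rat p + of_rat q * \<eta>" using \<eta>(3) by blast
    obtain m1 :: nat where m1: "m1 > 0" "of_nat m1 * (of_rat p :: 'k) \<in> \<int>"
      using algebraic_int_denominator_rat by blast
    obtain m2 :: nat where m2: "m2 > 0" "of_nat m2 * (of_rat q :: 'k) \<in> \<int>"
      using algebraic_int_denominator_rat by blast
    obtain m3 :: nat where m3: "m3 > 0" "of_nat m3 * (of_rat r :: 'k) \<in> \<int>"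
      using algebraic_int_denominator_rat by blast
    have "(of_nat m3 * \<eta>)\<^sup>2 = of_nat m3 * (of_nat m3 * of_rat r)"
      by (simp only: power_mult_distrib \<eta>(2)) (simp add: power2_eq_square)
    also have "\<dots> \<in> \<int>" using m3(2) by simp
    finally have \<eta>int: "algebraic_int (of_nat m3 * \<eta>)"
      by (rule algebraic_int_of_square[OF int_imp_algebraic_int])
    have "of_nat (m1 * m2 * m3) * c =
        of_nat (m2 * m3) * (of_nat m1 * of_rat p) + (of_nat m1 * (of_nat m2 * of_rat q)) * (of_nat m3 * \<eta>)"
      by (simp add: c algebra_simps)
    moreover have "algebraic_int (of_nat (m2 * m3) * (of_nat m1 * of_rat p) +
        (of_nat m1 * (of_nat m2 * of_rat q)) * (of_nat m3 * \<eta>))"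
      by (rule algebraic_int_add[OF int_imp_algebraic_int algebraic_int_mult[OF int_imp_algebraic_int \<eta>int]])
        (use m1 m2 in auto)
    ultimately have "algebraic_int (of_nat (m1 * m2 * m3) * c)" by (simp only:)
    then show ?thesis using m1 m2 m3 by (intro exI[of _ "m1 * m2 * m3"]) auto
  qed
  obtain m where m: "m > 0" "algebraic_int (of_nat m * d)" using scaleK by blast
  obtain n where n: "n > 0" "algebraic_int (of_nat n * \<eta>)" using scaleK by blast
  define \<theta>1 where "\<theta>1 = of_nat m * \<theta>"
  define \<eta>1 where "\<eta>1 = of_nat n * \<eta>"
  have "\<theta>1\<^sup>2 = of_nat m * \<iota> (of_nat m * d)"
    by (simp add: \<theta>1_def power_mult_distrib \<theta>(2) I) (simp add: power2_eq_square)
  moreover have "algebraic_int (of_nat m * \<iota> (of_nat m * d))"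
    using algebraic_int_embedding[OF F_over_K(1)] m(2)
    by (intro algebraic_int_mult) (auto intro: int_imp_algebraic_int)
  ultimately have \<theta>1: "algebraic_int \<theta>1" by (metis algebraic_int_of_square)
  have \<eta>1: "algebraic_int (\<iota> \<eta>1)"
    using algebraic_int_embedding[OF F_over_K(1)] n by (simp add: \<eta>1_def)
  define b where "b i = [1, \<iota> \<eta>1, \<theta>1, \<iota> \<eta>1 * \<theta>1] ! i" for i
  have sum4: "(\<Sum>i<4. f i) = f 0 + f 1 + f 2 + f (3::nat)" for f :: "nat \<Rightarrow> 'a"
    by (simp add: eval_nat_numeral)
  have b: "b 0 = 1" "b (Suc 0) = \<iota> \<eta>1" "b 2 = \<theta>1" "b 3 = \<iota> \<eta>1 * \<theta>1"
    by (simp_all add: b_def)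
  have "algebraic_int (b i)" if "i < 4" for i
  proof -
    have "i = 0 \<or> i = Suc 0 \<or> i = 2 \<or> i = 3" using that by auto
    then show ?thesis using \<theta>1 \<eta>1 b algebraic_int_mult[OF \<eta>1 \<theta>1]
      by (auto intro: int_imp_algebraic_int)
  qed
  moreover have "\<exists>q::nat \<Rightarrow> rat. x = (\<Sum>i<4. of_rat (q i) * b i)" for x
  proof -
    obtain p q where "P x = of_rat p + of_rat q * \<eta>" using \<eta>(3) by blast
    moreover obtain p' q' where "Q x = of_rat p' + of_rat q' * \<eta>" using \<eta>(3) by blast
    ultimately have x: "x = \<iota> (of_rat p + of_rat q * \<eta>) + \<iota> (of_rat p' + of_rat q' * \<eta>) * \<theta>"
      using PQ[of x] by simp
    define Q where "Q i = [p, q / of_nat n, p' / of_nat m, q' / (of_nat n * of_nat m)] ! i" for i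
    have Q: "Q 0 = p" "Q (Suc 0) = q / of_nat n" "Q 2 = p' / of_nat m" "Q 3 = q' / (of_nat n * of_nat m)"
      by (simp_all add: Q_def)
    have "x = (\<Sum>i<4. of_rat (Q i) * b i)"
      using m n unfolding sum4
      by (simp add: b Q x I \<theta>1_def \<eta>1_def of_rat_divide of_rat_mult algebra_simps)
    then show ?thesis by blast
  qed
  moreover have "\<forall>i<4. z i = 0" if "(\<Sum>i<4. of_int (z i) * b i) = 0" for z :: "nat \<Rightarrow> int"
  proof -
    have ir: "of_int k = (of_rat (of_int k) :: 'k)" for k by simp
    have "\<iota> (of_int (z 0) + of_int (z 1) * \<eta>1) + \<iota> (of_int (z 2) * of_nat m + of_int (z 3) * \<eta>1 * of_nat m) * \<theta> =
        \<iota> 0 + \<iota> 0 * \<theta>"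
      using that unfolding sum4 by (simp add: b I \<theta>1_def algebra_simps)
    from quadratic_extension_unique[OF F_over_K(1) \<theta>(1) this]
    have e: "of_int (z 0) + of_int (z 1) * \<eta>1 = 0"
      "(of_int (z 2) + of_int (z 3) * \<eta>1) * of_nat m = 0"
      by (simp_all add: algebra_simps)
    have zero: "u = 0 \<and> v = 0" if "of_int u + of_int v * \<eta>1 = 0" for u v
    proof -
      have "of_rat (of_int u) + of_rat (of_int v * of_nat n) * \<eta> = of_rat 0 + of_rat 0 * \<eta>"
        using that by (simp add: \<eta>1_def of_rat_mult algebra_simps)
      from quadratic_extension_unique[OF field_embedding_of_rat \<eta>(1) this] show ?thesis
        using n by auto
    qed
    have "z 0 = 0 \<and> z 1 = 0" "z 2 = 0 \<and> z 3 = 0"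
      using zero e m by auto
    moreover have "i = 0 \<or> i = Suc 0 \<or> i = 2 \<or> i = 3" if "i < 4" for i :: nat using that by auto
    ultimately show ?thesis by force
  qed
  ultimately have basis: "\<exists>b::nat \<Rightarrow> 'a. (\<forall>i<4. algebraic_int (b i)) \<and>
      (\<forall>x. \<exists>q::nat \<Rightarrow> rat. x = (\<Sum>i<4. of_rat (q i) * b i)) \<and>
      (\<forall>z::nat \<Rightarrow> int. (\<Sum>i<4. of_int (z i) * b i) = 0 \<longrightarrow> (\<forall>i<4. z i = 0))"
    by blast
  have "quadratic_over_imaginary_quadratic \<iota> \<sigma> \<sigma>' \<tau>"
    by unfold_locales
      (use F_over_K infinite_primes emb\<tau> \<tau>\<tau> \<tau>\<iota> trace norm cmod' cnj_in KR basis in auto)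
  then show ?thesis by blast
qed

section \<open>Indices of additive subgroups\<close>

definition additive_subgroup :: "'a::ab_group_add set \<Rightarrow> bool" where
  "additive_subgroup A \<longleftrightarrow> 0 \<in> A \<and> (\<forall>x\<in>A. \<forall>y\<in>A. x - y \<in> A)"

text \<open>The index is 0 if there are infinitely many cosets.\<close>

definition coset_index :: "'a::ab_group_add set \<Rightarrow> 'a set \<Rightarrow> nat" where
  "coset_index A B = card ((\<lambda>x. (+) x ` B) ` A)"

lemma additive_subgroup_uminus: "additive_subgroup A \<Longrightarrow> x \<in> A \<Longrightarrow> - x \<in> A"
  by (metis additive_subgroup_def diff_0)

lemma additive_subgroup_add: "additive_subgroup A \<Longrightarrow> x \<in> A \<Longrightarrow> y \<in> A \<Longrightarrow> x + y \<in> A"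
  by (metis additive_subgroup_def additive_subgroup_uminus diff_minus_eq_add)

lemma additive_subgroup_scale:
  fixes g :: "'a::ring"
  assumes A: "additive_subgroup A"
  shows "additive_subgroup ((*) g ` A)"
  unfolding additive_subgroup_def
proof (intro conjI ballI)
  have "g * 0 \<in> (*) g ` A" using A unfolding additive_subgroup_def by blast
  then show "0 \<in> (*) g ` A" by simp
  fix x y assume "x \<in> (*) g ` A" "y \<in> (*) g ` A"
  then obtain u v where "u \<in> A" "v \<in> A" "x = g * u" "y = g * v" by blast
  moreover from this have "u - v \<in> A" using A unfolding additive_subgroup_def by blast
  ultimately show "x - y \<in> (*) g ` A" by (metis image_eqI right_diff_distrib)
qed

lemma coset_eq_iff:
  assumes "additive_subgroup B"
  shows "(+) x ` B = (+) y ` B \<longleftrightarrow> x - y \<in> B"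
proof
  assume "(+) x ` B = (+) y ` B"
  moreover have "x \<in> (+) x ` B" using assms by (force simp: additive_subgroup_def)
  ultimately obtain z where "z \<in> B" "x = y + z" by auto
  then show "x - y \<in> B" by simp
next
  assume *: "x - y \<in> B"
  have "(+) x ` B \<subseteq> (+) y ` B" if "x - y \<in> B" for x y
  proof
    fix w assume "w \<in> (+) x ` B"
    then obtain z where z: "z \<in> B" "w = x + z" by auto
    have "w = y + ((x - y) + z)" using z by simp
    then show "w \<in> (+) y ` B" using additive_subgroup_add[OF assms that z(1)] by blast
  qed
  moreover have "y - x \<in> B" using additive_subgroup_uminus[OF assms *] by simp
  ultimately show "(+) x ` B = (+) y ` B" using * by blast
qed

lemma coset_representatives:
  assumes "additive_subgroup B"
  obtains R where "R \<subseteq> A" "\<And>x. x \<in> A \<Longrightarrow> \<exists>r\<in>R. x - r \<in> B"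
    "\<And>r r'. r \<in> R \<Longrightarrow> r' \<in> R \<Longrightarrow> r - r' \<in> B \<Longrightarrow> r = r'" "card R = coset_index A B"
proof -
  define rep where "rep = inv_into A (\<lambda>x. (+) x ` B)"
  define R where "R = rep ` ((\<lambda>x. (+) x ` B) ` A)"
  have inj: "inj_on rep ((\<lambda>x. (+) x ` B) ` A)"
    unfolding rep_def by (rule inj_on_inv_into) simp
  have RA: "R \<subseteq> A" unfolding R_def rep_def by (auto intro: inv_into_into)
  have coset_rep: "(+) (rep X) ` B = X" if "X \<in> (\<lambda>x. (+) x ` B) ` A" for X
    using f_inv_into_f[OF that] by (simp add: rep_def)
  show thesis
  proof (rule that[OF RA])
    show "\<exists>r\<in>R. x - r \<in> B" if x: "x \<in> A" for x
    proof -
      have "(+) x ` B = (+) (rep ((+) x ` B)) ` B" using coset_rep x by blast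
      then have "x - rep ((+) x ` B) \<in> B" using coset_eq_iff[OF assms] by blast
      then show ?thesis using x unfolding R_def by blast
    qed
    show "r = r'" if r: "r \<in> R" "r' \<in> R" "r - r' \<in> B" for r r'
    proof -
      obtain X X' where "X \<in> (\<lambda>x. (+) x ` B) ` A" "r = rep X" "X' \<in> (\<lambda>x. (+) x ` B) ` A" "r' = rep X'"
        using r(1,2) unfolding R_def by blast
      moreover have "(+) r ` B = (+) r' ` B" using r(3) coset_eq_iff[OF assms] by blast
      ultimately show ?thesis using coset_rep by metis
    qed
    show "card R = coset_index A B"
      unfolding R_def coset_index_def by (rule card_image[OF inj])
  qed
qed

text \<open>Sums of representatives of the two steps represent the cosets of the smallest group.
  Infinite indices fit in, since \<open>card\<close> is 0 on infinite sets and
  \<open>card_cartesian_product\<close> covers them.\<close>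

lemma coset_index_mult:
  assumes "additive_subgroup A" "additive_subgroup B" "additive_subgroup C" "C \<subseteq> B" "B \<subseteq> A"
  shows "coset_index A C = coset_index A B * coset_index B C"
proof -
  obtain R where R: "R \<subseteq> A" "\<And>x. x \<in> A \<Longrightarrow> \<exists>r\<in>R. x - r \<in> B"
    "\<And>r r'. r \<in> R \<Longrightarrow> r' \<in> R \<Longrightarrow> r - r' \<in> B \<Longrightarrow> r = r'" "card R = coset_index A B"
    using coset_representatives[OF assms(2)] by metis
  obtain S where S: "S \<subseteq> B" "\<And>x. x \<in> B \<Longrightarrow> \<exists>r\<in>S. x - r \<in> C"
    "\<And>r r'. r \<in> S \<Longrightarrow> r' \<in> S \<Longrightarrow> r - r' \<in> C \<Longrightarrow> r = r'" "card S = coset_index B C"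
    using coset_representatives[OF assms(3)] by metis
  have "bij_betw (\<lambda>(r, s). (+) (r + s) ` C) (R \<times> S) ((\<lambda>x. (+) x ` C) ` A)"
  proof (rule bij_betw_imageI)
    show "inj_on (\<lambda>(r, s). (+) (r + s) ` C) (R \<times> S)"
    proof (rule inj_onI, clarify)
      fix r s r' s' assume h: "r \<in> R" "s \<in> S" "r' \<in> R" "s' \<in> S"
        and "(+) (r + s) ` C = (+) (r' + s') ` C"
      then have c: "r + s - (r' + s') \<in> C" using coset_eq_iff[OF assms(3)] by blast
      have "r - r' = (r + s - (r' + s')) + (s' - s)" by simp
      moreover have "s' - s \<in> B" using h S(1) assms(2) by (auto simp: additive_subgroup_def)
      ultimately have "r - r' \<in> B" using c assms(2,4) additive_subgroup_add by (metis subsetD)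
      then have "r = r'" using R(3) h by blast
      moreover from this have "s - s' \<in> C" using c by simp
      ultimately show "r = r' \<and> s = s'" using S(3) h by blast
    qed
    show "(\<lambda>(r, s). (+) (r + s) ` C) ` (R \<times> S) = (\<lambda>x. (+) x ` C) ` A"
    proof (intro equalityI subsetI)
      fix X assume "X \<in> (\<lambda>(r, s). (+) (r + s) ` C) ` (R \<times> S)"
      then obtain r s where "r \<in> R" "s \<in> S" "X = (+) (r + s) ` C" by auto
      moreover have "r + s \<in> A" using calculation R(1) S(1) assms(1,5) additive_subgroup_add by blast
      ultimately show "X \<in> (\<lambda>x. (+) x ` C) ` A" by blast
    next
      fix X assume "X \<in> (\<lambda>x. (+) x ` C) ` A"
      then obtain x where x: "x \<in> A" "X = (+) x ` C" by blast
      obtain r where r: "r \<in> R" "x - r \<in> B" using R(2) x by blast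
      obtain s where s: "s \<in> S" "x - r - s \<in> C" using S(2) r by blast
      have "X = (+) (r + s) ` C"
        unfolding x(2) using coset_eq_iff[OF assms(3)] s by (simp add: diff_diff_eq)
      then show "X \<in> (\<lambda>(r, s). (+) (r + s) ` C) ` (R \<times> S)" using r s by blast
    qed
  qed
  then show ?thesis
    unfolding coset_index_def[of A C]
    by (metis R(4) S(4) bij_betw_same_card card_cartesian_product)
qed

lemma coset_index_scale:
  fixes g :: "'a::field"
  assumes "g \<noteq> 0"
  shows "coset_index ((*) g ` A) ((*) g ` B) = coset_index A B"
proof -
  have eq: "(+) (g * x) ` (*) g ` B = (*) g ` (+) x ` B" for x
    unfolding image_image by (simp add: distrib_left)
  have "(\<lambda>x. (+) x ` (*) g ` B) ` (*) g ` A = (\<lambda>x. (+) (g * x) ` (*) g ` B) ` A"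
    by (rule image_image)
  also have "\<dots> = (\<lambda>x. (*) g ` (+) x ` B) ` A"
    by (simp only: eq)
  also have "\<dots> = (`) ((*) g) ` ((\<lambda>x. (+) x ` B) ` A)"
    by (rule image_image[symmetric])
  finally have cosets: "(\<lambda>x. (+) x ` (*) g ` B) ` (*) g ` A = (`) ((*) g) ` ((\<lambda>x. (+) x ` B) ` A)" .
  have "inj_on ((`) ((*) g)) ((\<lambda>x. (+) x ` B) ` A)"
  proof (rule inj_onI)
    fix X Y assume "(*) g ` X = (*) g ` Y"
    then have "(*) (inverse g) ` (*) g ` X = (*) (inverse g) ` (*) g ` Y" by (rule arg_cong)
    then show "X = Y" using assms by (simp add: image_image flip: mult.assoc)
  qed
  then show ?thesis
    unfolding coset_index_def cosets by (rule card_image)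
qed

lemma coset_index_1:
  assumes "additive_subgroup A" "additive_subgroup B" "B \<subseteq> A" "coset_index A B = 1"
  shows "A = B"
proof
  show "A \<subseteq> B"
  proof
    fix x assume x: "x \<in> A"
    have 0: "0 \<in> A" using assms(1) by (simp add: additive_subgroup_def)
    obtain X where X: "(\<lambda>x. (+) x ` B) ` A = {X}"
      using assms(4) unfolding coset_index_def by (rule card_1_singletonE)
    have "(+) x ` B = X" "(+) 0 ` B = X"
      using imageI[OF x, of "\<lambda>x. (+) x ` B"] imageI[OF 0, of "\<lambda>x. (+) x ` B"] unfolding X by simp_all
    then have "(+) x ` B = (+) 0 ` B" by simp
    then show "x \<in> B" using coset_eq_iff[OF assms(2), of x 0] by simp
  qed
qed fact

lemma coset_index_upper:
  assumes "additive_subgroup B" "finite S" "\<And>x. x \<in> A \<Longrightarrow> \<exists>s\<in>S. x - s \<in> B"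
  shows "finite ((\<lambda>x. (+) x ` B) ` A)" "coset_index A B \<le> card S"
proof -
  have sub: "(\<lambda>x. (+) x ` B) ` A \<subseteq> (\<lambda>x. (+) x ` B) ` S"
  proof
    fix X assume "X \<in> (\<lambda>x. (+) x ` B) ` A"
    then obtain x where x: "x \<in> A" "X = (+) x ` B" by blast
    then obtain y where y: "y \<in> S" "x - y \<in> B" using assms(3) by blast
    then have "X = (+) y ` B" unfolding x(2) by (simp only: coset_eq_iff[OF assms(1)])
    then show "X \<in> (\<lambda>x. (+) x ` B) ` S" using y(1) by (rule image_eqI)
  qed
  then show "finite ((\<lambda>x. (+) x ` B) ` A)" using assms(2) by (meson finite_imageI finite_subset)
  show "coset_index A B \<le> card S"
    unfolding coset_index_def using sub assms(2) by (meson card_image_le card_mono finite_imageI le_trans)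
qed

text \<open>Finiteness of the quotient is assumed because an infinite index counts as 0 and would
  bound nothing.\<close>

lemma coset_index_lower:
  assumes "additive_subgroup B" "S \<subseteq> A" "finite ((\<lambda>x. (+) x ` B) ` A)"
    "\<And>x y. x \<in> S \<Longrightarrow> y \<in> S \<Longrightarrow> x - y \<in> B \<Longrightarrow> x = y"
  shows "finite S" "card S \<le> coset_index A B"
proof -
  have inj: "inj_on (\<lambda>x. (+) x ` B) S"
    using assms(4) coset_eq_iff[OF assms(1)] by (auto simp: inj_on_def)
  have sub: "(\<lambda>x. (+) x ` B) ` S \<subseteq> (\<lambda>x. (+) x ` B) ` A" using assms(2) by blast
  show "finite S" by (rule inj_on_finite[OF inj sub assms(3)])
  show "card S \<le> coset_index A B"
    unfolding coset_index_def by (rule card_inj_on_le[OF inj sub assms(3)])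
qed

text \<open>The power trick: otherwise (x / y)^k would outgrow every constant. It turns lossy
  packing and covering estimates for indices into exact ones.\<close>

lemma le_of_power_le:
  fixes x y C :: real
  assumes "x \<ge> 0" "y > 0" "\<And>k::nat. x ^ k \<le> C * y ^ k"
  shows "x \<le> y"
proof (rule ccontr)
  assume "\<not> x \<le> y"
  then have "x / y > 1" using assms by simp
  then obtain k where "C < (x / y) ^ k" using real_arch_pow by blast
  then have "C * y ^ k < x ^ k" using assms(2) by (simp add: power_divide field_simps)
  then show False using assms(3)[of k] by simp
qed

section \<open>Norms, principal ideals and their indices\<close>

lemma ring_of_integers_closed:
  fixes x y :: "'a::field_char_0"
  shows "x \<in> ring_of_integers \<Longrightarrow> y \<in> ring_of_integers \<Longrightarrow> x + y \<in> ring_of_integers"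
    and "x \<in> ring_of_integers \<Longrightarrow> y \<in> ring_of_integers \<Longrightarrow> x * y \<in> ring_of_integers"
    and "x \<in> ring_of_integers \<Longrightarrow> y \<in> ring_of_integers \<Longrightarrow> x - y \<in> ring_of_integers"
    and "x \<in> ring_of_integers \<Longrightarrow> - x \<in> ring_of_integers"
    and "(0::'a) \<in> ring_of_integers" "(1::'a) \<in> ring_of_integers"
    and "(of_nat n :: 'a) \<in> ring_of_integers" "(of_int z :: 'a) \<in> ring_of_integers"
    and "x \<in> ring_of_integers \<Longrightarrow> x ^ n \<in> ring_of_integers"
proof -
  show mult: "x \<in> ring_of_integers \<Longrightarrow> y \<in> ring_of_integers \<Longrightarrow> x * y \<in> ring_of_integers"
    for x y :: 'a
    by (simp add: ring_of_integers_def algebraic_int_mult)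
  show "x \<in> ring_of_integers \<Longrightarrow> y \<in> ring_of_integers \<Longrightarrow> x + y \<in> ring_of_integers"
    "x \<in> ring_of_integers \<Longrightarrow> y \<in> ring_of_integers \<Longrightarrow> x - y \<in> ring_of_integers"
    using algebraic_int_add[of x y] algebraic_int_add[of x "- y"]
    by (simp_all add: ring_of_integers_def)
  show "x \<in> ring_of_integers \<Longrightarrow> - x \<in> ring_of_integers"
    by (simp add: ring_of_integers_def)
  show "(0::'a) \<in> ring_of_integers" "(1::'a) \<in> ring_of_integers"
    "(of_nat n :: 'a) \<in> ring_of_integers" "(of_int z :: 'a) \<in> ring_of_integers"
    by (auto simp: ring_of_integers_def intro: int_imp_algebraic_int)
  show "x ^ n \<in> ring_of_integers" if "x \<in> ring_of_integers"
    using that mult by (induction n) (auto simp: ring_of_integers_def)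
qed

lemma ring_of_integers_sum:
  fixes f :: "'i \<Rightarrow> 'a::field_char_0"
  assumes "\<And>i. i \<in> S \<Longrightarrow> f i \<in> ring_of_integers"
  shows "sum f S \<in> ring_of_integers"
  using assms by (induction S rule: infinite_finite_induct) (auto intro: ring_of_integers_closed)

lemma additive_subgroup_ring_of_integers: "additive_subgroup (ring_of_integers :: 'a::field_char_0 set)"
  by (auto simp: additive_subgroup_def intro: ring_of_integers_closed)

lemma principal_ideal_subset:
  fixes g :: "'a::field_char_0"
  shows "g \<in> ring_of_integers \<Longrightarrow> (*) g ` ring_of_integers \<subseteq> ring_of_integers"
  by (auto intro: ring_of_integers_closed)

abbreviation principal_index :: "'a::field_char_0 \<Rightarrow> nat" where
  "principal_index g \<equiv> coset_index ring_of_integers ((*) g ` ring_of_integers)"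

lemma principal_index_mult:
  fixes g h :: "'a::field_char_0"
  assumes "g \<in> ring_of_integers" "h \<in> ring_of_integers" "g \<noteq> 0"
  shows "principal_index (g * h) = principal_index g * principal_index h"
proof -
  have eq: "(*) (g * h) ` ring_of_integers = (*) g ` (*) h ` ring_of_integers"
    by (simp add: image_image mult.assoc)
  have "principal_index (g * h) = principal_index g *
      coset_index ((*) g ` ring_of_integers) ((*) (g * h) ` ring_of_integers)"
    by (rule coset_index_mult)
      (use principal_ideal_subset assms in \<open>auto simp: eq intro!: additive_subgroup_scale
        additive_subgroup_ring_of_integers ring_of_integers_closed\<close>)
  then show ?thesis unfolding eq coset_index_scale[OF assms(3)] .
qed

lemma principal_index_power:
  fixes g :: "'a::field_char_0"
  assumes "g \<in> ring_of_integers" "g \<noteq> 0"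
  shows "principal_index (g ^ k) = principal_index g ^ k"
proof (induction k)
  case 0
  have "(\<lambda>x. (+) x ` (ring_of_integers :: 'a set)) ` ring_of_integers = {ring_of_integers}"
  proof -
    have "(+) x ` ring_of_integers = (+) 0 ` ring_of_integers" if "x \<in> ring_of_integers" for x :: 'a
      using that coset_eq_iff[OF additive_subgroup_ring_of_integers, of x 0] by simp
    moreover have "(+) (0::'a) ` ring_of_integers = ring_of_integers" by auto
    ultimately show ?thesis using ring_of_integers_closed(5) by (auto simp: image_iff)
  qed
  then show ?case by (simp add: coset_index_def)
next
  case (Suc k)
  then show ?case
    using principal_index_mult[OF assms(1) ring_of_integers_closed(9)[OF assms(1), of k] assms(2)] by simp
qed

section \<open>The absolute norm and the index of a principal ideal\<close>

context quadratic_over_imaginary_quadratic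
begin

lemmas \<sigma>_simps = field_embedding_simps[OF emb(2)]
lemmas \<sigma>'_simps = field_embedding_simps[OF emb(3)]
lemmas \<tau>_simps = field_embedding_simps[OF emb(4)]

text \<open>The absolute value of the norm of F over the rationals; a complex prime enters with the
  squared absolute value.\<close>

definition abs_norm :: "'a \<Rightarrow> real" where
  "abs_norm x = (cmod (\<sigma> x))\<^sup>2 * (cmod (\<sigma>' x))\<^sup>2"

lemma abs_norm_mult: "abs_norm (x * y) = abs_norm x * abs_norm y"
  by (simp add: abs_norm_def \<sigma>_simps \<sigma>'_simps norm_mult power_mult_distrib)

lemma abs_norm_power: "abs_norm (x ^ n) = abs_norm x ^ n"
proof (induction n)
  case 0
  show ?case by (simp add: abs_norm_def \<sigma>_simps \<sigma>'_simps)
qed (simp add: abs_norm_mult)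

lemma abs_norm_pos: "x \<noteq> 0 \<Longrightarrow> abs_norm x > 0"
  by (simp add: abs_norm_def \<sigma>_simps \<sigma>'_simps)

lemma \<tau>_integer: "\<tau> x \<in> ring_of_integers \<longleftrightarrow> x \<in> ring_of_integers"
  using algebraic_int_embedding[OF emb(4)] by (simp add: ring_of_integers_def)

lemma conjugate_integer:
  assumes "\<iota> c \<in> ring_of_integers"
  obtains c' where "\<iota> c' \<in> ring_of_integers" "\<sigma> (\<iota> c') = cnj (\<sigma> (\<iota> c))"
proof -
  obtain c' where c': "\<sigma> (\<iota> c') = cnj (\<sigma> (\<iota> c))" using cnj_in by blast
  have "algebraic_int (\<sigma> (\<iota> c))"
    using assms algebraic_int_embedding[OF emb(2)] by (simp add: ring_of_integers_def)
  then have "algebraic_int (\<sigma> (\<iota> c'))" unfolding c' by simp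
  then have "\<iota> c' \<in> ring_of_integers"
    using algebraic_int_embedding[OF emb(2)] unfolding ring_of_integers_def by blast
  then show thesis using that c' by blast
qed

lemma subfield_integer_abs:
  assumes "\<iota> c \<in> ring_of_integers"
  shows "(cmod (\<sigma> (\<iota> c)))\<^sup>2 \<in> \<nat>" "2 * Re (\<sigma> (\<iota> c)) \<in> \<int>"
proof -
  have int: "algebraic_int (\<sigma> (\<iota> c))"
    using assms algebraic_int_embedding[OF emb(2)] by (simp add: ring_of_integers_def)
  have "complex_of_real ((cmod (\<sigma> (\<iota> c)))\<^sup>2) = \<sigma> (\<iota> c) * cnj (\<sigma> (\<iota> c))"
    using complex_norm_square[of "\<sigma> (\<iota> c)"] by simp
  then have "algebraic_int (complex_of_real ((cmod (\<sigma> (\<iota> c)))\<^sup>2))"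
    using algebraic_int_mult[OF int] int by simp
  then have "(cmod (\<sigma> (\<iota> c)))\<^sup>2 \<in> \<int>"
    using abs_rat by (intro rational_algebraic_int_is_int) (simp_all only: algebraic_int_of_real_iff)
  then show "(cmod (\<sigma> (\<iota> c)))\<^sup>2 \<in> \<nat>"
    by (metis Nats_altdef2 mem_Collect_eq zero_le_power2)
  have "complex_of_real (2 * Re (\<sigma> (\<iota> c))) = \<sigma> (\<iota> c) + cnj (\<sigma> (\<iota> c))"
    by (simp add: complex_eq_iff)
  then have "algebraic_int (complex_of_real (2 * Re (\<sigma> (\<iota> c))))"
    using algebraic_int_add[OF int] int by simp
  then show "2 * Re (\<sigma> (\<iota> c)) \<in> \<int>"
    using Re_rat by (intro rational_algebraic_int_is_int) (simp_all only: algebraic_int_of_real_iff)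
qed

text \<open>The cofactor is the product of the other conjugates: \<tau> f times the conjugate,
  inside K, of the relative norm f \<tau> f. So every integer divides its absolute norm, which is
  therefore a natural number, and integers of norm 1 are units.\<close>

lemma integer_cofactor:
  assumes f: "f \<in> ring_of_integers"
  obtains g n where "g \<in> ring_of_integers" "f * g = of_nat n" "abs_norm f = real n"
proof -
  obtain c where c: "f * \<tau> f = \<iota> c" using norm_in by blast
  have cO: "\<iota> c \<in> ring_of_integers"
    using f unfolding c[symmetric] by (intro ring_of_integers_closed) (auto simp: \<tau>_integer)
  obtain c' where c': "\<iota> c' \<in> ring_of_integers" "\<sigma> (\<iota> c') = cnj (\<sigma> (\<iota> c))"
    using conjugate_integer[OF cO] by blast
  obtain n :: nat where n: "(cmod (\<sigma> (\<iota> c)))\<^sup>2 = real n"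
    using subfield_integer_abs(1)[OF cO] by (elim Nats_cases)
  have "\<sigma> (f * (\<tau> f * \<iota> c')) = \<sigma> (\<iota> c) * \<sigma> (\<iota> c')"
    by (simp add: \<sigma>_simps c[symmetric])
  also have "\<dots> = complex_of_real (real n)"
    unfolding c' n[symmetric] using complex_norm_square[of "\<sigma> (\<iota> c)"] by simp
  also have "\<dots> = \<sigma> (of_nat n)" by (simp add: \<sigma>_simps)
  finally have "f * (\<tau> f * \<iota> c') = of_nat n"
    unfolding field_embedding_simps(10)[OF emb(2)] .
  moreover have "abs_norm f = real n"
    by (simp add: abs_norm_def cmod_\<sigma>' n[symmetric] c[symmetric] \<sigma>_simps norm_mult power_mult_distrib)
  ultimately show thesis
    using that f c'(1) by (metis \<tau>_integer ring_of_integers_closed(2))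
qed

lemma abs_norm_integer: "f \<in> ring_of_integers \<Longrightarrow> abs_norm f \<in> \<nat>"
  using integer_cofactor by (metis of_nat_in_Nats)

lemma abs_norm_ge_1:
  assumes "f \<in> ring_of_integers" "f \<noteq> 0" shows "abs_norm f \<ge> 1"
proof -
  obtain n :: nat where "abs_norm f = real n" using abs_norm_integer[OF assms(1)] by (elim Nats_cases)
  then show ?thesis using abs_norm_pos[OF assms(2)] by simp
qed

lemma inverse_integer:
  assumes "f \<in> ring_of_integers" "abs_norm f = 1" shows "inverse f \<in> ring_of_integers"
  using integer_cofactor[OF assms(1)] assms(2) by (metis inverse_unique of_nat_1 of_nat_eq_1_iff)

lemma integer_eq_0:
  assumes "f \<in> ring_of_integers" "cmod (\<sigma> f) < 1" "cmod (\<sigma>' f) < 1" shows "f = 0"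
proof (rule ccontr)
  assume "f \<noteq> 0"
  have "(cmod (\<sigma> f))\<^sup>2 * (cmod (\<sigma>' f))\<^sup>2 < 1 * 1"
    by (intro mult_strict_mono) (use assms in \<open>auto simp: power_less_one_iff\<close>)
  then show False using abs_norm_ge_1[OF assms(1) \<open>f \<noteq> 0\<close>] by (simp add: abs_norm_def)
qed

definition bounded_integers :: "real \<Rightarrow> real \<Rightarrow> 'a set" where
  "bounded_integers r r' = {f \<in> ring_of_integers. cmod (\<sigma> f) \<le> r \<and> cmod (\<sigma>' f) \<le> r'}"

lemma floor_eq_imp_close:
  fixes x y :: real assumes "\<lfloor>2 * x\<rfloor> = \<lfloor>2 * y\<rfloor>" shows "\<bar>x - y\<bar> < 1 / 2"
  using floor_correct[of "2 * x"] floor_correct[of "2 * y"] assms by linarith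

lemma cmod_less_1:
  assumes "\<bar>Re z\<bar> < 1 / 2" "\<bar>Im z\<bar> < 1 / 2" shows "cmod z < 1"
  using cmod_le[of z] assms by linarith

text \<open>Integers are sorted into boxes of side 1/2 by their four real coordinates. Two in one
  box differ by less than 1 at both primes, hence coincide. As the radius is at least 1, a
  coordinate meets at most 4 r + 3 \<le> 7 r values, whence the factor 7^4.\<close>

lemma card_bounded_integers:
  assumes "r \<ge> 1" "r' \<ge> 1"
  shows "finite (bounded_integers r r')" "real (card (bounded_integers r r')) \<le> 7 ^ 4 * (r\<^sup>2 * r'\<^sup>2)"
proof -
  define K where "K t = \<lfloor>2 * t\<rfloor> + 1" for t :: real
  define box where "box t = {- K t..K t}" for t
  define \<Phi> where "\<Phi> f = (\<lfloor>2 * Re (\<sigma> f)\<rfloor>, \<lfloor>2 * Im (\<sigma> f)\<rfloor>, \<lfloor>2 * Re (\<sigma>' f)\<rfloor>, \<lfloor>2 * Im (\<sigma>' f)\<rfloor>)" for f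
  have inbox: "\<lfloor>2 * x\<rfloor> \<in> box t" if "\<bar>x\<bar> \<le> t" for x t
    using that unfolding box_def K_def atLeastAtMost_iff by linarith
  have sub: "\<Phi> ` bounded_integers r r' \<subseteq> box r \<times> box r \<times> box r' \<times> box r'"
    unfolding \<Phi>_def bounded_integers_def
    using abs_Re_le_cmod abs_Im_le_cmod by (auto intro!: inbox intro: order_trans)
  have inj: "inj_on \<Phi> (bounded_integers r r')"
  proof (rule inj_onI)
    fix f g assume fg: "f \<in> bounded_integers r r'" "g \<in> bounded_integers r r'" "\<Phi> f = \<Phi> g"
    have eqs: "\<lfloor>2 * Re (\<sigma> f)\<rfloor> = \<lfloor>2 * Re (\<sigma> g)\<rfloor>" "\<lfloor>2 * Im (\<sigma> f)\<rfloor> = \<lfloor>2 * Im (\<sigma> g)\<rfloor>"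
      "\<lfloor>2 * Re (\<sigma>' f)\<rfloor> = \<lfloor>2 * Re (\<sigma>' g)\<rfloor>" "\<lfloor>2 * Im (\<sigma>' f)\<rfloor> = \<lfloor>2 * Im (\<sigma>' g)\<rfloor>"
      using fg(3) by (simp_all add: \<Phi>_def)
    have "cmod (\<sigma> (f - g)) < 1" "cmod (\<sigma>' (f - g)) < 1"
      using eqs[THEN floor_eq_imp_close] unfolding \<sigma>_simps \<sigma>'_simps
      by (auto intro!: cmod_less_1)
    moreover have "f - g \<in> ring_of_integers"
      using fg by (auto simp: bounded_integers_def intro: ring_of_integers_closed)
    ultimately show "f = g" using integer_eq_0[of "f - g"] by simp
  qed
  have fin: "finite (box r \<times> box r \<times> box r' \<times> box r')" by (simp add: box_def)
  show "finite (bounded_integers r r')" by (rule inj_on_finite[OF inj sub fin])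
  have cb: "real (card (box t)) \<le> 7 * t" if "t \<ge> 1" for t
  proof -
    have "card (box t) = nat (2 * K t + 1)" by (simp add: box_def)
    then have "real (card (box t)) = 2 * of_int \<lfloor>2 * t\<rfloor> + 3" using that by (simp add: K_def)
    also have "\<dots> \<le> 2 * (2 * t) + 3" by (intro add_mono mult_left_mono) auto
    also have "\<dots> \<le> 7 * t" using that by simp
    finally show ?thesis .
  qed
  have "real (card (bounded_integers r r')) \<le> real (card (box r \<times> box r \<times> box r' \<times> box r'))"
    using card_inj_on_le[OF inj sub fin] by simp
  also have "\<dots> = real (card (box r)) * (real (card (box r)) * (real (card (box r')) * real (card (box r'))))"
    by (simp add: card_cartesian_product)
  also have "\<dots> \<le> (7 * r) * ((7 * r) * ((7 * r') * (7 * r')))"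
    by (intro mult_mono cb assms) (use assms in auto)
  also have "\<dots> = 7 ^ 4 * (r\<^sup>2 * r'\<^sup>2)" by (simp add: power2_eq_square eval_nat_numeral)
  finally show "real (card (bounded_integers r r')) \<le> 7 ^ 4 * (r\<^sup>2 * r'\<^sup>2)" .
qed

text \<open>The common bound \<open>\<rho>\<close> is stated for coefficients of any size
  \<open>s\<close>: the covering argument for upper bounds takes s = 1, the packing argument for
  lower bounds takes s = p - 1.\<close>

lemma covering_radius:
  obtains \<rho> b where "\<rho> \<ge> 1" "\<forall>i<4. b i \<in> ring_of_integers"
    "\<forall>q s. (\<forall>i<4. \<bar>real_of_rat (q i)\<bar> \<le> s) \<longrightarrow>
      cmod (\<sigma> (\<Sum>i<4. of_rat (q i) * b i)) \<le> s * \<rho> \<and> cmod (\<sigma>' (\<Sum>i<4. of_rat (q i) * b i)) \<le> s * \<rho>"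
    "\<forall>x. \<exists>q::nat \<Rightarrow> rat. x = (\<Sum>i<4. of_rat (q i) * b i)"
    "\<forall>z::nat \<Rightarrow> int. (\<Sum>i<4. of_int (z i) * b i) = 0 \<longrightarrow> (\<forall>i<4. z i = 0)"
proof -
  obtain b :: "nat \<Rightarrow> 'a" where b: "\<forall>i<4. algebraic_int (b i)"
    "\<forall>x. \<exists>q::nat \<Rightarrow> rat. x = (\<Sum>i<4. of_rat (q i) * b i)"
    "\<forall>z::nat \<Rightarrow> int. (\<Sum>i<4. of_int (z i) * b i) = 0 \<longrightarrow> (\<forall>i<4. z i = 0)"
    using integral_basis by auto
  define \<rho> where "\<rho> = 1 + (\<Sum>i<4. cmod (\<sigma> (b i))) + (\<Sum>i<4. cmod (\<sigma>' (b i)))"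
  have bound: "cmod (\<phi> (\<Sum>i<4. of_rat (q i) * b i)) \<le> s * \<rho>"
    if \<phi>: "field_embedding \<phi>" "(\<Sum>i<4. cmod (\<phi> (b i))) \<le> \<rho>"
      and q: "\<forall>i<4. \<bar>real_of_rat (q i)\<bar> \<le> s"
    for \<phi> :: "'a \<Rightarrow> complex" and q :: "nat \<Rightarrow> rat" and s :: real
  proof -
    have s: "s \<ge> 0" using order_trans[OF abs_ge_zero q[rule_format, of 0]] by simp
    have sumemb: "\<phi> (\<Sum>i<n. g i) = (\<Sum>i<n. \<phi> (g i))" for n :: nat and g
      by (induction n) (auto simp: field_embedding_simps[OF \<phi>(1)])
    have x: "cmod (\<phi> (of_rat q)) = \<bar>real_of_rat q\<bar>" for q
    proof -
      have "(of_rat q :: complex) = complex_of_real (of_rat q)"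
        by (cases q) (simp add: of_rat_rat)
      then show ?thesis by (simp only: field_embedding_rat[OF \<phi>(1)] norm_of_real)
    qed
    have "cmod (\<phi> (\<Sum>i<4. of_rat (q i) * b i)) \<le> (\<Sum>i<4. cmod (\<phi> (of_rat (q i))) * cmod (\<phi> (b i)))"
      unfolding sumemb field_embedding_simps[OF \<phi>(1)]
      by (rule order_trans[OF norm_sum]) (simp add: norm_mult)
    also have "\<dots> \<le> (\<Sum>i<4. s * cmod (\<phi> (b i)))"
      by (intro sum_mono mult_right_mono) (use x q in auto)
    also have "\<dots> = s * (\<Sum>i<4. cmod (\<phi> (b i)))" by (simp add: sum_distrib_left)
    also have "\<dots> \<le> s * \<rho>" by (intro mult_left_mono \<phi> s)
    finally show ?thesis .
  qed
  have nn: "(\<Sum>i<4. cmod (\<sigma> (b i))) \<ge> 0" "(\<Sum>i<4. cmod (\<sigma>' (b i))) \<ge> 0"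
    by (auto intro: sum_nonneg)
  show thesis
  proof (rule that[of \<rho> b])
    show "\<rho> \<ge> 1" using nn by (simp add: \<rho>_def)
    show "\<forall>i<4. b i \<in> ring_of_integers" using b(1) by (simp add: ring_of_integers_def)
    show "\<forall>q s. (\<forall>i<4. \<bar>real_of_rat (q i)\<bar> \<le> s) \<longrightarrow>
      cmod (\<sigma> (\<Sum>i<4. of_rat (q i) * b i)) \<le> s * \<rho> \<and> cmod (\<sigma>' (\<Sum>i<4. of_rat (q i) * b i)) \<le> s * \<rho>"
      using bound[OF emb(2)] bound[OF emb(3)] nn by (simp add: \<rho>_def)
  qed (fact b)+
qed

text \<open>Rounding down the coordinates of x / g gives every class modulo g a representative of
  size at most \<open>\<rho>\<close> times that of g at both primes, and such integers have been
  counted. The lower bounds on g keep both radii at least 1, as that count demands.\<close>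

lemma principal_index_bound:
  obtains C where "C > 0"
    "\<And>g. g \<in> ring_of_integers \<Longrightarrow> cmod (\<sigma> g) \<ge> 1 \<Longrightarrow> cmod (\<sigma>' g) \<ge> 1 \<Longrightarrow>
      finite ((\<lambda>x. (+) x ` (*) g ` ring_of_integers) ` ring_of_integers) \<and>
      real (principal_index g) \<le> C * abs_norm g"
proof -
  obtain \<rho> b where \<rho>: "\<rho> \<ge> 1" "\<forall>i<4. b i \<in> ring_of_integers"
    "\<forall>q s. (\<forall>i<4. \<bar>real_of_rat (q i)\<bar> \<le> s) \<longrightarrow>
      cmod (\<sigma> (\<Sum>i<4. of_rat (q i) * b i)) \<le> s * \<rho> \<and> cmod (\<sigma>' (\<Sum>i<4. of_rat (q i) * b i)) \<le> s * \<rho>"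
    "\<forall>x. \<exists>q::nat \<Rightarrow> rat. x = (\<Sum>i<4. of_rat (q i) * b i)"
    by (rule covering_radius)
  have bnd: "finite ((\<lambda>x. (+) x ` (*) g ` ring_of_integers) ` ring_of_integers) \<and>
      real (principal_index g) \<le> (7 ^ 4 * (\<rho>\<^sup>2 * \<rho>\<^sup>2)) * abs_norm g"
    if g: "g \<in> ring_of_integers" "cmod (\<sigma> g) \<ge> 1" "cmod (\<sigma>' g) \<ge> 1" for g
  proof -
    define r where "r = \<rho> * cmod (\<sigma> g)"
    define r' where "r' = \<rho> * cmod (\<sigma>' g)"
    have r: "r \<ge> 1" "r' \<ge> 1"
      unfolding r_def r'_def using mult_mono[of 1 \<rho> 1] \<rho>(1) g by fastforce+
    have g0: "g \<noteq> 0" using g(2) by (auto simp: \<sigma>_simps)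
    have rep: "\<exists>s\<in>bounded_integers r r'. x - s \<in> (*) g ` ring_of_integers"
      if x: "x \<in> ring_of_integers" for x
    proof -
      obtain q :: "nat \<Rightarrow> rat" where q: "x / g = (\<Sum>i<4. of_rat (q i) * b i)" using \<rho>(4) by blast
      define h where "h = (\<Sum>i<4. of_int \<lfloor>q i\<rfloor> * b i)"
      have h: "h \<in> ring_of_integers"
        unfolding h_def by (intro ring_of_integers_sum ring_of_integers_closed) (use \<rho>(2) in auto)
      have y: "x / g - h = (\<Sum>i<4. of_rat (frac (q i)) * b i)"
        unfolding q h_def
        by (simp add: frac_def of_rat_diff sum_subtractf left_diff_distrib)
      have "cmod (\<sigma> (x / g - h)) \<le> 1 * \<rho> \<and> cmod (\<sigma>' (x / g - h)) \<le> 1 * \<rho>"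
        unfolding y
      proof (rule \<rho>(3)[rule_format])
        show "\<bar>real_of_rat (frac (q i))\<bar> \<le> 1" for i
          using frac_ge_0[of "q i"] frac_lt_1[of "q i"] by (simp add: less_imp_le)
      qed
      moreover have "\<sigma> (x - g * h) = \<sigma> g * \<sigma> (x / g - h)" "\<sigma>' (x - g * h) = \<sigma>' g * \<sigma>' (x / g - h)"
        using g0 by (simp_all add: right_diff_distrib flip: \<sigma>_simps(4) \<sigma>'_simps(4))
      ultimately have "cmod (\<sigma> (x - g * h)) \<le> r" "cmod (\<sigma>' (x - g * h)) \<le> r'"
        unfolding r_def r'_def by (auto simp: norm_mult mult.commute[of \<rho>] intro!: mult_left_mono)
      then have "x - g * h \<in> bounded_integers r r'"
        using x g h by (auto simp: bounded_integers_def intro!: ring_of_integers_closed)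
      moreover have "x - (x - g * h) \<in> (*) g ` ring_of_integers" using h by auto
      ultimately show ?thesis by blast
    qed
    note up = coset_index_upper[where A = ring_of_integers, OF additive_subgroup_scale[OF additive_subgroup_ring_of_integers]
        card_bounded_integers(1)[OF r] rep]
    have "real (principal_index g) \<le> 7 ^ 4 * (r\<^sup>2 * r'\<^sup>2)"
      using up(2) card_bounded_integers(2)[OF r] by linarith
    then show ?thesis
      using up(1) by (simp add: r_def r'_def abs_norm_def power_mult_distrib mult_ac)
  qed
  show thesis
    by (rule that[OF _ bnd]) (use \<rho>(1) in auto)
qed

text \<open>Index and norm are both multiplicative, so the crude bound for all powers of g loses its
  constant.\<close>

lemma principal_index_le:
  assumes "g \<in> ring_of_integers" "cmod (\<sigma> g) \<ge> 1" "cmod (\<sigma>' g) \<ge> 1"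
  shows "real (principal_index g) \<le> abs_norm g"
proof -
  obtain C where C: "C > 0"
    "\<And>g. g \<in> ring_of_integers \<Longrightarrow> cmod (\<sigma> g) \<ge> 1 \<Longrightarrow> cmod (\<sigma>' g) \<ge> 1 \<Longrightarrow>
      finite ((\<lambda>x. (+) x ` (*) g ` ring_of_integers) ` ring_of_integers) \<and>
      real (principal_index g) \<le> C * abs_norm g"
    using principal_index_bound by blast
  have g0: "g \<noteq> 0" using assms(2) by (auto simp: \<sigma>_simps)
  show ?thesis
  proof (rule le_of_power_le)
    show "abs_norm g > 0" by (rule abs_norm_pos[OF g0])
    show "real (principal_index g) ^ k \<le> C * abs_norm g ^ k" for k
      using C(2)[of "g ^ k"] assms principal_index_power[OF assms(1) g0, of k]
      by (simp add: ring_of_integers_closed(9) \<sigma>_simps \<sigma>'_simps norm_power one_le_power abs_norm_power)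
  qed simp
qed

lemma finite_principal_cosets_nat:
  assumes "m > 0"
  shows "finite ((\<lambda>x. (+) x ` (*) (of_nat m) ` ring_of_integers) ` (ring_of_integers :: 'a set))"
proof -
  obtain C where "\<And>g. g \<in> ring_of_integers \<Longrightarrow> cmod (\<sigma> g) \<ge> 1 \<Longrightarrow> cmod (\<sigma>' g) \<ge> 1 \<Longrightarrow>
      finite ((\<lambda>x. (+) x ` (*) g ` ring_of_integers) ` ring_of_integers) \<and>
      real (principal_index g) \<le> C * abs_norm g"
    using principal_index_bound by blast
  from this[of "of_nat m"] show ?thesis
    using assms by (simp add: \<sigma>_simps \<sigma>'_simps ring_of_integers_closed(7))
qed

lemma abs_norm_of_nat: "abs_norm (of_nat m) = real m ^ 4"
  by (simp add: abs_norm_def \<sigma>_simps \<sigma>'_simps power2_eq_square eval_nat_numeral)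

text \<open>For the lower bound, the combinations of the four independent integers with coefficients
  below p, where p is about m / \<rho>, are pairwise incongruent modulo m. This gives away a factor
  \<rho>^4, which disappears on passing to the powers of m.\<close>

lemma principal_index_nat:
  assumes "m > 0"
  shows "principal_index (of_nat m :: 'a) = m ^ 4"
proof (rule antisym)
  have "real (principal_index (of_nat m :: 'a)) \<le> abs_norm (of_nat m)"
    by (rule principal_index_le) (use assms in \<open>auto simp: \<sigma>_simps \<sigma>'_simps ring_of_integers_closed\<close>)
  then show "principal_index (of_nat m :: 'a) \<le> m ^ 4"
    unfolding abs_norm_of_nat by (metis of_nat_le_iff of_nat_power)
  obtain \<rho> b where \<rho>: "\<rho> \<ge> 1" "\<forall>i<4. b i \<in> ring_of_integers"
    "\<forall>q s. (\<forall>i<4. \<bar>real_of_rat (q i)\<bar> \<le> s) \<longrightarrow>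
      cmod (\<sigma> (\<Sum>i<4. of_rat (q i) * b i)) \<le> s * \<rho> \<and> cmod (\<sigma>' (\<Sum>i<4. of_rat (q i) * b i)) \<le> s * \<rho>"
    "\<forall>z::nat \<Rightarrow> int. (\<Sum>i<4. of_int (z i) * b i) = 0 \<longrightarrow> (\<forall>i<4. z i = 0)"
    by (rule covering_radius)
  have lower: "real m ^ 4 \<le> \<rho> ^ 4 * real (principal_index (of_nat m :: 'a))" if m: "m > 0" for m
  proof -
    define p where "p = nat \<lceil>real m / \<rho>\<rceil>"
    have p: "real m \<le> \<rho> * real p" "(real p - 1) * \<rho> < real m"
    proof -
      have "real m / \<rho> > 0" using m \<rho>(1) by simp
      then have *: "real p = of_int \<lceil>real m / \<rho>\<rceil>" unfolding p_def by simp
      have "real m / \<rho> \<le> real p" "real p - 1 < real m / \<rho>"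
        unfolding * using ceiling_correct[of "real m / \<rho>"] by auto
      then show "real m \<le> \<rho> * real p" "(real p - 1) * \<rho> < real m"
        using \<rho>(1) by (simp_all add: field_simps)
    qed
    define E where "E = ({..<4::nat} \<rightarrow>\<^sub>E {..<p})"
    define \<Psi> where "\<Psi> z = (\<Sum>i<4. of_nat (z i) * b i)" for z
    have diff: "z = z'" if z: "z \<in> E" "z' \<in> E" "\<Psi> z - \<Psi> z' \<in> (*) (of_nat m) ` ring_of_integers" for z z'
    proof -
      define t where "t i = int (z i) - int (z' i)" for i
      have eq: "\<Psi> z - \<Psi> z' = (\<Sum>i<4. of_int (t i) * b i)"
        by (simp add: \<Psi>_def t_def sum_subtractf left_diff_distrib)
      have "\<bar>real_of_int (t i)\<bar> \<le> real p - 1" if i: "i < 4" for i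
      proof -
        have "z i < p" "z' i < p" using z i by (auto simp: E_def)
        then have "\<bar>t i\<bar> \<le> int p - 1" unfolding t_def by linarith
        then have "real_of_int \<bar>t i\<bar> \<le> real_of_int (int p - 1)" by (simp only: of_int_le_iff)
        then show ?thesis by simp
      qed
      then have "cmod (\<sigma> (\<Psi> z - \<Psi> z')) \<le> (real p - 1) * \<rho> \<and> cmod (\<sigma>' (\<Psi> z - \<Psi> z')) \<le> (real p - 1) * \<rho>"
        unfolding eq using \<rho>(3)[rule_format, of "\<lambda>i. of_int (t i)" "real p - 1"] by simp
      then have small: "cmod (\<sigma> (\<Psi> z - \<Psi> z')) < real m" "cmod (\<sigma>' (\<Psi> z - \<Psi> z')) < real m"
        using p(2) by linarith+
      obtain h where h: "h \<in> ring_of_integers" "\<Psi> z - \<Psi> z' = of_nat m * h" using z(3) by blast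
      have "h = 0"
        by (rule integer_eq_0[OF h(1)])
          (use small m in \<open>simp_all add: h(2) \<sigma>_simps \<sigma>'_simps norm_mult\<close>)
      then have "(\<Sum>i<4. of_int (t i) * b i) = 0" using h(2) eq by simp
      then have "\<forall>i<4. t i = 0" using \<rho>(4) by blast
      then have "z i = z' i" if "i < 4" for i using that by (simp add: t_def)
      then show ?thesis using z(1,2) by (intro PiE_ext[of z "{..<4}" "\<lambda>_. {..<p}" z']) (auto simp: E_def)
    qed
    have inj: "inj_on \<Psi> E"
    proof (rule inj_onI)
      fix z z' assume "z \<in> E" "z' \<in> E" "\<Psi> z = \<Psi> z'"
      moreover have "0 \<in> (*) (of_nat m) ` (ring_of_integers :: 'a set)"
        using ring_of_integers_closed(5) by force
      ultimately show "z = z'" using diff[of z z'] by simp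
    qed
    have "card (\<Psi> ` E) \<le> principal_index (of_nat m :: 'a)"
    proof (rule coset_index_lower(2)[OF additive_subgroup_scale[OF additive_subgroup_ring_of_integers]])
      show "\<Psi> ` E \<subseteq> ring_of_integers"
        by (auto simp: \<Psi>_def intro!: ring_of_integers_sum ring_of_integers_closed \<rho>(2)[rule_format])
      show "finite ((\<lambda>x. (+) x ` (*) (of_nat m) ` ring_of_integers) ` (ring_of_integers :: 'a set))"
        by (rule finite_principal_cosets_nat[OF m])
      show "x = y" if "x \<in> \<Psi> ` E" "y \<in> \<Psi> ` E" "x - y \<in> (*) (of_nat m) ` ring_of_integers" for x y
        using that diff by blast
    qed
    moreover have "card (\<Psi> ` E) = p ^ 4"
      using card_image[OF inj] by (simp add: E_def card_PiE)
    ultimately have le: "real p ^ 4 \<le> real (principal_index (of_nat m :: 'a))"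
      by (metis of_nat_le_iff of_nat_power)
    have "real m ^ 4 \<le> (\<rho> * real p) ^ 4" using p(1) by (intro power_mono) auto
    also have "\<dots> = \<rho> ^ 4 * real p ^ 4" by (simp add: power_mult_distrib)
    also have "\<dots> \<le> \<rho> ^ 4 * real (principal_index (of_nat m :: 'a))"
      using le \<rho>(1) by (intro mult_left_mono) auto
    finally show ?thesis .
  qed
  have "real m ^ 4 \<le> real (principal_index (of_nat m :: 'a))"
  proof (rule le_of_power_le)
    have "0 < real m ^ 4" using assms by simp
    also have "\<dots> \<le> \<rho> ^ 4 * real (principal_index (of_nat m :: 'a))" by (rule lower[OF assms])
    finally show "real (principal_index (of_nat m :: 'a)) > 0" using \<rho>(1)
      by (auto simp: zero_less_mult_iff)
    show "(real m ^ 4) ^ k \<le> \<rho> ^ 4 * real (principal_index (of_nat m :: 'a)) ^ k" for k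
    proof -
      have "(real m ^ 4) ^ k = real (m ^ k) ^ 4" by (simp add: power_mult[symmetric] mult.commute)
      also have "\<dots> \<le> \<rho> ^ 4 * real (principal_index (of_nat (m ^ k) :: 'a))"
        using assms by (intro lower) auto
      also have "principal_index (of_nat (m ^ k) :: 'a) = principal_index (of_nat m :: 'a) ^ k"
        using principal_index_power[of "of_nat m :: 'a" k] assms ring_of_integers_closed(7) by auto
      finally show ?thesis by simp
    qed
  qed simp
  then show "m ^ 4 \<le> principal_index (of_nat m :: 'a)"
    by (metis of_nat_le_iff of_nat_power)
qed

text \<open>The upper bound follows after scaling g by a natural number large enough for
  \<open>principal_index_le\<close>. For g and its cofactor h the product is a natural number, where
  equality is known; so neither upper bound can be strict.\<close>

theorem principal_index_eq:
  assumes g: "g \<in> ring_of_integers" "g \<noteq> 0"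
  shows "real (principal_index g) = abs_norm g"
proof -
  have le: "real (principal_index g) \<le> abs_norm g" if g: "g \<in> ring_of_integers" "g \<noteq> 0" for g
  proof -
    have pos: "cmod (\<sigma> g) > 0" "cmod (\<sigma>' g) > 0" using g by (auto simp: \<sigma>_simps \<sigma>'_simps)
    obtain m1 m2 :: nat where m: "1 / cmod (\<sigma> g) \<le> real m1" "1 / cmod (\<sigma>' g) \<le> real m2"
      using real_arch_simple by metis
    define m where "m = m1 + m2 + 1"
    have "1 \<le> real m * cmod (\<sigma> g)" "1 \<le> real m * cmod (\<sigma>' g)"
      using m pos by (simp_all add: m_def field_simps add_pos_nonneg add_increasing add_increasing2)
    then have "real (principal_index (of_nat m * g)) \<le> abs_norm (of_nat m * g)"
      by (intro principal_index_le)
        (use g in \<open>auto simp: \<sigma>_simps \<sigma>'_simps norm_mult intro!: ring_of_integers_closed\<close>)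
    moreover have "principal_index (of_nat m * g) = m ^ 4 * principal_index g"
      using principal_index_mult[of "of_nat m" g] principal_index_nat[of m] g
      by (simp add: m_def ring_of_integers_closed(7) del: of_nat_add of_nat_Suc)
    ultimately have "real m ^ 4 * real (principal_index g) \<le> real m ^ 4 * abs_norm g"
      by (simp add: abs_norm_mult abs_norm_of_nat)
    moreover have "real m ^ 4 > 0" by (simp add: m_def)
    ultimately show ?thesis by simp
  qed
  obtain h n where h: "h \<in> ring_of_integers" "g * h = of_nat n" "abs_norm g = real n"
    using integer_cofactor[OF g(1)] by blast
  have n: "n > 0" using h(3) abs_norm_pos[OF g(2)] by simp
  then have h0: "h \<noteq> 0" using h(2) by auto
  have "real (principal_index g) * real (principal_index h) = real (principal_index (g * h))"
    using principal_index_mult[OF g(1) h(1) g(2)] by simp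
  also have "\<dots> = abs_norm (g * h)"
    unfolding h(2) abs_norm_of_nat using principal_index_nat[OF n] by simp
  also have "\<dots> = abs_norm g * abs_norm h" by (rule abs_norm_mult)
  finally have eq: "real (principal_index g) * real (principal_index h) = abs_norm g * abs_norm h" .
  show ?thesis
  proof (rule antisym[OF le[OF g]], rule ccontr)
    assume "\<not> abs_norm g \<le> real (principal_index g)"
    then have "real (principal_index g) * abs_norm h < abs_norm g * abs_norm h"
      using abs_norm_pos[OF h0] by simp
    moreover have "real (principal_index g) * real (principal_index h) \<le> real (principal_index g) * abs_norm h"
      by (intro mult_left_mono le h h0) auto
    ultimately show False using eq by simp
  qed
qed

end

section \<open>Norms and indices of fractional ideals\<close>

lemma integral_ideal_norm_eq: "integral_ideal_norm J = coset_index ring_of_integers J"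
  by (simp add: integral_ideal_norm_def coset_index_def)

lemma additive_subgroup_fractional_ideal:
  assumes "fractional_ideal I" shows "additive_subgroup I"
proof -
  have "x - y \<in> I" if "x \<in> I" "y \<in> I" for x y
  proof -
    have "- 1 * y \<in> I"
      using assms that(2) ring_of_integers_closed(4)[OF ring_of_integers_closed(6)]
      unfolding fractional_ideal_def by blast
    then have "x + - 1 * y \<in> I" using assms that(1) unfolding fractional_ideal_def by blast
    then show ?thesis by simp
  qed
  then show ?thesis using assms by (auto simp: additive_subgroup_def fractional_ideal_def)
qed

lemma fractional_ideal_mult_closed:
  "fractional_ideal I \<Longrightarrow> a \<in> ring_of_integers \<Longrightarrow> x \<in> I \<Longrightarrow> a * x \<in> I"
  by (auto simp: fractional_ideal_def)

lemma fractional_ideal_principal_subset: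
  "fractional_ideal I \<Longrightarrow> f \<in> I \<Longrightarrow> (*) f ` ring_of_integers \<subseteq> I"
  by (auto simp: fractional_ideal_mult_closed mult.commute[of f])

context quadratic_over_imaginary_quadratic
begin

text \<open>Isolates the choice operator in \<open>ideal_norm\<close>: from here on the norm is an
  index divided by \<open>abs_norm d\<close> for some denominator d.\<close>

lemma ideal_norm_denominator:
  fixes I :: "'a set"
  assumes "fractional_ideal I"
  obtains d where "d \<in> ring_of_integers" "d \<noteq> 0" "(*) d ` I \<subseteq> ring_of_integers"
    "ideal_norm I = real (coset_index ring_of_integers ((*) d ` I)) / abs_norm d"
proof -
  define P where "P d \<longleftrightarrow> d \<in> ring_of_integers \<and> d \<noteq> 0 \<and> (*) d ` I \<subseteq> ring_of_integers" for d
  define d where "d = (SOME d. P d)"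
  have "\<exists>d. P d" using assms unfolding fractional_ideal_def P_def by blast
  then have "P d" unfolding d_def by (rule someI_ex)
  moreover have "ideal_norm I =
      real (coset_index ring_of_integers ((*) d ` I)) / real (principal_index d)"
    by (simp add: ideal_norm_def integral_ideal_norm_eq d_def P_def Let_def)
  ultimately show thesis
    using that[of d] principal_index_eq[of d] by (auto simp: P_def)
qed

text \<open>The index of d f O in O is the norm of d f; computed through d I it also is the product
  of the index of d I in O and that of f O in I. Dividing by the norm of d gives the claim.\<close>

lemma ideal_norm_index:
  assumes I: "fractional_ideal I" and f: "f \<in> I" "f \<noteq> 0"
  shows "ideal_norm I * real (coset_index I ((*) f ` ring_of_integers)) = abs_norm f"
proof -
  obtain d where d: "d \<in> ring_of_integers" "d \<noteq> 0" "(*) d ` I \<subseteq> ring_of_integers"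
    "ideal_norm I = real (coset_index ring_of_integers ((*) d ` I)) / abs_norm d"
    using ideal_norm_denominator[OF I] by blast
  have eq: "(*) (d * f) ` ring_of_integers = (*) d ` (*) f ` ring_of_integers"
    by (simp add: image_image mult.assoc)
  have "principal_index (d * f) = coset_index ring_of_integers ((*) d ` I) *
      coset_index ((*) d ` I) ((*) d ` (*) f ` ring_of_integers)"
    unfolding eq
    by (rule coset_index_mult)
      (use d fractional_ideal_principal_subset[OF I f(1)] additive_subgroup_fractional_ideal[OF I]
        in \<open>auto intro!: additive_subgroup_scale additive_subgroup_ring_of_integers\<close>)
  also have "\<dots> = coset_index ring_of_integers ((*) d ` I) * coset_index I ((*) f ` ring_of_integers)"
    unfolding coset_index_scale[OF d(2)] ..
  finally have "abs_norm (d * f) =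
      real (coset_index ring_of_integers ((*) d ` I)) * real (coset_index I ((*) f ` ring_of_integers))"
    using principal_index_eq[of "d * f"] d f by (simp add: image_subset_iff)
  then show ?thesis
    using abs_norm_pos[OF d(2)] by (simp add: d(4) abs_norm_mult field_simps)
qed

lemma ideal_norm_pos:
  fixes I :: "'a set"
  assumes I: "fractional_ideal I" shows "ideal_norm I > 0"
proof -
  obtain f where f: "f \<in> I" "f \<noteq> 0" using I unfolding fractional_ideal_def by blast
  have "ideal_norm I * real (coset_index I ((*) f ` ring_of_integers)) > 0"
    using ideal_norm_index[OF I f] abs_norm_pos[OF f(2)] by simp
  moreover have "ideal_norm I \<ge> 0" by (simp add: ideal_norm_def Let_def)
  ultimately show ?thesis by (cases "ideal_norm I = 0") auto
qed

text \<open>The index of d m I in O is computed once through d I and once through m O. The common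
  factor c can be cancelled because the ideal norm is positive.\<close>

lemma ideal_index_nat:
  fixes I :: "'a set"
  assumes I: "fractional_ideal I" and m: "m > 0"
  shows "coset_index I ((*) (of_nat m) ` I) = m ^ 4"
proof -
  obtain d where d: "d \<in> ring_of_integers" "d \<noteq> 0" "(*) d ` I \<subseteq> ring_of_integers"
    "ideal_norm I = real (coset_index ring_of_integers ((*) d ` I)) / abs_norm d"
    using ideal_norm_denominator[OF I] by blast
  define c where "c = coset_index ring_of_integers ((*) d ` I)"
  note sub = additive_subgroup_scale[OF additive_subgroup_fractional_ideal[OF I]]
    additive_subgroup_ring_of_integers additive_subgroup_scale[OF additive_subgroup_ring_of_integers]
    additive_subgroup_scale[OF additive_subgroup_scale[OF additive_subgroup_fractional_ideal[OF I]]]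
  have eq: "(*) d ` (*) (of_nat m) ` I = (*) (of_nat m) ` (*) d ` I"
    by (simp add: image_image mult.left_commute)
  have mI: "(*) (of_nat m) ` I \<subseteq> I"
    using fractional_ideal_mult_closed[OF I ring_of_integers_closed(7)] by blast
  have "coset_index ring_of_integers ((*) d ` (*) (of_nat m) ` I) =
      c * coset_index ((*) d ` I) ((*) d ` (*) (of_nat m) ` I)"
    unfolding c_def by (rule coset_index_mult) (use d mI sub in \<open>auto simp del: image_image\<close>)
  then have 1: "coset_index ring_of_integers ((*) d ` (*) (of_nat m) ` I) =
      c * coset_index I ((*) (of_nat m) ` I)"
    unfolding coset_index_scale[OF d(2)] .
  have "coset_index ring_of_integers ((*) (of_nat m) ` (*) d ` I) = principal_index (of_nat m :: 'a) *
      coset_index ((*) (of_nat m) ` ring_of_integers) ((*) (of_nat m) ` (*) d ` I)"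
    by (rule coset_index_mult)
      (use d sub in \<open>auto simp del: image_image intro: ring_of_integers_closed\<close>)
  also have "\<dots> = m ^ 4 * c"
    using m coset_index_scale[of "of_nat m :: 'a"] principal_index_nat[OF m] by (simp add: c_def)
  finally have "c * coset_index I ((*) (of_nat m) ` I) = m ^ 4 * c"
    using 1 unfolding eq by simp
  moreover have "c > 0"
    using ideal_norm_pos[OF I] d(4) unfolding c_def by (cases "coset_index ring_of_integers ((*) d ` I)") auto
  ultimately show ?thesis by simp
qed

end

section \<open>Counting lattice vectors and bounding theta tails\<close>

lemma exp_ge_Taylor:
  fixes x :: real assumes "x \<ge> 0" shows "(\<Sum>i<n. x ^ i / fact i) \<le> exp x"
proof -
  have s: "(\<lambda>i. x ^ i / fact i) sums exp x"
    using exp_converges[of x] by (simp add: divide_inverse mult.commute)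
  show ?thesis
    using sum_le_suminf[OF sums_summable[OF s], of "{..<n}"] sums_unique[OF s] assms by simp
qed

text \<open>Satisfied by the form of every divisor of degree 0. The axiom \<open>index\<close> plays
  the role of rank 4, and \<open>ge_2\<close> is the arithmetic-geometric mean bound.\<close>

locale quadratic_lattice =
  fixes L :: "'a::field_char_0 set" and Q :: "'a \<Rightarrow> real"
  assumes subgroup: "additive_subgroup L"
    and parallelogram: "Q (x + y) + Q (x - y) = 2 * Q x + 2 * Q y"
    and scale: "Q (of_nat m * x) = (real m)\<^sup>2 * Q x"
    and ge_2: "x \<in> L \<Longrightarrow> x \<noteq> 0 \<Longrightarrow> Q x \<ge> 2"
    and nonneg: "Q x \<ge> 0"
    and index: "m > 0 \<Longrightarrow> coset_index L ((*) (of_nat m) ` L) = m ^ 4"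
begin

lemma finite_cosets: "m > 0 \<Longrightarrow> finite ((\<lambda>x. (+) x ` (*) (of_nat m) ` L) ` L)"
  using index[of m] by (intro card_ge_0_finite) (simp add: coset_index_def)

text \<open>Such vectors are pairwise incongruent modulo m: a nonzero difference in m L has Q at
  least 2 m^2, while the parallelogram law keeps it strictly below 2 m^2.\<close>

lemma card_ball:
  assumes "m > 0"
  shows "finite {x \<in> L. Q x < (real m)\<^sup>2 / 2}" "card {x \<in> L. Q x < (real m)\<^sup>2 / 2} \<le> m ^ 4"
proof -
  have inj: "x = y" if xy: "x \<in> {x \<in> L. Q x < (real m)\<^sup>2 / 2}" "y \<in> {x \<in> L. Q x < (real m)\<^sup>2 / 2}"
    "x - y \<in> (*) (of_nat m) ` L" for x y
  proof (rule ccontr)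
    assume ne: "x \<noteq> y"
    obtain h where h: "h \<in> L" "x - y = of_nat m * h" using xy(3) by blast
    have "h \<noteq> 0" using h(2) ne by auto
    then have "(real m)\<^sup>2 * 2 \<le> Q (x - y)"
      unfolding h(2) scale using ge_2[OF h(1)] by (intro mult_left_mono) auto
    moreover have "Q (x - y) \<le> 2 * Q x + 2 * Q y" using parallelogram[of x y] nonneg[of "x + y"] by simp
    ultimately show False using xy(1,2) by simp
  qed
  note low = coset_index_lower[OF additive_subgroup_scale[OF subgroup] _ finite_cosets[OF assms] inj]
  show "finite {x \<in> L. Q x < (real m)\<^sup>2 / 2}"
    by (rule low(1)) blast+
  have "card {x \<in> L. Q x < (real m)\<^sup>2 / 2} \<le> coset_index L ((*) (of_nat m) ` L)"
    by (rule low(2)) blast+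
  then show "card {x \<in> L. Q x < (real m)\<^sup>2 / 2} \<le> m ^ 4" unfolding index[OF assms] .
qed

definition short :: "'a set" where "short = {x \<in> L. x \<noteq> 0 \<and> Q x < 4}"

lemma finite_short: "finite short"
  using card_ball(1)[of 3] by (rule finite_subset[rotated]) (auto simp: short_def)

text \<open>Two short vectors in the same class modulo \<open>2L\<close> are equal up to sign: otherwise half their
  sum and half their difference would be nonzero elements of \<open>L\<close>, too short by the parallelogram law.\<close>

lemma card_short: "card short \<le> 30"
proof -
  define \<kappa> where "\<kappa> x = (+) x ` (*) (2::'a) ` L" for x
  have two: "(2::'a) = of_nat 2" by simp
  have sub2: "additive_subgroup ((*) (2::'a) ` L)" by (rule additive_subgroup_scale[OF subgroup])
  have scale2: "Q (2 * x) = 4 * Q x" for x using scale[of 2 x] by simp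
  have pm: "y = x \<or> y = - x" if xy: "x \<in> short" "y \<in> short" "\<kappa> x = \<kappa> y" for x y
  proof (rule ccontr)
    assume ne: "\<not> (y = x \<or> y = - x)"
    have "x - y \<in> (*) 2 ` L" using xy(3) unfolding \<kappa>_def coset_eq_iff[OF sub2] .
    then obtain h where h: "h \<in> L" "x - y = 2 * h" by blast
    have h': "h + y \<in> L" using additive_subgroup_add[OF subgroup h(1)] xy(2) by (simp add: short_def)
    have eq: "x + y = 2 * (h + y)" using h(2) by (simp add: algebra_simps)
    have "h \<noteq> 0" "h + y \<noteq> 0" using ne h(2) eq by (auto simp: add_eq_0_iff)
    then have "Q (x - y) \<ge> 8" "Q (x + y) \<ge> 8"
      unfolding eq h(2) scale2 using ge_2[OF h(1)] ge_2[OF h'] by auto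
    then show False using parallelogram[of x y] xy by (simp add: short_def)
  qed
  have not0: "\<kappa> x \<noteq> \<kappa> 0" if x: "x \<in> short" for x
  proof
    assume "\<kappa> x = \<kappa> 0"
    then have "x \<in> (*) 2 ` L" unfolding \<kappa>_def coset_eq_iff[OF sub2] by simp
    then obtain h where h: "h \<in> L" "x = 2 * h" by blast
    then have "h \<noteq> 0" using x by (auto simp: short_def)
    then have "Q x \<ge> 8" unfolding h(2) scale2 using ge_2[OF h(1)] by simp
    then show False using x by (simp add: short_def)
  qed
  have fin: "finite (\<kappa> ` L)" and card: "card (\<kappa> ` L) = 16"
    using finite_cosets[of 2] index[of 2] by (simp_all add: \<kappa>_def coset_index_def)
  have "\<kappa> ` short \<subseteq> \<kappa> ` L - {\<kappa> 0}" using not0 by (auto simp: short_def)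
  then have "card (\<kappa> ` short) \<le> card (\<kappa> ` L - {\<kappa> 0})" using fin by (intro card_mono) auto
  also have "\<dots> = 15"
    using subgroup fin card by (subst card_Diff_singleton) (auto simp: additive_subgroup_def)
  finally have c15: "card (\<kappa> ` short) \<le> 15" .
  have "short = (\<Union>X\<in>\<kappa> ` short. {x \<in> short. \<kappa> x = X})" by blast
  then have "card short = card (\<Union>X\<in>\<kappa> ` short. {x \<in> short. \<kappa> x = X})" by simp
  also have "\<dots> \<le> (\<Sum>X\<in>\<kappa> ` short. card {x \<in> short. \<kappa> x = X})"
    by (rule card_UN_le) (use finite_short in auto)
  also have "\<dots> \<le> (\<Sum>X\<in>\<kappa> ` short. 2)"
  proof (rule sum_mono)
    fix X assume "X \<in> \<kappa> ` short"
    then obtain x where x: "x \<in> short" "X = \<kappa> x" by blast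
    have "{y \<in> short. \<kappa> y = X} \<subseteq> {x, - x}" using pm[OF x(1)] x(2) by auto
    then have "card {y \<in> short. \<kappa> y = X} \<le> card {x, - x}" by (intro card_mono) auto
    also have "\<dots> \<le> 2" by (simp add: card_insert_if)
    finally show "card {y \<in> short. \<kappa> y = X} \<le> 2" .
  qed
  also have "\<dots> \<le> 30" using c15 by simp
  finally show ?thesis .
qed

text \<open>Vectors are grouped by the integer part j of sqrt (2 Q). Group j lies in the ball
  counted by \<open>card_ball\<close> for j + 1, so it has at most (j + 1)^4 members, each with Q at
  least max 4 (j^2 / 2). Groups 2 and 3 give 81 = 3^4 and 256 = 4^4; the others together stay below
  1/1000 of the common factor.\<close>

lemma tail_sum:
  assumes S: "finite S" "S \<subseteq> L" "\<And>x. x \<in> S \<Longrightarrow> Q x \<ge> 4" and \<theta>: "\<theta> \<ge> 4"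
  shows "(\<Sum>x\<in>S. exp (- \<theta> * Q x)) \<le> exp (- 4 * \<theta>) * (81 + 256 * exp (- \<theta> / 2) + 1 / 1000)"
proof -
  define k where "k x = nat \<lfloor>sqrt (2 * Q x)\<rfloor>" for x
  have k: "(real (k x))\<^sup>2 \<le> 2 * Q x" "2 * Q x < (real (k x) + 1)\<^sup>2" for x
  proof -
    have "0 \<le> sqrt (2 * Q x)" using nonneg by simp
    then have "real (k x) = of_int \<lfloor>sqrt (2 * Q x)\<rfloor>" by (simp add: k_def)
    then have *: "real (k x) \<le> sqrt (2 * Q x)" "sqrt (2 * Q x) < real (k x) + 1" by linarith+
    have sq: "(sqrt (2 * Q x))\<^sup>2 = 2 * Q x" using nonneg[of x] by simp
    show "(real (k x))\<^sup>2 \<le> 2 * Q x" using power_mono[OF *(1), of 2] sq by simp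
    show "2 * Q x < (real (k x) + 1)\<^sup>2"
      using power_strict_mono[OF *(2), of 2] sq nonneg[of x] by simp
  qed
  define w where "w k = (if k = 2 then 81 * exp (- 4 * \<theta>) else if k = 3 then 256 * exp (- 4 * \<theta>) * exp (- \<theta> / 2)
    else exp (- 4 * \<theta>) * (1 / 7) ^ k)" for k :: nat
  have k2: "k x \<ge> 2" if "x \<in> S" for x
  proof (rule ccontr)
    assume "\<not> k x \<ge> 2"
    then have "(real (k x) + 1)\<^sup>2 \<le> 2\<^sup>2" by (intro power_mono) auto
    then show False using k(2)[of x] S(3)[OF that] by simp
  qed
  have bucket: "(\<Sum>x\<in>{x \<in> S. k x = j}. exp (- \<theta> * Q x)) \<le> w j" if j: "j \<ge> 2" for j
  proof -
    define e where "e = max 4 ((real j)\<^sup>2 / 2)"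
    have "(\<Sum>x\<in>{x \<in> S. k x = j}. exp (- \<theta> * Q x)) \<le> (\<Sum>x\<in>{x \<in> S. k x = j}. exp (- \<theta> * e))"
    proof (rule sum_mono)
      fix x assume "x \<in> {x \<in> S. k x = j}"
      then have "e \<le> Q x" using S(3) k(1)[of x] by (auto simp: e_def)
      then show "exp (- \<theta> * Q x) \<le> exp (- \<theta> * e)" using \<theta> by simp
    qed
    also have "\<dots> = real (card {x \<in> S. k x = j}) * exp (- \<theta> * e)" by simp
    also have "\<dots> \<le> real ((Suc j) ^ 4) * exp (- \<theta> * e)"
    proof (intro mult_right_mono)
      have "{x \<in> S. k x = j} \<subseteq> {x \<in> L. Q x < (real (Suc j))\<^sup>2 / 2}"
        using S(2) k(2) by (auto simp: add.commute mult.commute)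
      then have "card {x \<in> S. k x = j} \<le> card {x \<in> L. Q x < (real (Suc j))\<^sup>2 / 2}"
        by (intro card_mono card_ball) auto
      then show "real (card {x \<in> S. k x = j}) \<le> real (Suc j ^ 4)"
        using card_ball(2)[of "Suc j"] unfolding of_nat_le_iff by linarith
    qed simp
    also have "\<dots> \<le> w j"
    proof -
      consider "j = 2" | "j = 3" | "j \<ge> 4" using j by linarith
      then show ?thesis
      proof cases
        case 1
        then show ?thesis by (simp add: w_def e_def)
      next
        case 2
        have "exp (- \<theta> * (9 / 2)) = exp (- 4 * \<theta>) * exp (- \<theta> / 2)"
          by (simp flip: exp_add)
        then show ?thesis using 2 by (simp add: w_def e_def max_def)
      next
        case 3
        \<comment> \<open>For j \<ge> 4 the minimum of Q exceeds 4 by at least j. With \<theta>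
          \<ge> 4 this yields a factor exp(-4 j) against (j + 1)^4 \<le> exp(2 j), and the surplus
          exp(-2 j) is at most 7^(-j).\<close>
        have e: "e \<ge> 4 + real j"
        proof -
          have "(real j - 4) * (real j + 2) \<ge> 0" using 3 by simp
          then show ?thesis by (simp add: e_def power2_eq_square algebra_simps max_def)
        qed
        have "1 + real j \<le> exp (real j / 2)"
        proof -
          have "real j * 4 \<le> real j * real j" using 3 by (intro mult_left_mono) auto
          then have "1 + real j \<le> 1 + real j / 2 + (real j / 2)\<^sup>2 / 2"
            by (simp add: power2_eq_square field_simps)
          also have "\<dots> \<le> exp (real j / 2)" by (rule exp_lower_Taylor_quadratic) simp
          finally show ?thesis .
        qed
        then have "real (Suc j) ^ 4 \<le> exp (real j / 2) ^ 4" by (intro power_mono) auto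
        also have "\<dots> = exp (2 * real j)" by (simp flip: exp_of_nat_mult)
        finally have a: "real (Suc j ^ 4) \<le> exp (2 * real j)" by simp
        have "\<theta> * (4 + real j) \<le> \<theta> * e" using e \<theta> by (intro mult_left_mono) auto
        moreover have "4 * real j \<le> \<theta> * real j" using \<theta> by (intro mult_right_mono) auto
        ultimately have b: "exp (- \<theta> * e) \<le> exp (- 4 * \<theta>) * exp (- 4 * real j)"
          unfolding exp_add[symmetric] by (simp add: algebra_simps)
        have "(7::real) \<le> (\<Sum>i<6. 2 ^ i / fact i)" by (simp add: eval_nat_numeral)
        also have "\<dots> \<le> exp 2" by (rule exp_ge_Taylor) simp
        finally have "exp (- 2) \<le> (1 / 7 :: real)" by (simp add: exp_minus field_simps)
        then have "exp (- 2) ^ j \<le> (1 / 7 :: real) ^ j" by (intro power_mono) auto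
        then have c: "exp (- (2 * real j)) \<le> (1 / 7) ^ j" by (simp flip: exp_of_nat_mult add: mult.commute)
        have "real (Suc j ^ 4) * exp (- \<theta> * e) \<le> exp (2 * real j) * (exp (- 4 * \<theta>) * exp (- 4 * real j))"
          by (intro mult_mono a b) auto
        also have "\<dots> = exp (- 4 * \<theta>) * exp (- (2 * real j))"
          by (simp flip: exp_add)
        also have "\<dots> \<le> exp (- 4 * \<theta>) * (1 / 7) ^ j" by (intro mult_left_mono c) auto
        finally show ?thesis using 3 by (simp add: w_def)
      qed
    qed
    finally show ?thesis .
  qed
  obtain M where M: "k ` S \<subseteq> {2..<M + 4}"
  proof
    show "k ` S \<subseteq> {2..<Max (k ` S) + 4}"
    proof
      fix j assume j: "j \<in> k ` S"
      then have "j \<le> Max (k ` S)" using S(1) by (intro Max_ge) auto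
      then show "j \<in> {2..<Max (k ` S) + 4}" using j k2 by auto
    qed
  qed
  have w0: "w j \<ge> 0" for j by (simp add: w_def)
  have "(\<Sum>x\<in>S. exp (- \<theta> * Q x)) = (\<Sum>j\<in>k ` S. \<Sum>x\<in>{x \<in> S. k x = j}. exp (- \<theta> * Q x))"
    by (rule sum.image_gen[OF S(1)])
  also have "\<dots> \<le> (\<Sum>j\<in>k ` S. w j)"
    by (intro sum_mono bucket) (use k2 in auto)
  also have "\<dots> \<le> (\<Sum>j\<in>{2..<M + 4}. w j)"
    by (intro sum_mono2 M w0) auto
  also have "{2..<M + 4} = {2, 3} \<union> {4..<M + 4}" by auto
  also have "(\<Sum>j\<in>{2, 3} \<union> {4..<M + 4}. w j) = w 2 + w 3 + (\<Sum>j\<in>{4..<M + 4}. w j)"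
    by (subst sum.union_disjoint) auto
  also have "(\<Sum>j\<in>{4..<M + 4}. w j) = (\<Sum>j\<in>{4..<M + 4}. exp (- 4 * \<theta>) * (1 / 7) ^ j)"
    by (intro sum.cong) (auto simp: w_def)
  also have "\<dots> = exp (- 4 * \<theta>) * (\<Sum>j\<in>{4..<M + 4}. (1 / 7) ^ j)"
    by (simp add: sum_distrib_left)
  also have "(\<Sum>j\<in>{4..<M + 4}. (1 / 7) ^ j) = (\<Sum>j<M. (1 / 7 :: real) ^ 4 * (1 / 7) ^ j)"
    using sum.shift_bounds_nat_ivl[of "\<lambda>j. (1 / 7 :: real) ^ j" 0 4 M]
    by (simp add: power_add lessThan_atLeast0 mult.commute add.commute)
  also have "\<dots> \<le> 1 / 1000"
  proof -
    have "(\<Sum>j<M. (1 / 7 :: real) ^ j) = (1 - (1 / 7) ^ M) / (1 - 1 / 7)"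
      by (subst sum_gp_strict) auto
    also have "\<dots> \<le> 7 / 6" by (simp add: field_simps)
    finally have "(1 / 7 :: real) ^ 4 * (\<Sum>j<M. (1 / 7) ^ j) \<le> (1 / 7) ^ 4 * (7 / 6)"
      by (intro mult_left_mono) auto
    also have "\<dots> \<le> 1 / 1000" by (simp add: eval_nat_numeral)
    finally show ?thesis by (simp add: sum_distrib_left)
  qed
  finally show ?thesis by (simp add: w_def algebra_simps)
qed

lemma summable_exp:
  assumes "\<theta> \<ge> 4" shows "(\<lambda>x. exp (- \<theta> * Q x)) summable_on L"
proof (rule nonneg_bounded_partial_sums_imp_summable_on)
  show "\<forall>\<^sub>F S in finite_subsets_at_top L. (\<Sum>x\<in>S. exp (- \<theta> * Q x)) \<le>
      real (card {x \<in> L. Q x < 9 / 2}) + exp (- 4 * \<theta>) * (81 + 256 * exp (- \<theta> / 2) + 1 / 1000)"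
  proof (rule eventually_finite_subsets_at_top_weakI)
    fix S assume S: "finite S" "S \<subseteq> L"
    have fin: "finite {x \<in> L. Q x < 9 / 2}" using card_ball(1)[of 3] by simp
    have "(\<Sum>x\<in>S. exp (- \<theta> * Q x)) =
        (\<Sum>x\<in>{x \<in> S. Q x < 4}. exp (- \<theta> * Q x)) + (\<Sum>x\<in>{x \<in> S. Q x \<ge> 4}. exp (- \<theta> * Q x))"
      by (subst sum.union_disjoint[symmetric]) (use S in \<open>auto intro!: sum.cong\<close>)
    moreover have "(\<Sum>x\<in>{x \<in> S. Q x < 4}. exp (- \<theta> * Q x)) \<le> (\<Sum>x\<in>{x \<in> S. Q x < 4}. 1)"
      by (rule sum_mono) (use assms nonneg in auto)
    moreover have "card {x \<in> S. Q x < 4} \<le> card {x \<in> L. Q x < 9 / 2}"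
      using S fin by (intro card_mono) auto
    moreover have "(\<Sum>x\<in>{x \<in> S. Q x \<ge> 4}. exp (- \<theta> * Q x)) \<le>
        exp (- 4 * \<theta>) * (81 + 256 * exp (- \<theta> / 2) + 1 / 1000)"
      by (rule tail_sum) (use S assms in auto)
    ultimately show "(\<Sum>x\<in>S. exp (- \<theta> * Q x)) \<le>
      real (card {x \<in> L. Q x < 9 / 2}) + exp (- 4 * \<theta>) * (81 + 256 * exp (- \<theta> / 2) + 1 / 1000)"
      by simp
  qed
qed auto

end

section \<open>Numerical bounds\<close>

text \<open>The difference between arctan and a Taylor polynomial vanishes at 0, and up to sign its
  derivative, the remainder of a geometric series, is an even power of y divided by 1 + y^2.\<close>

lemma arctan_bounds_5_7:
  fixes x :: real assumes x: "x \<ge> 0"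
  shows "arctan x \<le> x - x ^ 3 / 3 + x ^ 5 / 5 - x ^ 7 / 7 + x ^ 9 / 9"
    and "arctan x \<ge> x - x ^ 3 / 3 + x ^ 5 / 5 - x ^ 7 / 7"
    and "arctan x \<le> x" and "arctan x \<ge> x - x ^ 3 / 3"
proof -
  have pos: "1 + y\<^sup>2 > 0" for y :: real by (simp add: add_pos_nonneg)
  have mono: "f 0 \<le> f x" if "\<And>y. DERIV f y :> f' y" "\<And>y. f' y \<ge> 0" for f f' :: "real \<Rightarrow> real"
    using DERIV_nonneg_imp_nondecreasing[of 0 x f] x that by blast
  have "0 \<le> x - x ^ 3 / 3 + x ^ 5 / 5 - x ^ 7 / 7 + x ^ 9 / 9 - arctan x"
  proof -
    have "((\<lambda>x. x - x ^ 3 / 3 + x ^ 5 / 5 - x ^ 7 / 7 + x ^ 9 / 9 - arctan x) has_real_derivative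
        y ^ 10 / (1 + y\<^sup>2)) (at y)" for y
    proof -
      have "1 - y\<^sup>2 + y ^ 4 - y ^ 6 + y ^ 8 - inverse (1 + y\<^sup>2) = y ^ 10 / (1 + y\<^sup>2)"
        using pos[of y] by (simp add: field_simps eval_nat_numeral)
      then show ?thesis by (auto intro!: derivative_eq_intros)
    qed
    from mono[OF this] show ?thesis using pos by (simp add: less_imp_le)
  qed
  then show "arctan x \<le> x - x ^ 3 / 3 + x ^ 5 / 5 - x ^ 7 / 7 + x ^ 9 / 9" by simp
  have "0 \<le> arctan x - (x - x ^ 3 / 3 + x ^ 5 / 5 - x ^ 7 / 7)"
  proof -
    have "((\<lambda>x. arctan x - (x - x ^ 3 / 3 + x ^ 5 / 5 - x ^ 7 / 7)) has_real_derivative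
        y ^ 8 / (1 + y\<^sup>2)) (at y)" for y
    proof -
      have "inverse (1 + y\<^sup>2) - (1 - y\<^sup>2 + y ^ 4 - y ^ 6) = y ^ 8 / (1 + y\<^sup>2)"
        using pos[of y] by (simp add: field_simps eval_nat_numeral)
      then show ?thesis by (auto intro!: derivative_eq_intros)
    qed
    from mono[OF this] show ?thesis using pos by (simp add: less_imp_le)
  qed
  then show "arctan x \<ge> x - x ^ 3 / 3 + x ^ 5 / 5 - x ^ 7 / 7" by simp
  have "0 \<le> x - arctan x"
  proof -
    have "((\<lambda>x. x - arctan x) has_real_derivative y\<^sup>2 / (1 + y\<^sup>2)) (at y)" for y
    proof -
      have "1 - inverse (1 + y\<^sup>2) = y\<^sup>2 / (1 + y\<^sup>2)" using pos[of y] by (simp add: field_simps)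
      then show ?thesis by (auto intro!: derivative_eq_intros)
    qed
    from mono[OF this] show ?thesis using pos by (simp add: less_imp_le)
  qed
  then show "arctan x \<le> x" by simp
  have "0 \<le> arctan x - (x - x ^ 3 / 3)"
  proof -
    have "((\<lambda>x. arctan x - (x - x ^ 3 / 3)) has_real_derivative y ^ 4 / (1 + y\<^sup>2)) (at y)" for y
    proof -
      have "inverse (1 + y\<^sup>2) - (1 - y\<^sup>2) = y ^ 4 / (1 + y\<^sup>2)"
        using pos[of y] by (simp add: field_simps eval_nat_numeral)
      then show ?thesis by (auto intro!: derivative_eq_intros)
    qed
    from mono[OF this] show ?thesis using pos by (simp add: less_imp_le)
  qed
  then show "arctan x \<ge> x - x ^ 3 / 3" by simp
qed

lemma pi_bounds: "31415 / 10000 < pi" "pi < 31416 / 10000"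
proof -
  have "pi = 4 * (4 * arctan (1 / 5) - arctan (1 / 239))" using machin by simp
  then show "31415 / 10000 < pi" "pi < 31416 / 10000"
    using arctan_bounds_5_7[of "1 / 5"] arctan_bounds_5_7[of "1 / 239"]
    by (simp_all add: power_divide)
qed

lemma exp_minus_le:
  fixes c r :: real
  assumes "c \<ge> 0" "1 \<le> r * (\<Sum>i<n. c ^ i / fact i)"
  shows "exp (- c) \<le> r"
proof -
  have 0: "0 < (\<Sum>i<n. c ^ i / fact i)"
  proof (rule ccontr)
    assume "\<not> ?thesis"
    moreover have "0 \<le> (\<Sum>i<n. c ^ i / fact i)" using assms(1) by (intro sum_nonneg) auto
    ultimately have "(\<Sum>i<n. c ^ i / fact i) = 0" by linarith
    then show False using assms(2) by simp
  qed
  then have r: "r \<ge> 0" using assms(2) by (smt (verit) mult_nonneg_nonpos2 mult_neg_pos)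
  have "1 \<le> r * exp c"
    using assms(2) mult_left_mono[OF exp_ge_Taylor[OF assms(1), of n] r] by linarith
  then show ?thesis by (simp add: exp_minus field_simps)
qed

lemma exp_sums: "(\<lambda>k. x ^ k / fact k) sums exp (x::real)"
  using exp_converges[of x] by (simp add: divide_inverse mult.commute)

lemma cosh_sums: "(\<lambda>k. x ^ (2 * k) / fact (2 * k)) sums cosh (x::real)"
proof -
  define f where "f n = (if even n then x ^ n / fact n else 0)" for n
  have "f sums cosh x"
    using cosh_converges[of x] by (simp add: f_def[abs_def] divide_inverse mult.commute cong: if_cong)
  moreover have "strict_mono ((*) (2::nat))" by (simp add: strict_mono_def)
  moreover have "f n = 0" if "n \<notin> range ((*) 2)" for n using that by (auto simp: f_def elim!: evenE)
  ultimately have "(\<lambda>k. f (2 * k)) sums cosh x" by (subst sums_mono_reindex) auto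
  then show ?thesis by (simp add: f_def)
qed

lemma cosh_minus_1_sums: "(\<lambda>k. x ^ (2 * k + 2) / fact (2 * k + 2)) sums (cosh x - 1 :: real)"
  using sums_split_initial_segment[OF cosh_sums[of x], of 1] by (simp add: algebra_simps)

text \<open>The series of (cosh x - 1) / x^2 has nonnegative coefficients, so the quotient
  increases; it is multiplied out so that x = 0 is included. It will make gains at most linear in
  \<open>d\<close>.\<close>

lemma cosh_minus_1_quotient_mono:
  fixes x y :: real
  assumes "0 \<le> x" "x \<le> y"
  shows "(cosh x - 1) * y\<^sup>2 \<le> (cosh y - 1) * x\<^sup>2"
proof (rule sums_le)
  show "(\<lambda>k. x ^ (2 * k + 2) / fact (2 * k + 2) * y\<^sup>2) sums ((cosh x - 1) * y\<^sup>2)"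
    "(\<lambda>k. y ^ (2 * k + 2) / fact (2 * k + 2) * x\<^sup>2) sums ((cosh y - 1) * x\<^sup>2)"
    by (intro sums_mult2 cosh_minus_1_sums)+
  show "x ^ (2 * k + 2) / fact (2 * k + 2) * y\<^sup>2 \<le> y ^ (2 * k + 2) / fact (2 * k + 2) * x\<^sup>2" for k
  proof -
    have "x ^ (2 * k) * (x\<^sup>2 * y\<^sup>2) \<le> y ^ (2 * k) * (x\<^sup>2 * y\<^sup>2)"
      using assms by (intro mult_right_mono power_mono) auto
    then have "x ^ (2 * k + 2) * y\<^sup>2 \<le> y ^ (2 * k + 2) * x\<^sup>2"
      by (simp add: power_add power2_eq_square mult_ac)
    then show ?thesis by (simp add: divide_right_mono)
  qed
qed

text \<open>Termwise, from 2 * 12^k * k! \<le> (2 k + 2)!. The Gaussian form merges with the other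
  exponentials in the gain.\<close>

lemma cosh_minus_1_le_exp: "cosh x - 1 \<le> x\<^sup>2 / 2 * exp (x\<^sup>2 / 12)" for x :: real
proof (rule sums_le)
  have "(\<lambda>k. (x\<^sup>2 / 12) ^ k / fact k) sums exp (x\<^sup>2 / 12)"
    by (rule exp_sums)
  then show "(\<lambda>k. x\<^sup>2 / 2 * ((x\<^sup>2 / 12) ^ k / fact k)) sums (x\<^sup>2 / 2 * exp (x\<^sup>2 / 12))"
    by (rule sums_mult)
  show "(\<lambda>k. x ^ (2 * k + 2) / fact (2 * k + 2)) sums (cosh x - 1)" by (rule cosh_minus_1_sums)
  show "x ^ (2 * k + 2) / fact (2 * k + 2) \<le> x\<^sup>2 / 2 * ((x\<^sup>2 / 12) ^ k / fact k)" for k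
  proof -
    have "(2::real) * (12 ^ k * fact k) \<le> fact (2 * k + 2)"
    proof (induction k)
      case (Suc k)
      have "(12::real) * (real k + 1) \<le> (2 * real k + 4) * (2 * real k + 3)"
        by (simp add: algebra_simps)
      from mult_mono[OF this Suc.IH]
      have "(12 * (real k + 1)) * (2 * (12 ^ k * fact k)) \<le> ((2 * real k + 4) * (2 * real k + 3)) * fact (2 * k + 2)"
        by simp
      moreover have "fact (2 * Suc k + 2) = ((2 * real k + 4) * (2 * real k + 3)) * fact (2 * k + 2)"
      proof -
        have "2 * Suc k + 2 = Suc (Suc (2 * k + 2))" by simp
        then show ?thesis by (simp only: fact_Suc) (simp add: algebra_simps)
      qed
      ultimately show ?case by (simp add: algebra_simps)
    qed simp
    moreover have "0 \<le> x ^ (2 * k + 2)" by (rule zero_le_even_power) simp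
    ultimately have "x ^ (2 * k + 2) / fact (2 * k + 2) \<le> x ^ (2 * k + 2) / (2 * (12 ^ k * fact k))"
      by (rule divide_left_mono) simp
    then show ?thesis by (simp add: power_divide power_mult power2_eq_square)
  qed
qed

text \<open>From x^8 on the series is dominated by a geometric one of ratio 8/90 = 4/45, since two
  factorial steps contribute at least 9 * 10. The constant 36000 is a round number below 40320 *
  41/45.\<close>

lemma cosh_le_Taylor:
  fixes x :: real assumes "x\<^sup>2 \<le> 8"
  shows "cosh x \<le> 1 + x\<^sup>2 / 2 + x ^ 4 / 24 + x ^ 6 / 720 + x ^ 8 / 36000"
proof -
  have "(\<lambda>k. x ^ (2 * (k + 4)) / fact (2 * (k + 4))) sums
      (cosh x - (\<Sum>k<4. x ^ (2 * k) / fact (2 * k)))"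
    by (rule sums_split_initial_segment[OF cosh_sums])
  moreover have "(\<lambda>k. x ^ 8 / 40320 * (4 / 45) ^ k) sums (x ^ 8 / 40320 * (1 / (1 - 4 / 45)))"
    by (intro sums_mult geometric_sums) simp
  moreover have "x ^ (2 * (k + 4)) / fact (2 * (k + 4)) \<le> x ^ 8 / 40320 * (4 / 45) ^ k" for k
  proof -
    have f: "(40320::real) * 90 ^ k \<le> fact (2 * (k + 4))"
    proof (induction k)
      case (Suc k)
      have "(90::real) \<le> (2 * real k + 10) * (2 * real k + 9)" by (simp add: algebra_simps)
      from mult_mono[OF this Suc.IH]
      have "90 * (40320 * 90 ^ k) \<le> ((2 * real k + 10) * (2 * real k + 9)) * fact (2 * (k + 4))"
        by simp
      moreover have "fact (2 * (Suc k + 4)) = ((2 * real k + 10) * (2 * real k + 9)) * fact (2 * (k + 4))"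
      proof -
        have "2 * (Suc k + 4) = Suc (Suc (2 * (k + 4)))" by simp
        then show ?thesis by (simp only: fact_Suc) (simp add: algebra_simps)
      qed
      ultimately show ?case by simp
    qed (simp add: fact_numeral)
    have "x ^ (2 * (k + 4)) = x ^ (8 + 2 * k)" by (simp add: algebra_simps)
    also have "\<dots> = x ^ 8 * (x\<^sup>2) ^ k" by (simp only: power_add power_mult)
    also have "\<dots> \<le> x ^ 8 * 8 ^ k"
      using assms by (intro mult_left_mono power_mono) (auto simp: zero_le_even_power)
    finally have "x ^ (2 * (k + 4)) / fact (2 * (k + 4)) \<le> (x ^ 8 * 8 ^ k) / (40320 * 90 ^ k)"
      using f by (intro frac_le) (auto simp: zero_le_even_power)
    also have "\<dots> = x ^ 8 / 40320 * (8 / 90) ^ k"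
      by (simp only: power_divide times_divide_times_eq)
    also have "(8 / 90 :: real) = 4 / 45" by simp
    finally show ?thesis .
  qed
  ultimately have "cosh x - (\<Sum>k<4. x ^ (2 * k) / fact (2 * k)) \<le> x ^ 8 / 40320 * (1 / (1 - 4 / 45))"
    by (rule sums_le[rotated]) 
  moreover have "(\<Sum>k<4. x ^ (2 * k) / fact (2 * k)) = 1 + x\<^sup>2 / 2 + x ^ 4 / 24 + x ^ 6 / 720"
    by (simp add: eval_nat_numeral)
  moreover have "x ^ 8 / 40320 * (1 / (1 - 4 / 45)) \<le> x ^ 8 / 36000"
    by (simp add: zero_le_even_power)
  ultimately show ?thesis by linarith
qed

lemma exp_minus_le_Taylor4:
  fixes u :: real assumes "u \<ge> 0"
  shows "exp (- u) \<le> 1 - u + u\<^sup>2 / 2 - u ^ 3 / 6 + u ^ 4 / 24"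
proof -
  define f0 where "f0 u = 1 - u + u\<^sup>2 / 2 - u ^ 3 / 6 + u ^ 4 / 24 - exp (- u)" for u :: real
  define f1 where "f1 u = - 1 + u - u\<^sup>2 / 2 + u ^ 3 / 6 + exp (- u)" for u :: real
  define f2 where "f2 u = 1 - u + u\<^sup>2 / 2 - exp (- u)" for u :: real
  define f3 where "f3 u = - 1 + u + exp (- u)" for u :: real
  have d: "(f0 has_real_derivative f1 u) (at u)" "(f1 has_real_derivative f2 u) (at u)"
    "(f2 has_real_derivative f3 u) (at u)" for u
    unfolding f0_def f1_def f2_def f3_def
    by (auto intro!: derivative_eq_intros simp: field_simps)
  have mono: "f u \<ge> 0" if "\<And>y. DERIV f y :> f' y" "\<And>y. y \<ge> 0 \<Longrightarrow> f' y \<ge> 0" "f 0 = 0" "u \<ge> 0"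
    for f f' :: "real \<Rightarrow> real" and u
    using DERIV_nonneg_imp_nondecreasing[of 0 u f] that by metis
  have 3: "f3 u \<ge> 0" for u using exp_ge_add_one_self[of "- u"] by (simp add: f3_def)
  have 2: "f2 u \<ge> 0" if "u \<ge> 0" for u by (rule mono[OF d(3)]) (use 3 that in \<open>auto simp: f2_def\<close>)
  have 1: "f1 u \<ge> 0" if "u \<ge> 0" for u by (rule mono[OF d(2)]) (use 2 that in \<open>auto simp: f1_def\<close>)
  have "f0 u \<ge> 0" by (rule mono[OF d(1)]) (use 1 assms in \<open>auto simp: f0_def\<close>)
  then show ?thesis by (simp add: f0_def)
qed

text \<open>The tangent of exp, with equality at x = l. It moves a factor B^2 into an exponent;
  \<open>l\<close> is tuned to the range of B^2 at hand.\<close>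

lemma le_exp_tangent: "x \<le> l * exp (x / l - 1)" if "l > 0" for x l :: real
  using exp_ge_add_one_self[of "x / l - 1"] that by (simp add: field_simps)

lemma exp_chord:
  fixes p q a b x :: real
  assumes "a < b" "a \<le> x" "x \<le> b"
  shows "exp (p + q * x) \<le> (b - x) / (b - a) * exp (p + q * a) + (x - a) / (b - a) * exp (p + q * b)"
proof -
  define s where "s = (x - a) / (b - a)"
  have s: "0 \<le> s" "s \<le> 1" "1 - s = (b - x) / (b - a)" using assms by (auto simp: s_def field_simps)
  have "convex_on UNIV (exp :: real \<Rightarrow> real)" by (rule exp_convex)
  then have "exp ((1 - s) *\<^sub>R (p + q * a) + s *\<^sub>R (p + q * b)) \<le> (1 - s) * exp (p + q * a) + s * exp (p + q * b)"
    using s by (intro convex_onD) auto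
  moreover have "(1 - s) *\<^sub>R (p + q * a) + s *\<^sub>R (p + q * b) = p + q * (a + s * (b - a))"
    by (simp add: algebra_simps)
  moreover have "s * (b - a) = x - a" using assms by (simp add: s_def)
  ultimately show ?thesis using s(3) by (simp add: s_def)
qed

text \<open>One step of a Horner scheme with lower bounds: \<open>m\<close> bounds the inner value
  \<open>x\<close>, whose sign is unknown, so d x is at least t min(0, m). The new bound
  \<open>m'\<close> may be rounded down.\<close>

lemma horner_lower:
  fixes d t m x r m' :: real
  assumes "0 \<le> d" "d \<le> t" "m \<le> x" "m' \<le> r + t * min 0 m"
  shows "m' \<le> r + d * x"
proof -
  have "t * min 0 m \<le> d * min 0 m" using assms(2) by (intro mult_right_mono_neg) auto
  also have "\<dots> \<le> d * x" using assms(1,3) by (intro mult_left_mono) auto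
  finally show ?thesis using assms(4) by linarith
qed

lemma combine_bounds:
  fixes G L L' e p p' :: real
  assumes "0 \<le> L' - 2 * (e * (p' - 1)) - G" "L' \<le> L" "p \<le> p'" "e \<ge> 0"
  shows "G \<le> L - 2 * (e * (p - 1))"
proof -
  have "e * (p - 1) \<le> e * (p' - 1)" using assms(3,4) by (intro mult_left_mono) auto
  then show ?thesis using assms(1,2) by linarith
qed

lemma exp_minus_le_power:
  fixes c r \<rho> :: real
  assumes "c \<ge> 0" "1 \<le> \<rho> * (\<Sum>i<n. c ^ i / fact i)" "\<rho> ^ k \<le> r"
  shows "exp (- (real k * c)) \<le> r"
proof -
  have "exp (- (real k * c)) = exp (- c) ^ k" by (simp flip: exp_of_nat_mult)
  also have "\<dots> \<le> \<rho> ^ k" by (intro power_mono exp_minus_le[OF assms(1,2)]) simp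
  finally show ?thesis using assms(3) by simp
qed

text \<open>Decimal bounds cited by number below. Each exponent is divided by a power of 2 until it
  is at most 1; eight Taylor terms then give \<rho>, and its power the bound.\<close>

lemma exp_minus_bounds:
  shows "exp (- (1902 / 1000)) \<le> (1493 / 10000 :: real)"
    and "exp (- (26024 / 10000)) \<le> (741 / 10000 :: real)"
    and "exp (- (349 / 100)) \<le> (31 / 1000 :: real)"
    and "exp (- (6204 / 1000)) \<le> (20216 / 10000000 :: real)"
    and "exp (- (6803 / 1000)) \<le> (1111 / 1000000 :: real)"
    and "exp (- (8)) \<le> (4 / 10000 :: real)"
    and "exp (- (7194 / 1000)) \<le> (752 / 1000000 :: real)"
    and "exp (- (2246 / 1000)) \<le> (106 / 1000 :: real)"
    and "exp (- (12566 / 1000)) \<le> (35 / 10000000 :: real)"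
    and "exp (- (314 / 100)) \<le> (44 / 1000 :: real)"
    and "exp (- (52048 / 10000)) \<le> (55 / 10000 :: real)"
    and "exp (- (4398 / 1000)) \<le> (1231 / 100000 :: real)"
    and "exp (- (647 / 100)) \<le> (16 / 10000 :: real)"
    and "exp (- (1474 / 1000)) \<le> (2295 / 10000 :: real)"
    and "exp (- (81 / 100)) \<le> (445 / 1000 :: real)"
    and "exp (- (8167 / 10000)) \<le> (442 / 1000 :: real)"
    and "exp (- (3769 / 10000)) \<le> (686 / 1000 :: real)"
proof -
  show "exp (- (1902 / 1000)) \<le> (1493 / 10000 :: real)"
    using exp_minus_le_power[where k = 2 and c = "951 / 1000" and \<rho> = "9659 / 25000" and n = 8 and r = "1493 / 10000"]
    by (simp add: eval_nat_numeral)
  show "exp (- (26024 / 10000)) \<le> (741 / 10000 :: real)"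
    using exp_minus_le_power[where k = 4 and c = "3253 / 5000" and \<rho> = "26087 / 50000" and n = 8 and r = "741 / 10000"]
    by (simp add: eval_nat_numeral)
  show "exp (- (349 / 100)) \<le> (31 / 1000 :: real)"
    using exp_minus_le_power[where k = 4 and c = "349 / 400" and \<rho> = "209 / 500" and n = 8 and r = "31 / 1000"]
    by (simp add: eval_nat_numeral)
  show "exp (- (6204 / 1000)) \<le> (20216 / 10000000 :: real)"
    using exp_minus_le_power[where k = 8 and c = "1551 / 2000" and \<rho> = "1439 / 3125" and n = 8 and r = "20216 / 10000000"]
    by (simp add: eval_nat_numeral)
  show "exp (- (6803 / 1000)) \<le> (1111 / 1000000 :: real)"
    using exp_minus_le_power[where k = 8 and c = "6803 / 8000" and \<rho> = "21363 / 50000" and n = 8 and r = "1111 / 1000000"]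
    by (simp add: eval_nat_numeral)
  show "exp (- (8)) \<le> (4 / 10000 :: real)"
    using exp_minus_le_power[where k = 8 and c = "1 / 1" and \<rho> = "46 / 125" and n = 8 and r = "4 / 10000"]
    by (simp add: eval_nat_numeral)
  show "exp (- (7194 / 1000)) \<le> (752 / 1000000 :: real)"
    using exp_minus_le_power[where k = 8 and c = "3597 / 4000" and \<rho> = "4069 / 10000" and n = 8 and r = "752 / 1000000"]
    by (simp add: eval_nat_numeral)
  show "exp (- (2246 / 1000)) \<le> (106 / 1000 :: real)"
    using exp_minus_le_power[where k = 4 and c = "1123 / 2000" and \<rho> = "713 / 1250" and n = 8 and r = "106 / 1000"]
    by (simp add: eval_nat_numeral)
  show "exp (- (12566 / 1000)) \<le> (35 / 10000000 :: real)"
    using exp_minus_le_power[where k = 16 and c = "6283 / 8000" and \<rho> = "57 / 125" and n = 8 and r = "35 / 10000000"]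
    by (simp add: eval_nat_numeral)
  show "exp (- (314 / 100)) \<le> (44 / 1000 :: real)"
    using exp_minus_le_power[where k = 4 and c = "157 / 200" and \<rho> = "457 / 1000" and n = 8 and r = "44 / 1000"]
    by (simp add: eval_nat_numeral)
  show "exp (- (52048 / 10000)) \<le> (55 / 10000 :: real)"
    using exp_minus_le_power[where k = 8 and c = "3253 / 5000" and \<rho> = "2609 / 5000" and n = 8 and r = "55 / 10000"]
    by (simp add: eval_nat_numeral)
  show "exp (- (4398 / 1000)) \<le> (1231 / 100000 :: real)"
    using exp_minus_le_power[where k = 8 and c = "2199 / 4000" and \<rho> = "5771 / 10000" and n = 8 and r = "1231 / 100000"]
    by (simp add: eval_nat_numeral)
  show "exp (- (647 / 100)) \<le> (16 / 10000 :: real)"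
    using exp_minus_le_power[where k = 8 and c = "647 / 800" and \<rho> = "223 / 500" and n = 8 and r = "16 / 10000"]
    by (simp add: eval_nat_numeral)
  show "exp (- (1474 / 1000)) \<le> (2295 / 10000 :: real)"
    using exp_minus_le_power[where k = 2 and c = "737 / 1000" and \<rho> = "479 / 1000" and n = 8 and r = "2295 / 10000"]
    by (simp add: eval_nat_numeral)
  show "exp (- (81 / 100)) \<le> (445 / 1000 :: real)"
    using exp_minus_le_power[where k = 1 and c = "81 / 100" and \<rho> = "89 / 200" and n = 8 and r = "445 / 1000"]
    by (simp add: eval_nat_numeral)
  show "exp (- (8167 / 10000)) \<le> (442 / 1000 :: real)"
    using exp_minus_le_power[where k = 1 and c = "8167 / 10000" and \<rho> = "221 / 500" and n = 8 and r = "442 / 1000"]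
    by (simp add: eval_nat_numeral)
  show "exp (- (3769 / 10000)) \<le> (686 / 1000 :: real)"
    using exp_minus_le_power[where k = 1 and c = "3769 / 10000" and \<rho> = "343 / 500" and n = 8 and r = "686 / 1000"]
    by (simp add: eval_nat_numeral)
qed

text \<open>The numbers belong to A = (1 + sqrt 13) / 2: 12566/1000 is below 4 pi, 3617/250 below 2
  pi A, 1286/25 above 4 pi^2 B^2, and 1493/10000 above exp(-2 pi (A - 2)). On the right stands a
  root of unity's loss minus twice the gain; the cubic factor on the left follows it closely, and
  3051/2000 is just below the margin of the linear terms.\<close>

lemma loss_polynomial_tight:
  fixes d :: real assumes d: "0 \<le> d" "d \<le> 93 / 2500"
  shows "d * (3051 / 2000 + (-684 / 25) * d + 304 * d\<^sup>2 + (-1900) * d ^ 3) \<le>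
    (12566 / 1000 * d - (12566 / 1000 * d)\<^sup>2 / 2 + (12566 / 1000 * d) ^ 3 / 6 - (12566 / 1000 * d) ^ 4 / 24) - 2 * (1493 / 10000 * ((1 - 3617 / 250 * d + (3617 / 250 * d)\<^sup>2 / 2 - (3617 / 250 * d) ^ 3 / 6 + (3617 / 250 * d) ^ 4 / 24) *
    (1 + 1286 / 25 * (d * (1 + d / 2)) + (1286 / 25)\<^sup>2 * d\<^sup>2 * (1 + 102 / 100 * d) / 6 +
      (1286 / 25) ^ 3 * d ^ 3 * (1 + 154 / 100 * d) / 90 + (1286 / 25) ^ 4 * d ^ 4 * (111 / 100) / 2250) - 1))"
    (is "?G \<le> ?L - 2 * (_ * (?P * ?C - 1))")
proof -
  have pos: "0 \<le> d ^ k" for k using d by simp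
  have pwP: "(3617 / 250 * d)\<^sup>2 = 13082689 / 62500 * d ^ 2" "(3617 / 250 * d) ^ 3 = 47320086113 / 15625000 * d ^ 3" "(3617 / 250 * d) ^ 4 = 171156751470721 / 3906250000 * d ^ 4"
    by (simp_all add: power_mult_distrib power_divide)
  have pwL: "(12566 / 1000 * d)\<^sup>2 = 39476089 / 250000 * d ^ 2" "(12566 / 1000 * d) ^ 3 = 248028267187 / 125000000 * d ^ 3" "(12566 / 1000 * d) ^ 4 = 1558361602735921 / 62500000000 * d ^ 4"
    by (simp_all add: power_mult_distrib power_divide)
  \<comment> \<open>Coefficients are rounded to short decimals in the safe direction before the two
    factors are multiplied.\<close>
  have P: "?P \<le> 1 + (-3617 / 250) * d + (10467 / 100) * d ^ 2 + (-5047 / 10) * d ^ 3 + (1826) * d ^ 4"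
    using pos[of 2] pos[of 3] pos[of 4] pwP by linarith
  have C: "?C \<le> 1 + 1286 / 25 * d + 2334 / 5 * d ^ 2 + 1963 * d ^ 3 + 5784 * d ^ 4"
  proof -
    have "?C = 1 + 1286 / 25 * d + 875123 / 1875 * d ^ 2 + 1379679313 / 703125 * d ^ 3 + 63536538582172 / 10986328125 * d ^ 4"
      by (simp add: field_simps eval_nat_numeral)
    then show ?thesis using pos[of 2] pos[of 3] pos[of 4] by linarith
  qed
  have L: "?L \<ge> 6283 / 500 * d + (-1974 / 25) * d ^ 2 + (3307 / 10) * d ^ 3 + (-1039) * d ^ 4"
    using pos[of 2] pos[of 3] pos[of 4] pwL by linarith
  have "0 \<le> ?P" using exp_minus_le_Taylor4[of "3617 / 250 * d"] d by (intro order_trans[OF exp_ge_zero]) auto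
  moreover have "0 \<le> ?C" using d by simp
  ultimately have PC: "?P * ?C \<le> (1 + (-3617 / 250) * d + (10467 / 100) * d ^ 2 + (-5047 / 10) * d ^ 3 + (1826) * d ^ 4) * (1 + 1286 / 25 * d + 2334 / 5 * d ^ 2 + 1963 * d ^ 3 + 5784 * d ^ 4)"
    using P C by (intro mult_mono) auto
  \<comment> \<open>The difference of the two sides, divided by d, has degree 7. Horner's scheme
    bounds it below from the leading coefficient down; only the last bound must be
    nonnegative.\<close>
  have h8: "-3153689 \<le> (-1971055614 / 625 :: real)" by simp
  have h7: "-315962 \<le> -2483057569 / 12500 + d * (-1971055614 / 625)"
    by (rule horner_lower[OF d h8]) simp
  have h6: "-151219 \<le> -34866176807 / 250000 + d * (-2483057569 / 12500 + d * (-1971055614 / 625))"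
    by (rule horner_lower[OF d h7]) simp
  have h5: "0 \<le> 14840585723 / 2500000 + d * (-34866176807 / 250000 + d * (-2483057569 / 12500 + d * (-1971055614 / 625)))"
    by (rule horner_lower[OF d h6]) simp
  have h4: "0 \<le> 72406033 / 312500 + d * (14840585723 / 2500000 + d * (-34866176807 / 250000 + d * (-2483057569 / 12500 + d * (-1971055614 / 625))))"
    by (rule horner_lower[OF d h5]) simp
  have h3: "0 \<le> 517773 / 3125000 + d * (72406033 / 312500 + d * (14840585723 / 2500000 + d * (-34866176807 / 250000 + d * (-2483057569 / 12500 + d * (-1971055614 / 625)))))"
    by (rule horner_lower[OF d h4]) simp
  have h2: "-127 / 10000 \<le> -793343 / 62500000 + d * (517773 / 3125000 + d * (72406033 / 312500 + d * (14840585723 / 2500000 + d * (-34866176807 / 250000 + d * (-2483057569 / 12500 + d * (-1971055614 / 625))))))"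
    by (rule horner_lower[OF d h3]) simp
  have h1: "0 \<le> 413 / 625000 + d * (-793343 / 62500000 + d * (517773 / 3125000 + d * (72406033 / 312500 + d * (14840585723 / 2500000 + d * (-34866176807 / 250000 + d * (-2483057569 / 12500 + d * (-1971055614 / 625)))))))"
    by (rule horner_lower[OF d h2]) simp
  have "0 \<le> d * (413 / 625000 + d * (-793343 / 62500000 + d * (517773 / 3125000 + d * (72406033 / 312500 + d * (14840585723 / 2500000 + d * (-34866176807 / 250000 + d * (-2483057569 / 12500 + d * (-1971055614 / 625))))))))" using h1 d(1) by simp
  also have "\<dots> = 6283 / 500 * d + (-1974 / 25) * d ^ 2 + (3307 / 10) * d ^ 3 + (-1039) * d ^ 4 - 2 * (1493 / 10000 * ((1 + (-3617 / 250) * d + (10467 / 100) * d ^ 2 + (-5047 / 10) * d ^ 3 + (1826) * d ^ 4) *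
    (1 + 1286 / 25 * d + 2334 / 5 * d ^ 2 + 1963 * d ^ 3 + 5784 * d ^ 4) - 1)) - ?G"
    by (simp add: field_simps eval_nat_numeral)
  finally show ?thesis by (rule combine_bounds[OF _ L PC]) simp
qed

text \<open>The same comparison for A = 1 + sqrt 2, with 1896/125 below 2 pi A, 7219/100 above 4
  pi^2 B^2 and 741/10000 above exp(-2 pi (A - 2)).\<close>

lemma loss_polynomial_silver:
  fixes d :: real assumes d: "0 \<le> d" "d \<le> 253 / 5000"
  shows "d * (823 / 200 + (-3391 / 50) * d + 468 * d\<^sup>2 + (-2400) * d ^ 3) \<le>
    (12566 / 1000 * d - (12566 / 1000 * d)\<^sup>2 / 2 + (12566 / 1000 * d) ^ 3 / 6 - (12566 / 1000 * d) ^ 4 / 24) - 2 * (741 / 10000 * ((1 - 1896 / 125 * d + (1896 / 125 * d)\<^sup>2 / 2 - (1896 / 125 * d) ^ 3 / 6 + (1896 / 125 * d) ^ 4 / 24) *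
    (1 + 7219 / 100 * (d * (1 + d / 2)) + (7219 / 100)\<^sup>2 * d\<^sup>2 * (1 + 102 / 100 * d) / 6 +
      (7219 / 100) ^ 3 * d ^ 3 * (1 + 154 / 100 * d) / 90 + (7219 / 100) ^ 4 * d ^ 4 * (111 / 100) / 2250) - 1))"
    (is "?G \<le> ?L - 2 * (_ * (?P * ?C - 1))")
proof -
  have pos: "0 \<le> d ^ k" for k using d by simp
  have pwP: "(1896 / 125 * d)\<^sup>2 = 3594816 / 15625 * d ^ 2" "(1896 / 125 * d) ^ 3 = 6815771136 / 1953125 * d ^ 3" "(1896 / 125 * d) ^ 4 = 12922702073856 / 244140625 * d ^ 4"
    by (simp_all add: power_mult_distrib power_divide)
  have pwL: "(12566 / 1000 * d)\<^sup>2 = 39476089 / 250000 * d ^ 2" "(12566 / 1000 * d) ^ 3 = 248028267187 / 125000000 * d ^ 3" "(12566 / 1000 * d) ^ 4 = 1558361602735921 / 62500000000 * d ^ 4"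
    by (simp_all add: power_mult_distrib power_divide)
  have P: "?P \<le> 1 + (-1896 / 125) * d + (2876 / 25) * d ^ 2 + (-2908 / 5) * d ^ 3 + (2206) * d ^ 4"
    using pos[of 2] pos[of 3] pos[of 4] pwP by linarith
  have C: "?C \<le> 1 + 7219 / 100 * d + 9047 / 10 * d ^ 2 + 5067 * d ^ 3 + 19836 * d ^ 4"
  proof -
    have "?C = 1 + 7219 / 100 * d + 54279661 / 60000 * d ^ 2 + 455945044789 / 90000000 * d ^ 3 + 446302120869871831 / 22500000000000 * d ^ 4"
      by (simp add: field_simps eval_nat_numeral)
    then show ?thesis using pos[of 2] pos[of 3] pos[of 4] by linarith
  qed
  have L: "?L \<ge> 6283 / 500 * d + (-1974 / 25) * d ^ 2 + (3307 / 10) * d ^ 3 + (-1039) * d ^ 4"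
    using pos[of 2] pos[of 3] pos[of 4] pwL by linarith
  have "0 \<le> ?P" using exp_minus_le_Taylor4[of "1896 / 125 * d"] d by (intro order_trans[OF exp_ge_zero]) auto
  moreover have "0 \<le> ?C" using d by simp
  ultimately have PC: "?P * ?C \<le> (1 + (-1896 / 125) * d + (2876 / 25) * d ^ 2 + (-2908 / 5) * d ^ 3 + (2206) * d ^ 4) * (1 + 7219 / 100 * d + 9047 / 10 * d ^ 2 + 5067 * d ^ 3 + 19836 * d ^ 4)"
    using P C by (intro mult_mono) auto
  have h8: "-6484968 \<le> (-4053104757 / 625 :: real)" by simp
  have h7: "-274963 \<le> 664705899 / 12500 + d * (-4053104757 / 625)"
    by (rule horner_lower[OF d h8]) simp
  have h6: "-211128 \<le> -24651855501 / 125000 + d * (664705899 / 12500 + d * (-4053104757 / 625))"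
    by (rule horner_lower[OF d h7]) simp
  have h5: "0 \<le> 15725344167 / 1250000 + d * (-24651855501 / 125000 + d * (664705899 / 12500 + d * (-4053104757 / 625)))"
    by (rule horner_lower[OF d h6]) simp
  have h4: "0 \<le> 176618069 / 625000 + d * (15725344167 / 1250000 + d * (-24651855501 / 125000 + d * (664705899 / 12500 + d * (-4053104757 / 625))))"
    by (rule horner_lower[OF d h5]) simp
  have h3: "0 \<le> 136651 / 156250 + d * (176618069 / 625000 + d * (15725344167 / 1250000 + d * (-24651855501 / 125000 + d * (664705899 / 12500 + d * (-4053104757 / 625)))))"
    by (rule horner_lower[OF d h4]) simp
  have h2: "0 \<le> 320617 / 31250000 + d * (136651 / 156250 + d * (176618069 / 625000 + d * (15725344167 / 1250000 + d * (-24651855501 / 125000 + d * (664705899 / 12500 + d * (-4053104757 / 625))))))"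
    by (rule horner_lower[OF d h3]) simp
  have h1: "0 \<le> 849 / 2500000 + d * (320617 / 31250000 + d * (136651 / 156250 + d * (176618069 / 625000 + d * (15725344167 / 1250000 + d * (-24651855501 / 125000 + d * (664705899 / 12500 + d * (-4053104757 / 625)))))))"
    by (rule horner_lower[OF d h2]) simp
  have "0 \<le> d * (849 / 2500000 + d * (320617 / 31250000 + d * (136651 / 156250 + d * (176618069 / 625000 + d * (15725344167 / 1250000 + d * (-24651855501 / 125000 + d * (664705899 / 12500 + d * (-4053104757 / 625))))))))" using h1 d(1) by simp
  also have "\<dots> = 6283 / 500 * d + (-1974 / 25) * d ^ 2 + (3307 / 10) * d ^ 3 + (-1039) * d ^ 4 - 2 * (741 / 10000 * ((1 + (-1896 / 125) * d + (2876 / 25) * d ^ 2 + (-2908 / 5) * d ^ 3 + (2206) * d ^ 4) *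
    (1 + 7219 / 100 * d + 9047 / 10 * d ^ 2 + 5067 * d ^ 3 + 19836 * d ^ 4) - 1)) - ?G"
    by (simp add: field_simps eval_nat_numeral)
  finally show ?thesis by (rule combine_bounds[OF _ L PC]) simp
qed

section \<open>The gain of a pair of conjugate elements\<close>

lemma chord_square: "a \<le> A \<Longrightarrow> A \<le> b \<Longrightarrow> A\<^sup>2 \<le> (a + b) * A - a * b" for a A b :: real
  using mult_nonneg_nonneg[of "A - a" "b - A"] by (simp add: power2_eq_square algebra_simps)

text \<open>The average of the weights of \<open>x\<close> and \<open>\<tau> x\<close> at distortion \<open>d\<close>, minus their common weight at \<open>d = 0\<close>,
  for \<open>A = |\<sigma> x|\<^sup>2 + |\<sigma>' x|\<^sup>2\<close> and \<open>B = ||\<sigma> x|\<^sup>2 - |\<sigma>' x|\<^sup>2|\<close>; here \<open>1 + d\<close> and \<open>(2 d + d\<^sup>2)\<^sup>1\<^sup>/\<^sup>2\<close> are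
  \<open>cosh t\<close> and \<open>sinh t\<close> for \<open>p = exp t\<close>.\<close>

definition gain :: "real \<Rightarrow> real \<Rightarrow> real \<Rightarrow> real" where
  "gain A B d = exp (- (2 * pi) * (A - 2)) *
     (exp (- (2 * pi) * A * d) * cosh (2 * pi * B * sqrt (2 * d + d\<^sup>2)) - 1)"

lemma two_pi_mult_le: "x \<ge> 0 \<Longrightarrow> 6283 / 1000 * x \<le> 2 * pi * x"
  using pi_bounds by (intro mult_right_mono) auto

lemma pi_square_le: "pi\<^sup>2 \<le> 986966 / 100000"
proof -
  have "pi\<^sup>2 \<le> (31416 / 10000)\<^sup>2" using pi_bounds by (intro power_mono) auto
  then show ?thesis by (simp add: power2_eq_square)
qed

text \<open>A root of unity has A = 2 and B = 0, so its weight falls from 1 to exp(-4 pi d).\<close>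

lemma torsion_loss_ge:
  fixes d :: real assumes "0 \<le> d"
  shows "1 - exp (- (4 * pi) * d) \<ge>
    12566 / 1000 * d - (12566 / 1000 * d)\<^sup>2 / 2 + (12566 / 1000 * d) ^ 3 / 6 - (12566 / 1000 * d) ^ 4 / 24"
proof -
  have "12566 / 1000 * d \<le> 4 * pi * d" using pi_bounds assms by (intro mult_right_mono) auto
  then have "exp (- (4 * pi) * d) \<le> exp (- (12566 / 1000 * d))" by simp
  also have "\<dots> \<le> 1 - (12566 / 1000 * d) + (12566 / 1000 * d)\<^sup>2 / 2 - (12566 / 1000 * d) ^ 3 / 6 + (12566 / 1000 * d) ^ 4 / 24"
    by (rule exp_minus_le_Taylor4) (use assms in simp)
  finally show ?thesis by simp
qed

lemma torsion_loss_ge_linear: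
  fixes d :: real assumes "0 \<le> d" "d \<le> 506 / 10000"
  shows "1 - exp (- (4 * pi) * d) \<ge> 85 / 10 * d"
    and "d \<le> 3 / 100 \<Longrightarrow> 1 - exp (- (4 * pi) * d) \<ge> 101 / 10 * d"
proof -
  have pwL: "(12566 / 1000 * d)\<^sup>2 = 39476089 / 250000 * d\<^sup>2" "(12566 / 1000 * d) ^ 3 = 248028267187 / 125000000 * d ^ 3"
    "(12566 / 1000 * d) ^ 4 = 1558361602735921 / 62500000000 * d ^ 4"
    by (simp_all add: power_mult_distrib power_divide)
  have pw: "d\<^sup>2 \<le> u * d" "0 \<le> d ^ 3" "d ^ 4 \<le> u * d ^ 3" if "d \<le> u" for u
    using assms(1) mult_right_mono[OF that assms(1)] mult_right_mono[OF that, of "d ^ 3"]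
    by (simp_all add: eval_nat_numeral)
  show "1 - exp (- (4 * pi) * d) \<ge> 85 / 10 * d"
    using torsion_loss_ge[OF assms(1)] pwL pw[OF assms(2)] assms(1) by linarith
  show "1 - exp (- (4 * pi) * d) \<ge> 101 / 10 * d" if "d \<le> 3 / 100"
    using torsion_loss_ge[OF assms(1)] pwL pw[OF that] assms(1) by linarith
qed

text \<open>cosh X is expanded in z = \<beta> d (1 + d / 2), where X^2 \<le> 2 z; the constants
  102/100, 154/100 and 111/100 bound powers of 1 + d / 2 on the range of d. The maximum with 0
  covers a nonpositive gain, where replacing exp(-2 pi (A - 2)) by the larger \<epsilon> would go
  the wrong way.\<close>

lemma gain_le_polynomial:
  assumes d: "0 \<le> d" "d \<le> 506 / 10000" and A: "A \<ge> 2" and B: "B \<ge> 0"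
    and \<alpha>: "0 \<le> \<alpha>" "\<alpha> \<le> 2 * pi * A" and \<beta>: "4 * pi\<^sup>2 * B\<^sup>2 \<le> \<beta>" "\<beta> * (2 * d + d\<^sup>2) \<le> 8"
    and \<epsilon>: "exp (- (2 * pi) * (A - 2)) \<le> \<epsilon>"
  shows "gain A B d \<le> max 0 (\<epsilon> * ((1 - \<alpha> * d + (\<alpha> * d)\<^sup>2 / 2 - (\<alpha> * d) ^ 3 / 6 + (\<alpha> * d) ^ 4 / 24) *
    (1 + \<beta> * (d * (1 + d / 2)) + \<beta>\<^sup>2 * d\<^sup>2 * (1 + 102 / 100 * d) / 6 +
      \<beta> ^ 3 * d ^ 3 * (1 + 154 / 100 * d) / 90 + \<beta> ^ 4 * d ^ 4 * (111 / 100) / 2250) - 1))"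
    (is "_ \<le> max 0 (\<epsilon> * (?P * ?C - 1))")
proof -
  define X where "X = 2 * pi * B * sqrt (2 * d + d\<^sup>2)"
  define z where "z = \<beta> * (d * (1 + d / 2))"
  have \<beta>0: "\<beta> \<ge> 0" using \<beta>(1) by (smt (verit) mult_nonneg_nonneg zero_le_power2)
  have X2: "X\<^sup>2 = 4 * pi\<^sup>2 * B\<^sup>2 * (2 * d + d\<^sup>2)"
    using d by (simp add: X_def power_mult_distrib)
  have "X\<^sup>2 \<le> \<beta> * (2 * d + d\<^sup>2)"
    unfolding X2 using \<beta>(1) d by (intro mult_right_mono) auto
  then have Xz: "X\<^sup>2 \<le> 2 * z" by (simp add: z_def power2_eq_square algebra_simps)
  have z0: "0 \<le> z" using \<beta>0 d by (simp add: z_def)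
  have "cosh X \<le> 1 + X\<^sup>2 / 2 + X ^ 4 / 24 + X ^ 6 / 720 + X ^ 8 / 36000"
    using \<open>X\<^sup>2 \<le> \<beta> * (2 * d + d\<^sup>2)\<close> \<beta>(2) by (intro cosh_le_Taylor) simp
  also have "\<dots> = 1 + X\<^sup>2 / 2 + (X\<^sup>2)\<^sup>2 / 24 + (X\<^sup>2) ^ 3 / 720 + (X\<^sup>2) ^ 4 / 36000"
    by (simp flip: power_mult)
  also have "\<dots> \<le> 1 + (2 * z) / 2 + (2 * z)\<^sup>2 / 24 + (2 * z) ^ 3 / 720 + (2 * z) ^ 4 / 36000"
    using Xz by (intro add_mono divide_right_mono power_mono) auto
  also have "\<dots> = 1 + z + z\<^sup>2 / 6 + z ^ 3 / 90 + z ^ 4 / 2250"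
    by (simp add: power_mult_distrib)
  also have "\<dots> \<le> ?C"
  proof -
    have dd: "d * d \<le> 506 / 10000 * d" "d * d * d \<le> 506 / 10000 * (d * d)"
      using mult_right_mono[OF d(2) d(1)] mult_right_mono[OF d(2), of "d * d"] d(1)
      by (simp_all add: mult_ac)
    have "(1 + d / 2)\<^sup>2 = 1 + d + d * d / 4" "(1 + d / 2) ^ 3 = 1 + 3 / 2 * d + 3 / 4 * (d * d) + d * d * d / 8"
      by (simp_all add: eval_nat_numeral field_simps)
    then have q2: "(1 + d / 2)\<^sup>2 \<le> 1 + 102 / 100 * d" and q3: "(1 + d / 2) ^ 3 \<le> 1 + 154 / 100 * d"
      using d dd by linarith+
    have "(1 + d / 2) ^ 4 \<le> (1 + 506 / 10000 / 2) ^ 4" using d by (intro power_mono) auto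
    also have "\<dots> \<le> 111 / 100" by (simp add: eval_nat_numeral)
    finally have q4: "(1 + d / 2) ^ 4 \<le> 111 / 100" .
    have "z\<^sup>2 \<le> \<beta>\<^sup>2 * d\<^sup>2 * (1 + 102 / 100 * d)"
      unfolding z_def power_mult_distrib mult.assoc by (intro mult_left_mono q2 zero_le_power \<beta>0 d(1))
    moreover have "z ^ 3 \<le> \<beta> ^ 3 * d ^ 3 * (1 + 154 / 100 * d)"
      unfolding z_def power_mult_distrib mult.assoc by (intro mult_left_mono q3 zero_le_power \<beta>0 d(1))
    moreover have "z ^ 4 \<le> \<beta> ^ 4 * d ^ 4 * (111 / 100)"
      unfolding z_def power_mult_distrib mult.assoc by (intro mult_left_mono q4 zero_le_power \<beta>0 d(1))
    ultimately show ?thesis unfolding z_def[symmetric] by (intro add_mono divide_right_mono) auto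
  qed
  finally have C: "cosh X \<le> ?C" .
  have "\<alpha> * d \<le> 2 * pi * A * d" using \<alpha> d by (intro mult_right_mono) auto
  then have "exp (- (2 * pi) * A * d) \<le> exp (- (\<alpha> * d))" by simp
  also have "\<dots> \<le> ?P" by (rule exp_minus_le_Taylor4) (use \<alpha> d in simp)
  finally have P: "exp (- (2 * pi) * A * d) \<le> ?P" .
  have PC: "exp (- (2 * pi) * A * d) * cosh X \<le> ?P * ?C"
    using P C by (intro mult_mono) (auto intro: order_trans[OF exp_ge_zero P])
  show ?thesis
  proof (cases "exp (- (2 * pi) * A * d) * cosh X \<le> 1")
    case True
    then have "gain A B d \<le> 0" unfolding gain_def X_def[symmetric] by (simp add: mult_nonneg_nonpos)
    then show ?thesis by simp
  next
    case False
    then have "gain A B d \<le> \<epsilon> * (?P * ?C - 1)"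
      unfolding gain_def X_def[symmetric] using PC \<epsilon> order_trans[OF exp_ge_zero \<epsilon>] by (intro mult_mono) auto
    then show ?thesis by simp
  qed
qed

lemma combine_gain:
  fixes g M G L L' :: real
  shows "g \<le> max 0 M \<Longrightarrow> G \<le> L' - 2 * M \<Longrightarrow> L' \<le> L \<Longrightarrow> g \<le> 0 \<or> G \<le> L - 2 * g"
  by (auto simp: max_def split: if_splits)

text \<open>The bound 372/10000 on d is what minimality of 1 allows for this A. The slopes 83/100
  and 87/100 are just enough for six roots of unity to pay for twelve other short vectors and the
  tail.\<close>

lemma unit_loss_tight:
  assumes A: "A\<^sup>2 - A = 3" "A > 2" and B: "B \<ge> 0" "B\<^sup>2 = A\<^sup>2 - 4" and d: "0 \<le> d" "d \<le> 372 / 10000"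
  shows "1 - exp (- (4 * pi) * d) - 2 * gain A B d \<ge> 83 / 100 * d"
    and "d \<le> 3 / 100 \<Longrightarrow> 1 - exp (- (4 * pi) * d) - 2 * gain A B d \<ge> 87 / 100 * d"
proof -
  have Alo: "A \<ge> 230277 / 100000"
  proof (rule ccontr)
    assume "\<not> ?thesis"
    then have "A * (A - 1) < 230277 / 100000 * (130277 / 100000)"
      using A by (intro mult_strict_mono) auto
    then show False using A(1) by (simp add: power2_eq_square algebra_simps)
  qed
  have Ahi: "A \<le> 2302777 / 1000000"
  proof (rule ccontr)
    assume "\<not> ?thesis"
    then have "2302777 / 1000000 * (1302777 / 1000000) < A * (A - 1)"
      by (intro mult_strict_mono) auto
    then show False using A(1) by (simp add: power2_eq_square algebra_simps)
  qed
  have B2: "B\<^sup>2 \<le> 1302777 / 1000000" using B(2) A(1) Ahi by simp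
  have b: "4 * pi\<^sup>2 * B\<^sup>2 \<le> 1286 / 25"
    using mult_mono[OF pi_square_le B2] by (simp add: mult.commute)
  have a: "3617 / 250 \<le> 2 * pi * A"
    using mult_mono[of "2 * (31415 / 10000)" "2 * pi" "230277 / 100000" A] pi_bounds Alo by (simp add: mult.commute)
  have e: "exp (- (2 * pi) * (A - 2)) \<le> 1493 / 10000"
  proof -
    have "1902 / 1000 \<le> 6283 / 1000 * (A - 2)" using Alo by simp
    also have "\<dots> \<le> 2 * pi * (A - 2)" using Alo by (intro two_pi_mult_le) simp
    finally have "exp (- (2 * pi) * (A - 2)) \<le> exp (- (1902 / 1000))" by simp
    also have "\<dots> \<le> 1493 / 10000"
      by (rule exp_minus_bounds(1))
    finally show ?thesis .
  qed
  have pw: "d\<^sup>2 \<le> u * d" "d ^ 3 \<ge> 0" "d ^ 3 \<le> u * d\<^sup>2" "d ^ 4 \<le> u * d ^ 3" if "d \<le> u" for u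
    using d that by (auto simp: eval_nat_numeral intro!: mult_right_mono)
  have "1286 / 25 * (2 * d + d\<^sup>2) \<le> 8" using pw(1)[OF d(2)] d(2) by simp
  from gain_le_polynomial[OF d(1) _ less_imp_le[OF A(2)] B(1) _ a b this e] d(2)
  have "gain A B d \<le> max 0 (1493 / 10000 * ((1 - 3617 / 250 * d + (3617 / 250 * d)\<^sup>2 / 2 - (3617 / 250 * d) ^ 3 / 6 + (3617 / 250 * d) ^ 4 / 24) *
    (1 + 1286 / 25 * (d * (1 + d / 2)) + (1286 / 25)\<^sup>2 * d\<^sup>2 * (1 + 102 / 100 * d) / 6 +
      (1286 / 25) ^ 3 * d ^ 3 * (1 + 154 / 100 * d) / 90 + (1286 / 25) ^ 4 * d ^ 4 * (111 / 100) / 2250) - 1))"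
    by simp
  from combine_gain[OF this loss_polynomial_tight[OF d(1)] torsion_loss_ge[OF d(1)]] d(2)
  have g: "gain A B d \<le> 0 \<or> d * (3051 / 2000 + (- 684 / 25) * d + 304 * d\<^sup>2 + (- 1900) * d ^ 3) \<le>
    1 - exp (- (4 * pi) * d) - 2 * gain A B d"
    by simp
  have q: "83 / 100 \<le> 3051 / 2000 + (- 684 / 25) * d + 304 * d\<^sup>2 + (- 1900) * d ^ 3"
    "d \<le> 3 / 100 \<Longrightarrow> 87 / 100 \<le> 3051 / 2000 + (- 684 / 25) * d + 304 * d\<^sup>2 + (- 1900) * d ^ 3"
  proof -
    \<comment> \<open>This linear lower bound for d^2 is exact at d = 372/10000, where the
      decreasing cubic is smallest; the square below does the same at 3/100.\<close>
    have "0 \<le> (372 / 10000 - d) * (8 / 100 - d)" using d(2) by (intro mult_nonneg_nonneg) auto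
    moreover have "(372 / 10000 - d) * (8 / 100 - d) = 2976 / 1000000 - 1172 / 10000 * d + d\<^sup>2"
      by (simp add: power2_eq_square field_simps)
    ultimately have "0 \<le> 2976 / 1000000 - 1172 / 10000 * d + d\<^sup>2" by simp
    then show "83 / 100 \<le> 3051 / 2000 + (- 684 / 25) * d + 304 * d\<^sup>2 + (- 1900) * d ^ 3"
      using pw(3)[OF d(2)] d(2) by simp
    have "0 \<le> (d - 3 / 100)\<^sup>2" by simp
    then have "6 / 100 * d - 9 / 10000 \<le> d\<^sup>2" by (simp add: power2_eq_square algebra_simps)
    then show "87 / 100 \<le> 3051 / 2000 + (- 684 / 25) * d + 304 * d\<^sup>2 + (- 1900) * d ^ 3" if "d \<le> 3 / 100"
      using pw(3)[OF that] that by simp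
  qed
  show "1 - exp (- (4 * pi) * d) - 2 * gain A B d \<ge> 83 / 100 * d"
    using g torsion_loss_ge_linear(1)[OF d(1)] d mult_left_mono[OF q(1) d(1)] by (auto simp: mult.commute)
  show "1 - exp (- (4 * pi) * d) - 2 * gain A B d \<ge> 87 / 100 * d" if "d \<le> 3 / 100"
    using g torsion_loss_ge_linear(1)[OF d(1)] d mult_left_mono[OF q(2)[OF that] d(1)] by (auto simp: mult.commute)
qed

text \<open>Here A = 1 + sqrt 2, and 506/10000 is again the limit set by minimality of 1. The second
  bound is absolute: twice 665/10000 just covers 24 further short vectors and the tail.\<close>

lemma unit_loss_silver:
  assumes A: "A\<^sup>2 - 2 * A = 1" "A > 2" and B: "B \<ge> 0" "B\<^sup>2 = A\<^sup>2 - 4" and d: "0 \<le> d" "d \<le> 506 / 10000"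
  shows "d \<le> 3 / 100 \<Longrightarrow> 1 - exp (- (4 * pi) * d) - 2 * gain A B d \<ge> 22 / 10 * d"
    and "d \<ge> 3 / 100 \<Longrightarrow> 1 - exp (- (4 * pi) * d) - 2 * gain A B d \<ge> 665 / 10000"
proof -
  have Alo: "A \<ge> 24142 / 10000"
  proof (rule ccontr)
    assume "\<not> ?thesis"
    then have "A * (A - 2) < 24142 / 10000 * (4142 / 10000)"
      using A by (intro mult_strict_mono) auto
    then show False using A(1) by (simp add: power2_eq_square algebra_simps)
  qed
  have Ahi: "A \<le> 241422 / 100000"
  proof (rule ccontr)
    assume "\<not> ?thesis"
    then have "241422 / 100000 * (41422 / 100000) < A * (A - 2)"
      by (intro mult_strict_mono) auto
    then show False using A(1) by (simp add: power2_eq_square algebra_simps)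
  qed
  have B2: "B\<^sup>2 \<le> 182844 / 100000" using B(2) A(1) Ahi by simp
  have b: "4 * pi\<^sup>2 * B\<^sup>2 \<le> 7219 / 100"
    using mult_mono[OF pi_square_le B2] by (simp add: mult.commute)
  have a: "1896 / 125 \<le> 2 * pi * A"
    using mult_mono[of "2 * (31415 / 10000)" "2 * pi" "24142 / 10000" A] pi_bounds Alo by (simp add: mult.commute)
  have e: "exp (- (2 * pi) * (A - 2)) \<le> 741 / 10000"
  proof -
    have "26024 / 10000 \<le> 6283 / 1000 * (A - 2)" using Alo by simp
    also have "\<dots> \<le> 2 * pi * (A - 2)" using Alo by (intro two_pi_mult_le) simp
    finally have "exp (- (2 * pi) * (A - 2)) \<le> exp (- (26024 / 10000))" by simp
    also have "\<dots> \<le> 741 / 10000"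
      by (rule exp_minus_bounds(2))
    finally show ?thesis .
  qed
  have pw: "d\<^sup>2 \<le> u * d" "d ^ 3 \<ge> 0" "d ^ 3 \<le> u * d\<^sup>2" "d ^ 4 \<le> u * d ^ 3" if "d \<le> u" for u
    using d that by (auto simp: eval_nat_numeral intro!: mult_right_mono)
  have "7219 / 100 * (2 * d + d\<^sup>2) \<le> 8" using pw(1)[OF d(2)] d(2) by simp
  from gain_le_polynomial[OF d less_imp_le[OF A(2)] B(1) _ a b this e]
  have "gain A B d \<le> max 0 (741 / 10000 * ((1 - 1896 / 125 * d + (1896 / 125 * d)\<^sup>2 / 2 - (1896 / 125 * d) ^ 3 / 6 + (1896 / 125 * d) ^ 4 / 24) *
    (1 + 7219 / 100 * (d * (1 + d / 2)) + (7219 / 100)\<^sup>2 * d\<^sup>2 * (1 + 102 / 100 * d) / 6 +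
      (7219 / 100) ^ 3 * d ^ 3 * (1 + 154 / 100 * d) / 90 + (7219 / 100) ^ 4 * d ^ 4 * (111 / 100) / 2250) - 1))"
    by simp
  from combine_gain[OF this loss_polynomial_silver[OF d(1)] torsion_loss_ge[OF d(1)]] d(2)
  have g: "gain A B d \<le> 0 \<or> d * (823 / 200 + (- 3391 / 50) * d + 468 * d\<^sup>2 + (- 2400) * d ^ 3) \<le>
    1 - exp (- (4 * pi) * d) - 2 * gain A B d"
    by simp
  have q: "34 / 10 - 37 * d \<le> 823 / 200 + (- 3391 / 50) * d + 468 * d\<^sup>2 + (- 2400) * d ^ 3"
  proof -
    have "0 \<le> (d - 44 / 1000)\<^sup>2" by simp
    then have "88 / 1000 * d - 1936 / 1000000 \<le> d\<^sup>2" by (simp add: power2_eq_square algebra_simps)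
    then show ?thesis using pw(3)[OF d(2)] d by simp
  qed
  show "1 - exp (- (4 * pi) * d) - 2 * gain A B d \<ge> 22 / 10 * d" if "d \<le> 3 / 100"
  proof -
    have "22 / 10 \<le> 823 / 200 + (- 3391 / 50) * d + 468 * d\<^sup>2 + (- 2400) * d ^ 3"
      using that q by linarith
    from mult_left_mono[OF this d(1)]
    have "22 / 10 * d \<le> d * (823 / 200 + (- 3391 / 50) * d + 468 * d\<^sup>2 + (- 2400) * d ^ 3)"
      by (simp only: mult.commute)
    then show ?thesis using g torsion_loss_ge_linear(1)[OF d] d by auto
  qed
  show "1 - exp (- (4 * pi) * d) - 2 * gain A B d \<ge> 665 / 10000" if "d \<ge> 3 / 100"
  proof -
    have "665 / 10000 \<le> d * (34 / 10 - 37 * d)"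
    proof -
      have "d * (34 / 10 - 37 * d) = 34 / 10 * d - 37 * d\<^sup>2" by (simp add: power2_eq_square algebra_simps)
      then show ?thesis using chord_square[OF that d(2)] that d(2) by simp
    qed
    also have "\<dots> \<le> d * (823 / 200 + (- 3391 / 50) * d + 468 * d\<^sup>2 + (- 2400) * d ^ 3)"
      using q d(1) by (rule mult_left_mono)
    finally show ?thesis using g torsion_loss_ge_linear(1)[OF d] d that by auto
  qed
qed

lemma exp_linear_le:
  assumes "x \<ge> 0" "6283 / 1000 * x \<ge> c" "exp (- c) \<le> r"
  shows "exp (- (2 * pi) * x) \<le> r"
proof -
  have "c \<le> 2 * pi * x" using two_pi_mult_le[OF assms(1)] assms(2) by linarith
  then have "exp (- (2 * pi) * x) \<le> exp (- c)" by simp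
  then show ?thesis using assms(3) by linarith
qed

lemma gain_le_cosh:
  assumes "0 \<le> d" "A \<ge> 0"
  shows "gain A B d \<le> exp (- (2 * pi) * (A - 2)) *
    (exp (- (2 * pi) * A * d) * (cosh (2 * pi * B * sqrt (2 * d + d\<^sup>2)) - 1))"
proof -
  have "exp (- (2 * pi) * A * d) \<le> 1" using assms by simp
  then show ?thesis unfolding gain_def by (intro mult_left_mono) (simp_all add: right_diff_distrib)
qed

text \<open>Once B^2 is moved into the exponent, the gain is bounded by d times a single
  exponential. With A^2 replaced by its chord the exponent has a bound linear and decreasing in A,
  so A = 2.56 is the worst case. There B^2 = 2.5536, which explains the tangent point
  256/100.\<close>

lemma unit_loss_large:
  assumes A: "256 / 100 \<le> A" "A \<le> 4" and B: "B \<ge> 0" "B\<^sup>2 = A\<^sup>2 - 4" and d: "0 \<le> d" "d \<le> 3 / 100"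
  shows "1 - exp (- (4 * pi) * d) - 2 * gain A B d \<ge> 22 / 10 * d"
proof -
  define X where "X = 2 * pi * B * sqrt (2 * d + d\<^sup>2)"
  have chord: "A\<^sup>2 \<le> 656 / 100 * A - 1024 / 100"
    using chord_square[OF A] by simp
  have X2: "X\<^sup>2 = 4 * pi\<^sup>2 * B\<^sup>2 * (2 * d + d\<^sup>2)"
    using d by (simp add: X_def power_mult_distrib)
  have dd: "2 * d + d\<^sup>2 \<le> 203 / 100 * d"
    using mult_right_mono[OF d(2) d(1)] by (simp add: power2_eq_square)
  have "X\<^sup>2 \<le> (4 * (986966 / 100000) * B\<^sup>2) * (203 / 100 * d)"
    unfolding X2 using pi_square_le dd d by (intro mult_mono) auto
  also have "\<dots> \<le> 80142 / 1000 * (B\<^sup>2 * d)" using d by simp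
  finally have Xle: "X\<^sup>2 \<le> 80142 / 1000 * (B\<^sup>2 * d)" .
  define t where "t = - (2 * pi) * (A - 2) + - (2 * pi) * A * d + X\<^sup>2 / 12"
  define u where "u = B\<^sup>2 / (256 / 100) - 1 + t"
  have "gain A B d \<le> exp (- (2 * pi) * (A - 2)) * (exp (- (2 * pi) * A * d) * (cosh X - 1))"
    unfolding X_def by (rule gain_le_cosh) (use d A in auto)
  also have "\<dots> \<le> exp (- (2 * pi) * (A - 2)) * (exp (- (2 * pi) * A * d) * (X\<^sup>2 / 2 * exp (X\<^sup>2 / 12)))"
    by (intro mult_left_mono cosh_minus_1_le_exp) auto
  also have "\<dots> = X\<^sup>2 / 2 * exp t" unfolding t_def exp_add by (simp only: mult_ac)
  also have "\<dots> \<le> (40071 / 1000 * (B\<^sup>2 * d)) * exp t" using Xle by (intro mult_right_mono) auto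
  also have "\<dots> = (40071 / 1000 * d) * (B\<^sup>2 * exp t)" by simp
  also have "\<dots> \<le> (40071 / 1000 * d) * ((256 / 100 * exp (B\<^sup>2 / (256 / 100) - 1)) * exp t)"
    using le_exp_tangent[of "256 / 100" "B\<^sup>2"] d by (intro mult_left_mono mult_right_mono) auto
  also have "\<dots> = 40071 / 1000 * (256 / 100) * d * exp u" by (simp add: u_def exp_add)
  also have "\<dots> \<le> 40071 / 1000 * (256 / 100) * d * (31 / 1000)"
  proof (intro mult_left_mono)
    have "2 * pi * A * d \<ge> 6283 / 1000 * (A * d)" using two_pi_mult_le[of "A * d"] A d by (simp add: mult_ac)
    moreover have "2 * pi * (A - 2) \<ge> 6283 / 1000 * (A - 2)" using two_pi_mult_le[of "A - 2"] A by simp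
    ultimately have t: "t \<le> - (6283 / 1000) * (A - 2) + d * (66785 / 10000 * B\<^sup>2 - 6283 / 1000 * A)"
    proof -
      have "t = - (2 * pi * (A - 2)) - 2 * pi * A * d + X\<^sup>2 / 12" by (simp add: t_def)
      moreover have "d * (66785 / 10000 * B\<^sup>2 - 6283 / 1000 * A) = 66785 / 10000 * (B\<^sup>2 * d) - 6283 / 1000 * (A * d)"
        by (simp add: algebra_simps)
      ultimately show ?thesis
        using Xle \<open>2 * pi * A * d \<ge> 6283 / 1000 * (A * d)\<close> \<open>2 * pi * (A - 2) \<ge> 6283 / 1000 * (A - 2)\<close>
        by linarith
    qed
    \<comment> \<open>The left side is linear in d, so an end point of the interval from 0 to 3/100
      bounds it.\<close>
    have "d * (66785 / 10000 * B\<^sup>2 - 6283 / 1000 * A) \<le> max 0 (3 / 100 * (66785 / 10000 * B\<^sup>2 - 6283 / 1000 * A))"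
    proof (cases "66785 / 10000 * B\<^sup>2 - 6283 / 1000 * A \<ge> 0")
      case True
      then show ?thesis using mult_right_mono[OF d(2) True] by simp
    next
      case False
      then have "d * (66785 / 10000 * B\<^sup>2 - 6283 / 1000 * A) \<le> 0" using d(1) by (intro mult_nonneg_nonpos) auto
      then show ?thesis by simp
    qed
    with t have "t \<le> - (6283 / 1000) * (A - 2) + max 0 (3 / 100 * (66785 / 10000 * B\<^sup>2 - 6283 / 1000 * A))"
      by linarith
    moreover have "3 / 100 * (66785 / 10000 * B\<^sup>2 - 6283 / 1000 * A) = 200355 / 1000000 * B\<^sup>2 - 18849 / 100000 * A"
      by (simp add: field_simps)
    moreover have "- (6283 / 1000) * (A - 2) = - (6283 / 1000) * A + 12566 / 1000" by (simp add: field_simps)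
    ultimately have "t \<le> - (6283 / 1000) * A + 12566 / 1000 + max 0 (200355 / 1000000 * B\<^sup>2 - 18849 / 100000 * A)"
      by (simp only:)
    then consider "t \<le> - (6283 / 1000) * A + 12566 / 1000"
      | "t \<le> - (6283 / 1000) * A + 12566 / 1000 + (200355 / 1000000 * B\<^sup>2 - 18849 / 100000 * A)"
      by (cases "0 \<le> 200355 / 1000000 * B\<^sup>2 - 18849 / 100000 * A") auto
    then have "25 / 64 * B\<^sup>2 - 1 + t \<le> - (349 / 100)"
      using chord A B(2) by cases linarith+
    then have "u \<le> - (349 / 100)" by (simp add: u_def)
    then have "exp u \<le> exp (- (349 / 100))" by simp
    also have "\<dots> \<le> 31 / 1000" by (rule exp_minus_bounds(3))
    finally show "exp u \<le> 31 / 1000" .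
  qed (use d in auto)
  finally have "gain A B d \<le> 32 / 10 * d" using d by simp
  then show ?thesis using torsion_loss_ge_linear(2)[of d] d by simp
qed

text \<open>The argument of cosh at d is compared with that at 3/100, where 2 d + d^2 = 609/10000,
  through the monotone quotient (cosh x - 1) / x^2. Since 2 d + d^2 \<le> 2.03 d and 2.03 / 0.0609 =
  100/3, the result is linear in d.\<close>

lemma gain_le_short:
  assumes d: "0 \<le> d" "d \<le> 3 / 100" and A: "A \<ge> 0" and B: "B \<ge> 0"
  shows "gain A B d \<le> d * (exp (- (2 * pi) * (A - 2)) * (100 / 3 * (cosh (2 * pi * B * sqrt (609 / 10000)) - 1)))"
proof -
  define X where "X = 2 * pi * B * sqrt (2 * d + d\<^sup>2)"
  define Y where "Y = 2 * pi * B * sqrt (609 / 10000)"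
  have dd: "2 * d + d\<^sup>2 \<le> 203 / 100 * d"
    using mult_right_mono[OF d(2) d(1)] by (simp add: power2_eq_square)
  have "sqrt (2 * d + d\<^sup>2) \<le> sqrt (609 / 10000)" using dd d by (intro real_sqrt_le_mono) simp
  then have XY: "0 \<le> X" "X \<le> Y" unfolding X_def Y_def using B d by (auto intro!: mult_left_mono)
  have X2: "X\<^sup>2 = 4 * pi\<^sup>2 * B\<^sup>2 * (2 * d + d\<^sup>2)" and Y2: "Y\<^sup>2 = 4 * pi\<^sup>2 * B\<^sup>2 * (609 / 10000)"
    using d by (simp_all add: X_def Y_def power_mult_distrib)
  have c: "cosh X - 1 \<le> d * (100 / 3 * (cosh Y - 1))"
  proof (cases "B = 0")
    case True
    then show ?thesis by (simp add: X_def Y_def)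
  next
    case False
    define b where "b = 4 * pi\<^sup>2 * B\<^sup>2"
    have b: "b > 0" using False by (simp add: b_def)
    have "(cosh X - 1) * (609 / 10000) * b \<le> (cosh Y - 1) * (2 * d + d\<^sup>2) * b"
      using cosh_minus_1_quotient_mono[OF XY] unfolding X2 Y2 b_def[symmetric] by (simp add: mult_ac)
    then have "(cosh X - 1) * (609 / 10000) \<le> (cosh Y - 1) * (2 * d + d\<^sup>2)"
      using b by (rule mult_right_le_imp_le)
    also have "\<dots> \<le> (cosh Y - 1) * (203 / 100 * d)"
      using dd cosh_real_ge_1[of Y] by (intro mult_left_mono) auto
    finally have "(cosh X - 1) * (609 / 10000) \<le> (cosh Y - 1) * (203 / 100 * d)" .
    moreover have "(cosh Y - 1) * (203 / 100 * d) = d * (100 / 3 * (cosh Y - 1)) * (609 / 10000)" by simp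
    ultimately have "(cosh X - 1) * (609 / 10000) \<le> d * (100 / 3 * (cosh Y - 1)) * (609 / 10000)" by (simp only:)
    then show ?thesis by (rule mult_right_le_imp_le) simp
  qed
  have "gain A B d \<le> exp (- (2 * pi) * (A - 2)) * (exp (- (2 * pi) * A * d) * (cosh X - 1))"
    unfolding X_def by (rule gain_le_cosh[OF d(1) A])
  also have "\<dots> \<le> exp (- (2 * pi) * (A - 2)) * (1 * (cosh X - 1))"
    using cosh_real_ge_1[of X] d A by (intro mult_left_mono mult_right_mono) auto
  also have "\<dots> \<le> exp (- (2 * pi) * (A - 2)) * (d * (100 / 3 * (cosh Y - 1)))"
    using c by (intro mult_left_mono) auto
  finally show ?thesis by (simp add: Y_def mult_ac)
qed

text \<open>200355/1000000 bounds 4 pi^2 * 0.0609 / 12. With B^2 traded for an exponential at the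
  tangent point \<open>l\<close>, only the exponent remains to be checked, which a chord makes
  linear in A.\<close>

lemma gain_le_gauss:
  assumes d: "0 \<le> d" "d \<le> 3 / 100" and A: "A \<ge> 2" and B: "B \<ge> 0" and l: "l > 0"
    and u: "(200355 / 1000000 + 1 / l) * B\<^sup>2 - 1 - 6283 / 1000 * (A - 2) \<le> - c"
  shows "gain A B d \<le> (40071 / 1000 * l * exp (- c)) * d"
proof -
  define Y where "Y = 2 * pi * B * sqrt (609 / 10000)"
  have "Y\<^sup>2 = 4 * pi\<^sup>2 * B\<^sup>2 * (609 / 10000)" by (simp add: Y_def power_mult_distrib)
  also have "\<dots> \<le> 4 * (986966 / 100000) * B\<^sup>2 * (609 / 10000)"
    using pi_square_le by (intro mult_right_mono mult_left_mono) auto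
  finally have Y2: "Y\<^sup>2 / 2 \<le> 3 / 100 * (40071 / 1000 * B\<^sup>2)" "Y\<^sup>2 / 12 \<le> 200355 / 1000000 * B\<^sup>2"
    using zero_le_power2[of B] by linarith+
  have "exp (- (2 * pi) * (A - 2)) * (100 / 3 * (cosh Y - 1)) \<le>
      exp (- (6283 / 1000 * (A - 2))) * (100 / 3 * (Y\<^sup>2 / 2 * exp (Y\<^sup>2 / 12)))"
    using two_pi_mult_le[of "A - 2"] A cosh_minus_1_le_exp[of Y] cosh_real_ge_1[of Y]
    by (intro mult_mono) auto
  also have "\<dots> \<le> exp (- (6283 / 1000 * (A - 2))) * (100 / 3 * ((3 / 100 * (40071 / 1000 * B\<^sup>2)) * exp (200355 / 1000000 * B\<^sup>2)))"
    using Y2 by (intro mult_mono) auto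
  also have "\<dots> = 40071 / 1000 * (exp (- (6283 / 1000 * (A - 2))) * exp (200355 / 1000000 * B\<^sup>2)) * B\<^sup>2"
    by simp
  also have "\<dots> \<le> 40071 / 1000 * (exp (- (6283 / 1000 * (A - 2))) * exp (200355 / 1000000 * B\<^sup>2)) * (l * exp (B\<^sup>2 / l - 1))"
    by (intro mult_left_mono le_exp_tangent l) auto
  also have "\<dots> = 40071 / 1000 * l * exp ((200355 / 1000000 + 1 / l) * B\<^sup>2 - 1 - 6283 / 1000 * (A - 2))"
    using l by (simp add: algebra_simps flip: exp_add)
  also have "\<dots> \<le> 40071 / 1000 * l * exp (- c)" using u l by simp
  finally have "exp (- (2 * pi) * (A - 2)) * (100 / 3 * (cosh Y - 1)) \<le> 40071 / 1000 * l * exp (- c)" .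
  from mult_left_mono[OF this d(1)] gain_le_short[OF d _ B, of A] A
  show ?thesis unfolding Y_def by (simp add: mult_ac)
qed

text \<open>For norm N \<ge> 2 one has B^2 = A^2 - 4 N \<le> A^2 - 8, which forces A \<ge> sqrt 8
  and keeps B small where A is small.\<close>

lemma gain_nonunit:
  assumes d: "0 \<le> d" "d \<le> 3 / 100" and A: "A \<ge> 0" "A\<^sup>2 \<ge> 8" "A \<le> 4" and B: "B \<ge> 0" "B\<^sup>2 \<le> A\<^sup>2 - 8"
  shows "gain A B d \<le> 122 / 1000 * d"
proof -
  have A2: "A \<ge> 2828 / 1000"
  proof (rule ccontr)
    assume "\<not> ?thesis"
    then have "A\<^sup>2 < (2828 / 1000)\<^sup>2" using A(1) by (intro power_strict_mono) auto
    then show False using A(2) by (simp add: power2_eq_square)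
  qed
  have chord: "B\<^sup>2 \<le> 6828 / 1000 * A - 19312 / 1000"
    using chord_square[OF A2 A(3)] B(2) by simp
  have "gain A B d \<le> (40071 / 1000 * (3 / 2) * exp (- (6204 / 1000))) * d"
  proof (rule gain_le_gauss[OF d _ B(1)])
    show "(200355 / 1000000 + 1 / (3 / 2)) * B\<^sup>2 - 1 - 6283 / 1000 * (A - 2) \<le> - (6204 / 1000)"
    proof -
      have "520213 / 600000 * B\<^sup>2 - 1 - 6283 / 1000 * (A - 2) \<le> - (6204 / 1000)" using A2 chord unfolding ring_distribs by linarith
      then show ?thesis by simp
    qed
  qed (use A2 in auto)
  also have "\<dots> \<le> (40071 / 1000 * (3 / 2) * (20216 / 10000000)) * d"
    using d(1) by (intro mult_right_mono mult_left_mono exp_minus_bounds(4)) simp_all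
  also have "\<dots> \<le> 122 / 1000 * d" using d(1) by simp
  finally show ?thesis .
qed

text \<open>A unit beyond f, its inverse and their torsion multiples has trace at least A^2 - 2 for
  the minimal trace A; 33/10 and 382/100 are this value, rounded down, for (1 + sqrt 13) / 2 and 1 +
  sqrt 2.\<close>

lemma gain_unit:
  assumes d: "0 \<le> d" "d \<le> 3 / 100" and A: "33 / 10 \<le> A" "A \<le> 4" and B: "B \<ge> 0" "B\<^sup>2 \<le> A\<^sup>2 - 4"
  shows "gain A B d \<le> 312 / 1000 * d" and "382 / 100 \<le> A \<Longrightarrow> gain A B d \<le> 122 / 1000 * d"
proof -
  have chord: "B\<^sup>2 \<le> 73 / 10 * A - 172 / 10"
    using chord_square[OF A] B(2) by simp
  have "gain A B d \<le> (40071 / 1000 * 7 * exp (- (6803 / 1000))) * d"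
  proof (rule gain_le_gauss[OF d _ B(1)])
    show "(200355 / 1000000 + 1 / 7) * B\<^sup>2 - 1 - 6283 / 1000 * (A - 2) \<le> - (6803 / 1000)"
    proof -
      have "480497 / 1400000 * B\<^sup>2 - 1 - 6283 / 1000 * (A - 2) \<le> - (6803 / 1000)" using A chord unfolding ring_distribs by linarith
      then show ?thesis by simp
    qed
  qed (use A in auto)
  also have "\<dots> \<le> (40071 / 1000 * 7 * (1111 / 1000000)) * d"
    using d(1) by (intro mult_right_mono mult_left_mono exp_minus_bounds(5)) simp_all
  also have "\<dots> \<le> 312 / 1000 * d" using d(1) by simp
  finally show "gain A B d \<le> 312 / 1000 * d" .
  assume A': "382 / 100 \<le> A"
  have "gain A B d \<le> (40071 / 1000 * 7 * exp (- 8)) * d"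
  proof (rule gain_le_gauss[OF d _ B(1)])
    show "(200355 / 1000000 + 1 / 7) * B\<^sup>2 - 1 - 6283 / 1000 * (A - 2) \<le> - 8"
    proof -
      have "480497 / 1400000 * B\<^sup>2 - 1 - 6283 / 1000 * (A - 2) \<le> - 8" using A' chord unfolding ring_distribs by linarith
      then show ?thesis by simp
    qed
  qed (use A in auto)
  also have "\<dots> \<le> (40071 / 1000 * 7 * (4 / 10000)) * d"
    using d(1) by (intro mult_right_mono mult_left_mono exp_minus_bounds(6)) simp_all
  also have "\<dots> \<le> 122 / 1000 * d" using d(1) by simp
  finally show "gain A B d \<le> 122 / 1000 * d" .
qed

text \<open>For A \<ge> 4, sqrt ((A^2 - 4) * 0.0609) \<le> 0.285 (A - 1), so cosh costs a share
  0.285 of the decay rate 2 pi. What remains, 2 pi * 0.715, still exceeds the 4 required by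
  \<open>tail_sum\<close>.\<close>

lemma gain_tail:
  assumes d: "0 \<le> d" "d \<le> 3 / 100" and A: "A \<ge> 4" and B: "B \<ge> 0" "B\<^sup>2 \<le> A\<^sup>2 - 4"
  shows "gain A B d \<le> d * (50 / 3 * exp (2 * pi * (1715 / 1000)) * exp (- (2 * pi * (715 / 1000)) * A))"
proof -
  define Y where "Y = 2 * pi * B * sqrt (609 / 10000)"
  have "(B * sqrt (609 / 10000))\<^sup>2 \<le> (A\<^sup>2 - 4) * (609 / 10000)"
    using B(2) by (simp add: power_mult_distrib mult_right_mono)
  also have "\<dots> \<le> (285 / 1000 * (A - 1))\<^sup>2"
  proof -
    have "(285 / 1000 * (A - 1))\<^sup>2 - (A\<^sup>2 - 4) * (609 / 10000) = 203 / 10000 * (A - 4)\<^sup>2 + 25 / 1000000 * (A - 1)\<^sup>2"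
      by (simp add: power2_eq_square field_simps)
    moreover have "0 \<le> 203 / 10000 * (A - 4)\<^sup>2 + 25 / 1000000 * (A - 1)\<^sup>2" by simp
    ultimately show ?thesis by linarith
  qed
  finally have "B * sqrt (609 / 10000) \<le> 285 / 1000 * (A - 1)"
    by (rule power2_le_imp_le) (use A in simp)
  then have Y: "Y \<le> 2 * pi * (285 / 1000 * (A - 1))"
    unfolding Y_def mult.assoc by (intro mult_left_mono) auto
  have "0 \<le> Y" using B(1) by (simp add: Y_def)
  then have "exp (- Y) \<le> 1" by simp
  then have "cosh Y - 1 \<le> exp Y / 2"
    unfolding cosh_field_def by argo
  then have "exp (- (2 * pi) * (A - 2)) * (100 / 3 * (cosh Y - 1)) \<le>
      exp (- (2 * pi) * (A - 2)) * (100 / 3 * (exp (2 * pi * (285 / 1000 * (A - 1))) / 2))"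
    using Y by (intro mult_left_mono) (auto intro: order_trans)
  also have "\<dots> = 50 / 3 * (exp (- (2 * pi) * (A - 2)) * exp (2 * pi * (285 / 1000 * (A - 1))))" by simp
  also have "exp (- (2 * pi) * (A - 2)) * exp (2 * pi * (285 / 1000 * (A - 1))) =
      exp (2 * pi * (1715 / 1000)) * exp (- (2 * pi * (715 / 1000)) * A)"
    unfolding exp_add[symmetric] by (rule arg_cong[of _ _ exp]) (simp add: field_simps)
  finally have "exp (- (2 * pi) * (A - 2)) * (100 / 3 * (cosh Y - 1)) \<le>
    50 / 3 * exp (2 * pi * (1715 / 1000)) * exp (- (2 * pi * (715 / 1000)) * A)" by (simp only: mult.assoc)
  from mult_left_mono[OF this d(1)] gain_le_short[OF d _ B(1), of A] A
  show ?thesis unfolding Y_def by linarith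
qed

lemma tail_constants:
  shows "50 / 3 * exp (2 * pi * (1715 / 1000)) * (exp (- 4 * (2 * pi * (715 / 1000))) *
      (81 + 256 * exp (- (2 * pi * (715 / 1000)) / 2) + 1 / 1000)) \<le> 136 / 100"
    and "exp (8 * pi / 2) * (exp (- 4 * (2 * pi)) * (81 + 256 * exp (- (2 * pi) / 2) + 1 / 1000)) \<le> 33 / 100000"
proof -
  have "exp (2 * pi * (1715 / 1000)) * exp (- 4 * (2 * pi * (715 / 1000))) = exp (- (2 * pi) * (1145 / 1000))"
    unfolding exp_add[symmetric] by (rule arg_cong[of _ _ exp]) (simp add: field_simps)
  also have "\<dots> \<le> 752 / 1000000"
    by (rule exp_linear_le[OF _ _ exp_minus_bounds(7)]) simp_all
  finally have 1: "exp (2 * pi * (1715 / 1000)) * exp (- 4 * (2 * pi * (715 / 1000))) \<le> 752 / 1000000" .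
  have "- (2 * pi * (715 / 1000)) / 2 = - (2 * pi) * (3575 / 10000)" by simp
  also have "exp \<dots> \<le> 106 / 1000"
    by (rule exp_linear_le[OF _ _ exp_minus_bounds(8)]) simp_all
  finally have 2: "exp (- (2 * pi * (715 / 1000)) / 2) \<le> 106 / 1000" .
  have "50 / 3 * exp (2 * pi * (1715 / 1000)) * (exp (- 4 * (2 * pi * (715 / 1000))) *
      (81 + 256 * exp (- (2 * pi * (715 / 1000)) / 2) + 1 / 1000)) =
    50 / 3 * (exp (2 * pi * (1715 / 1000)) * exp (- 4 * (2 * pi * (715 / 1000)))) *
      (81 + 256 * exp (- (2 * pi * (715 / 1000)) / 2) + 1 / 1000)" by simp
  also have "\<dots> \<le> 50 / 3 * (752 / 1000000) * (81 + 256 * (106 / 1000) + 1 / 1000)"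
    using 1 2 by (intro mult_mono add_mono) auto
  also have "\<dots> \<le> 136 / 100" by simp
  finally show "50 / 3 * exp (2 * pi * (1715 / 1000)) * (exp (- 4 * (2 * pi * (715 / 1000))) *
      (81 + 256 * exp (- (2 * pi * (715 / 1000)) / 2) + 1 / 1000)) \<le> 136 / 100" .
  have "exp (8 * pi / 2) * exp (- 4 * (2 * pi)) = exp (- (2 * pi) * 2)"
    unfolding exp_add[symmetric] by (rule arg_cong[of _ _ exp]) simp
  also have "\<dots> \<le> 35 / 10000000"
    by (rule exp_linear_le[OF _ _ exp_minus_bounds(9)]) simp_all
  finally have 3: "exp (8 * pi / 2) * exp (- 4 * (2 * pi)) \<le> 35 / 10000000" .
  have "- (2 * pi) / 2 = - (2 * pi) * (1 / 2)" by simp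
  also have "exp \<dots> \<le> 44 / 1000"
    by (rule exp_linear_le[OF _ _ exp_minus_bounds(10)]) simp_all
  finally have 4: "exp (- (2 * pi) / 2) \<le> 44 / 1000" .
  have "exp (8 * pi / 2) * (exp (- 4 * (2 * pi)) * (81 + 256 * exp (- (2 * pi) / 2) + 1 / 1000)) =
     (exp (8 * pi / 2) * exp (- 4 * (2 * pi))) * (81 + 256 * exp (- (2 * pi) / 2) + 1 / 1000)" by simp
  also have "\<dots> \<le> 35 / 10000000 * (81 + 256 * (44 / 1000) + 1 / 1000)"
    using 3 4 by (intro mult_mono add_mono) auto
  also have "\<dots> \<le> 33 / 100000" by simp
  finally show "exp (8 * pi / 2) * (exp (- 4 * (2 * pi)) * (81 + 256 * exp (- (2 * pi) / 2) + 1 / 1000)) \<le> 33 / 100000" .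
qed

lemma exp_constants:
  shows "exp (- (2 * pi) * (1 / 2)) \<le> 44 / 1000" "exp (- (2 * pi) * (8284 / 10000)) \<le> 55 / 10000"
    "exp (- (2 * pi) * (7 / 10)) \<le> 1231 / 100000"
  by (rule exp_linear_le[OF _ _ exp_minus_bounds(10)] exp_linear_le[OF _ _ exp_minus_bounds(11)]
      exp_linear_le[OF _ _ exp_minus_bounds(12)]; simp)+

text \<open>The three terms are the weights of 1, f and \<tau> f. The assumption
  \<open>short\<close>, that 1 is a shortest vector, settles d \<ge> 65/1000. Below that, A = 2.56
  is the worst case, and convexity of exp in d leaves the end points 3/100 and 65/1000 to be
  checked.\<close>

lemma two_units_bound:
  assumes A: "256 / 100 \<le> A" and B: "B \<ge> 0" "B\<^sup>2 = A\<^sup>2 - 4" and d: "3 / 100 \<le> d"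
    and s: "s \<ge> 0" "s\<^sup>2 = 2 * d + d\<^sup>2" and short: "2 * (1 + d) \<le> A * (1 + d) - B * s"
  shows "exp (- (4 * pi) * d) + exp (- (2 * pi) * (A * (1 + d) - B * s - 2)) +
    exp (- (2 * pi) * (A * (1 + d) + B * s - 2)) \<le> 9225 / 10000"
proof -
  define u where "u = A * (1 + d) + B * s - 2"
  define g where "g = A * (1 + d) - B * s - 2"
  have B0: "B \<ge> 15979 / 10000"
  proof (rule power2_le_imp_le[OF _ B(1)])
    have "(256 / 100)\<^sup>2 \<le> A\<^sup>2" using A by (intro power_mono) auto
    then show "(15979 / 10000)\<^sup>2 \<le> B\<^sup>2" unfolding B(2) by (simp add: power2_eq_square)
  qed
  have s0: "s \<ge> 2467 / 10000"
  proof (rule power2_le_imp_le[OF _ s(1)])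
    have "(3 / 100)\<^sup>2 \<le> d\<^sup>2" using d by (intro power_mono) auto
    then show "(2467 / 10000)\<^sup>2 \<le> s\<^sup>2" unfolding s(2) using d by (simp add: power2_eq_square)
  qed
  have "256 / 100 * (103 / 100) \<le> A * (1 + d)" using A d by (intro mult_mono) auto
  moreover have "15979 / 10000 * (2467 / 10000) \<le> B * s" using B0 s0 by (intro mult_mono) auto
  ultimately have u: "u \<ge> 103 / 100" unfolding u_def by simp
  have plus: "exp (- (2 * pi) * u) \<le> 16 / 10000"
  proof (rule exp_linear_le)
    show "0 \<le> u" "647 / 100 \<le> 6283 / 1000 * u" using u by auto
    show "exp (- (647 / 100)) \<le> 16 / (10000::real)"
      by (rule exp_minus_bounds(13))
  qed
  have "exp (- (4 * pi) * d) + exp (- (2 * pi) * g) \<le> 916 / 1000"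
  proof (cases "d \<ge> 65 / 1000")
    case True
    have c: "exp (- (8167 / 10000)) \<le> 442 / (1000::real)"
      by (rule exp_minus_bounds(16))
    have "exp (- (2 * pi) * (2 * d)) \<le> 442 / 1000"
      by (rule exp_linear_le[OF _ _ c]) (use True in auto)
    moreover have "exp (- (2 * pi) * g) \<le> 442 / 1000"
      by (rule exp_linear_le[OF _ _ c]) (use True short in \<open>auto simp: g_def\<close>)
    moreover have "exp (- (4 * pi) * d) = exp (- (2 * pi) * (2 * d))" by simp
    ultimately show ?thesis by linarith
  next
    case False
    then have d': "d \<le> 65 / 1000" by simp
    \<comment> \<open>A linear bound for sqrt (A^2 - 4) with nearly the slope of the tangent at
      2.56; with it, g is smallest at A = 2.56.\<close>
    have Bhi: "B \<le> 1598 / 1000 + 1603 / 1000 * (A - 256 / 100)"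
    proof (rule power2_le_imp_le)
      have "(1598 / 1000 + 1603 / 1000 * (A - 256 / 100))\<^sup>2 - (A\<^sup>2 - 4) =
          (4 / 1000000) + 3188 / 1000000 * (A - 256 / 100) + 1569609 / 1000000 * (A - 256 / 100)\<^sup>2"
        by (simp add: power2_eq_square field_simps)
      moreover have "0 \<le> (4 / 1000000) + 3188 / 1000000 * (A - 256 / 100) + 1569609 / 1000000 * (A - 256 / 100)\<^sup>2"
        using A by (intro add_nonneg_nonneg mult_nonneg_nonneg) auto
      ultimately have "0 \<le> (1598 / 1000 + 1603 / 1000 * (A - 256 / 100))\<^sup>2 - (A\<^sup>2 - 4)" by (simp only:)
      then show "B\<^sup>2 \<le> (1598 / 1000 + 1603 / 1000 * (A - 256 / 100))\<^sup>2"
        unfolding B(2) by (simp only: diff_ge_0_iff_ge)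
    qed (use A in simp)
    have dsq: "d\<^sup>2 \<le> 95 / 1000 * d - 195 / 100000" using chord_square[OF d d'] by simp
    have "6 / 10 * s \<le> s\<^sup>2 + 9 / 100" using zero_le_power2[of "s - 3 / 10"] by (simp add: power2_eq_square algebra_simps)
    then have s1: "s \<le> 14675 / 100000 + 3491667 / 1000000 * d" unfolding s(2) using dsq d by simp
    have "B * s \<le> (1598 / 1000 + 1603 / 1000 * (A - 256 / 100)) * s" using Bhi s by (intro mult_right_mono)
    moreover have "0 \<le> (A - 256 / 100) * (1 + d - 1603 / 1000 * s)"
      using A s1 d d' by (intro mult_nonneg_nonneg) auto
    ultimately have "g \<ge> 256 / 100 * (1 + d) - 1598 / 1000 * s - 2"
      unfolding g_def by (simp add: algebra_simps)
    then have g1: "3254 / 10000 - 30197 / 10000 * d \<le> g" using s1 d unfolding ring_distribs by linarith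
    have "6283 / 1000 * (3254 / 10000 - 30197 / 10000 * d) \<le> 2 * pi * (3254 / 10000 - 30197 / 10000 * d)"
      using d' by (intro two_pi_mult_le) simp
    also have "\<dots> \<le> 2 * pi * g" using g1 by (intro mult_left_mono) auto
    finally have "exp (- (2 * pi) * g) \<le> exp (- (2044 / 1000) + 18973 / 1000 * d)" using d by simp
    also have "\<dots> \<le> (65 / 1000 - d) / (65 / 1000 - 3 / 100) * exp (- (2044 / 1000) + 18973 / 1000 * (3 / 100)) +
        (d - 3 / 100) / (65 / 1000 - 3 / 100) * exp (- (2044 / 1000) + 18973 / 1000 * (65 / 1000))"
      by (rule exp_chord) (use d d' in auto)
    also have "\<dots> \<le> (65 / 1000 - d) / (65 / 1000 - 3 / 100) * (2295 / 10000) +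
        (d - 3 / 100) / (65 / 1000 - 3 / 100) * (445 / 1000)"
    proof (intro add_mono mult_left_mono)
      have "exp (- (2044 / 1000) + 18973 / 1000 * (3 / 100)) \<le> exp (- (1474 / 1000) :: real)" by simp
      also have "\<dots> \<le> 2295 / 10000" by (rule exp_minus_bounds(14))
      finally show "exp (- (2044 / 1000) + 18973 / 1000 * (3 / 100)) \<le> 2295 / (10000::real)" .
      have "exp (- (2044 / 1000) + 18973 / 1000 * (65 / 1000)) \<le> exp (- (81 / 100) :: real)" by simp
      also have "\<dots> \<le> 445 / 1000" by (rule exp_minus_bounds(15))
      finally show "exp (- (2044 / 1000) + 18973 / 1000 * (65 / 1000)) \<le> 445 / (1000::real)" .
    qed (use d d' in auto)
    finally have 1: "exp (- (2 * pi) * g) \<le> (65 / 1000 - d) / (65 / 1000 - 3 / 100) * (2295 / 10000) +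
        (d - 3 / 100) / (65 / 1000 - 3 / 100) * (445 / 1000)" .
    have "12566 / 1000 * d \<le> 4 * pi * d" using pi_bounds d by (intro mult_right_mono) auto
    then have "exp (- (4 * pi) * d) \<le> exp (0 + (- (12566 / 1000)) * d)" by simp
    also have "\<dots> \<le> (65 / 1000 - d) / (65 / 1000 - 3 / 100) * exp (0 + (- (12566 / 1000)) * (3 / 100)) +
        (d - 3 / 100) / (65 / 1000 - 3 / 100) * exp (0 + (- (12566 / 1000)) * (65 / 1000))"
      by (rule exp_chord) (use d d' in auto)
    also have "\<dots> \<le> (65 / 1000 - d) / (65 / 1000 - 3 / 100) * (686 / 1000) +
        (d - 3 / 100) / (65 / 1000 - 3 / 100) * (442 / 1000)"
    proof (intro add_mono mult_left_mono)
      have "exp (0 + (- (12566 / 1000)) * (3 / 100)) \<le> exp (- (3769 / 10000) :: real)" by simp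
      also have "\<dots> \<le> 686 / 1000" by (rule exp_minus_bounds(17))
      finally show "exp (0 + (- (12566 / 1000)) * (3 / 100)) \<le> 686 / (1000::real)" .
      have "exp (0 + (- (12566 / 1000)) * (65 / 1000)) \<le> exp (- (8167 / 10000) :: real)" by simp
      also have "\<dots> \<le> 442 / 1000" by (rule exp_minus_bounds(16))
      finally show "exp (0 + (- (12566 / 1000)) * (65 / 1000)) \<le> 442 / (1000::real)" .
    qed (use d d' in auto)
    finally have "exp (- (4 * pi) * d) \<le> (65 / 1000 - d) / (65 / 1000 - 3 / 100) * (686 / 1000) +
        (d - 3 / 100) / (65 / 1000 - 3 / 100) * (442 / 1000)" .
    with 1 show ?thesis using d d' by (simp add: field_simps)
  qed
  then show ?thesis using plus unfolding u_def g_def by linarith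
qed

section \<open>Short elements and units\<close>

text \<open>Three ranges: an explicit set \<open>X\<close>, at most \<open>N\<close> further short
  vectors with a uniform bound, and a tail that \<open>tail_sum\<close> controls at a rate \<theta>
  which may be smaller than 2 pi.\<close>

lemma (in quadratic_lattice) infsum_le_short:
  fixes g :: "'a \<Rightarrow> real"
  assumes summ: "g summable_on (L - {0})" and X: "finite X" "X \<subseteq> L - {0}"
    and short: "\<And>x. x \<in> short - X \<Longrightarrow> g x \<le> M" "card (short - X) \<le> N" "M \<ge> 0"
    and tail: "\<theta> \<ge> 4" "K \<ge> 0" "\<And>x. x \<in> L \<Longrightarrow> Q x \<ge> 4 \<Longrightarrow> x \<notin> X \<Longrightarrow> g x \<le> K * exp (- \<theta> * Q x)"
  shows "infsum g (L - {0}) \<le> sum g X + real N * M +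
    K * (exp (- 4 * \<theta>) * (81 + 256 * exp (- \<theta> / 2) + 1 / 1000))"
proof -
  have rest: "g summable_on (L - {0} - X)"
    by (rule summable_on_subset_banach[OF summ]) auto
  have "infsum g (X \<union> (L - {0} - X)) = infsum g X + infsum g (L - {0} - X)"
    by (rule infsum_Un_disjoint) (use X rest in auto)
  moreover have "X \<union> (L - {0} - X) = L - {0}" using X(2) by blast
  ultimately have split: "infsum g (L - {0}) = sum g X + infsum g (L - {0} - X)"
    using X(1) by simp
  have "infsum g (L - {0} - X) \<le> real N * M + K * (exp (- 4 * \<theta>) * (81 + 256 * exp (- \<theta> / 2) + 1 / 1000))"
  proof (rule infsum_le_finite_sums[OF rest])
    fix S assume S: "finite S" "S \<subseteq> L - {0} - X"
    have "sum g S = sum g {x \<in> S. Q x < 4} + sum g {x \<in> S. Q x \<ge> 4}"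
      by (subst sum.union_disjoint[symmetric]) (use S in \<open>auto intro!: sum.cong\<close>)
    also have "sum g {x \<in> S. Q x < 4} \<le> (\<Sum>x\<in>{x \<in> S. Q x < 4}. M)"
      by (rule sum_mono) (use S short(1) in \<open>auto simp: short_def\<close>)
    also have "\<dots> = real (card {x \<in> S. Q x < 4}) * M" by simp
    also have "\<dots> \<le> real N * M"
    proof (intro mult_right_mono short(3))
      have "card {x \<in> S. Q x < 4} \<le> card (short - X)"
        using S finite_short by (intro card_mono) (auto simp: short_def)
      then show "real (card {x \<in> S. Q x < 4}) \<le> real N" using short(2) by simp
    qed
    also have "sum g {x \<in> S. Q x \<ge> 4} \<le> (\<Sum>x\<in>{x \<in> S. Q x \<ge> 4}. K * exp (- \<theta> * Q x))"
    proof (rule sum_mono)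
      fix x assume "x \<in> {x \<in> S. Q x \<ge> 4}"
      then show "g x \<le> K * exp (- \<theta> * Q x)" using S(2) by (intro tail(3)) auto
    qed
    also have "\<dots> = K * (\<Sum>x\<in>{x \<in> S. Q x \<ge> 4}. exp (- \<theta> * Q x))"
      by (simp add: sum_distrib_left)
    also have "\<dots> \<le> K * (exp (- 4 * \<theta>) * (81 + 256 * exp (- \<theta> / 2) + 1 / 1000))"
      by (intro mult_left_mono tail(2) tail_sum) (use S tail in auto)
    finally show "sum g S \<le> real N * M + K * (exp (- 4 * \<theta>) * (81 + 256 * exp (- \<theta> / 2) + 1 / 1000))"
      by simp
  qed
  then show ?thesis using split by simp
qed

lemma cmod_parallelogram: "(cmod (x + y))\<^sup>2 + (cmod (x - y))\<^sup>2 = 2 * (cmod x)\<^sup>2 + 2 * (cmod y)\<^sup>2"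
  unfolding cmod_power2 by (simp add: power2_eq_square algebra_simps)

lemma add_ge_of_mult_ge:
  fixes x y r :: real
  assumes "x \<ge> 0" "y \<ge> 0" "x * y \<ge> (r / 2)\<^sup>2" "r \<ge> 0"
  shows "x + y \<ge> r"
proof (rule power2_le_imp_le)
  have "r\<^sup>2 \<le> 4 * (x * y)" using assms(3) by (simp add: power_divide)
  also have "\<dots> \<le> (x + y)\<^sup>2"
    using zero_le_power2[of "x - y"] by (simp add: power2_eq_square algebra_simps)
  finally show "r\<^sup>2 \<le> (x + y)\<^sup>2" .
qed (use assms in simp)

lemma add_inverse_mono:
  fixes x y :: real
  assumes "1 \<le> y" "y \<le> x \<or> (0 < x \<and> x \<le> 1 / y)"
  shows "y + 1 / y \<le> x + 1 / x"
proof -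
  have *: "y + 1 / y \<le> x + 1 / x" if "1 \<le> y" "y \<le> x" for x y :: real
  proof -
    have "x + 1 / x - (y + 1 / y) = (x - y) * (x * y - 1) / (x * y)"
      using that by (simp add: field_simps)
    moreover have "1 * 1 \<le> x * y" using that by (intro mult_mono) auto
    ultimately have "0 \<le> x + 1 / x - (y + 1 / y)"
      using that by (auto intro!: divide_nonneg_nonneg mult_nonneg_nonneg)
    then show ?thesis by simp
  qed
  show ?thesis
  proof (cases "y \<le> x")
    case True
    then show ?thesis by (rule *[OF assms(1)])
  next
    case False
    then have "0 < x" "x \<le> 1 / y" using assms(2) by auto
    then have "y \<le> 1 / x" using assms(1) by (simp add: field_simps)
    from *[OF assms(1) this] show ?thesis by (simp add: add.commute)
  qed
qed

section \<open>The form of a divisor and the traces of units\<close>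

context quadratic_over_imaginary_quadratic
begin

definition sq :: "'a \<Rightarrow> real" where "sq x = (cmod (\<sigma> x))\<^sup>2"
definition sq' :: "'a \<Rightarrow> real" where "sq' x = (cmod (\<sigma>' x))\<^sup>2"

lemma abs_norm_sq: "abs_norm x = sq x * sq' x"
  by (simp add: abs_norm_def sq_def sq'_def)

lemma sq_simps:
  "sq (x * y) = sq x * sq y" "sq' (x * y) = sq' x * sq' y" "sq 0 = 0" "sq' 0 = 0" "sq 1 = 1" "sq' 1 = 1"
  "sq (- x) = sq x" "sq' (- x) = sq' x" "sq (\<tau> x) = sq' x" "sq' (\<tau> x) = sq x"
  "sq (inverse x) = 1 / sq x" "sq' (inverse x) = 1 / sq' x" "sq x \<ge> 0" "sq' x \<ge> 0"
  by (simp_all add: sq_def sq'_def \<sigma>_simps \<sigma>'_simps norm_mult power_mult_distrib cmod_\<sigma>' \<tau>_\<tau>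
      norm_inverse power_inverse divide_inverse \<tau>_simps)

lemma sq_pos: "x \<noteq> 0 \<Longrightarrow> sq x > 0" "x \<noteq> 0 \<Longrightarrow> sq' x > 0"
  by (simp_all add: sq_def sq'_def \<sigma>_simps \<sigma>'_simps)

text \<open>Since the degree is 0, the two summands of the form at f multiply to the index of f O in
  I. The minimum 2 of the form and the index 1 of a sufficiently short vector both come from
  this.\<close>

lemma ideal_index_eq:
  assumes I: "fractional_ideal I" and pq: "p * q * ideal_norm I = 1" and f: "f \<in> I" "f \<noteq> 0"
  shows "(p * sq f) * (q * sq' f) = real (coset_index I ((*) f ` ring_of_integers))"
    and "coset_index I ((*) f ` ring_of_integers) \<ge> 1"
proof -
  define n where "n = coset_index I ((*) f ` ring_of_integers)"
  have n: "ideal_norm I * real n = abs_norm f" unfolding n_def by (rule ideal_norm_index[OF I f])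
  have "(p * sq f) * (q * sq' f) = (p * q) * (ideal_norm I * real n)"
    unfolding n by (simp add: abs_norm_sq)
  also have "\<dots> = (p * q * ideal_norm I) * real n" by (simp only: mult.assoc)
  finally show "(p * sq f) * (q * sq' f) = real (coset_index I ((*) f ` ring_of_integers))"
    unfolding pq n_def by simp
  have "ideal_norm I * real n > 0" using n abs_norm_pos[OF f(2)] by simp
  then show "coset_index I ((*) f ` ring_of_integers) \<ge> 1" unfolding n_def[symmetric] by (cases n) auto
qed

lemma ideal_lattice:
  assumes I: "fractional_ideal I" and pq: "p > 0" "q > 0" "p * q * ideal_norm I = 1"
  shows "quadratic_lattice I (\<lambda>x. p * sq x + q * sq' x)"
proof
  show "additive_subgroup I" by (rule additive_subgroup_fractional_ideal[OF I])
  show "p * sq (x + y) + q * sq' (x + y) + (p * sq (x - y) + q * sq' (x - y)) =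
      2 * (p * sq x + q * sq' x) + 2 * (p * sq y + q * sq' y)" for x y
  proof -
    have e: "sq (x + y) + sq (x - y) = 2 * sq x + 2 * sq y" "sq' (x + y) + sq' (x - y) = 2 * sq' x + 2 * sq' y"
      using cmod_parallelogram[of "\<sigma> x" "\<sigma> y"] cmod_parallelogram[of "\<sigma>' x" "\<sigma>' y"]
      by (simp_all add: sq_def sq'_def \<sigma>_simps \<sigma>'_simps)
    have "p * sq (x + y) + q * sq' (x + y) + (p * sq (x - y) + q * sq' (x - y)) =
        p * (sq (x + y) + sq (x - y)) + q * (sq' (x + y) + sq' (x - y))" by (simp add: algebra_simps)
    also have "\<dots> = 2 * (p * sq x + q * sq' x) + 2 * (p * sq y + q * sq' y)"
      unfolding e by (simp add: algebra_simps)
    finally show ?thesis .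
  qed
  show "p * sq (of_nat m * x) + q * sq' (of_nat m * x) = (real m)\<^sup>2 * (p * sq x + q * sq' x)" for m x
    by (simp add: sq_def sq'_def \<sigma>_simps \<sigma>'_simps norm_mult power_mult_distrib algebra_simps)
  show "2 \<le> p * sq x + q * sq' x" if x: "x \<in> I" "x \<noteq> 0" for x
  proof -
    have "(2 / 2)\<^sup>2 \<le> (p * sq x) * (q * sq' x)"
      unfolding ideal_index_eq(1)[OF I pq(3) x] using ideal_index_eq(2)[OF I pq(3) x] by simp
    then show ?thesis using pq sq_simps(13,14)[of x] by (intro add_ge_of_mult_ge) auto
  qed
  show "0 \<le> p * sq x + q * sq' x" for x using pq sq_simps(13,14)[of x] by simp
  show "coset_index I ((*) (of_nat m) ` I) = m ^ 4" if "m > 0" for m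
    by (rule ideal_index_nat[OF I that])
qed

lemma fractional_ideal_ring_of_integers: "fractional_ideal (ring_of_integers :: 'a set)"
proof -
  have "ring_of_integers \<noteq> {0::'a}" using ring_of_integers_closed(6) by (metis singletonD zero_neq_one)
  moreover have "\<exists>d\<in>ring_of_integers. d \<noteq> 0 \<and> (*) d ` ring_of_integers \<subseteq> (ring_of_integers :: 'a set)"
    by (intro bexI[of _ 1] conjI) (auto intro: ring_of_integers_closed)
  ultimately show ?thesis
    unfolding fractional_ideal_def by (auto intro: ring_of_integers_closed)
qed

lemma ideal_norm_ring_of_integers: "ideal_norm (ring_of_integers :: 'a set) = 1"
proof -
  have "principal_index (1::'a) = 1"
    using principal_index_power[OF ring_of_integers_closed(6), where 'a = 'a and k = 0] by simp
  then show ?thesis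
    using ideal_norm_index[OF fractional_ideal_ring_of_integers ring_of_integers_closed(6)]
    by (simp add: abs_norm_sq sq_simps)
qed

lemma integer_lattice:
  assumes "p > 0" shows "quadratic_lattice ring_of_integers (\<lambda>x. p * sq x + 1 / p * sq' x)"
  using assms by (intro ideal_lattice fractional_ideal_ring_of_integers)
    (auto simp: ideal_norm_ring_of_integers)

definition trace_sq :: "'a \<Rightarrow> real" where "trace_sq x = sq x + sq' x"
definition diff_sq :: "'a \<Rightarrow> real" where "diff_sq x = \<bar>sq x - sq' x\<bar>"

lemma diff_sq_square: "(diff_sq x)\<^sup>2 = (trace_sq x)\<^sup>2 - 4 * abs_norm x"
  by (simp add: diff_sq_def trace_sq_def abs_norm_sq power2_eq_square algebra_simps)

lemma trace_sq_ge:
  assumes "x \<in> ring_of_integers" "x \<noteq> 0" shows "trace_sq x \<ge> 2"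
  unfolding trace_sq_def
  by (rule add_ge_of_mult_ge) (use abs_norm_ge_1[OF assms] sq_simps(13,14)[of x] in \<open>auto simp: abs_norm_sq\<close>)

lemma integer_nonunit:
  assumes "x \<in> ring_of_integers" "x \<noteq> 0" "abs_norm x \<noteq> 1"
  shows "abs_norm x \<ge> 2"
proof -
  obtain n :: nat where n: "abs_norm x = real n" using abs_norm_integer[OF assms(1)] by (elim Nats_cases)
  then have "n \<noteq> 0" "n \<noteq> 1" using abs_norm_pos[OF assms(2)] assms(3) by auto
  then show ?thesis using n by simp
qed

text \<open>By Kronecker's theorem these are the roots of unity in F; the sums see only the absolute
  values.\<close>

definition torsion :: "'a set" where
  "torsion = {f \<in> ring_of_integers. sq f = 1 \<and> sq' f = 1}"

definition nontorsion_units :: "'a set" where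
  "nontorsion_units = {f \<in> ring_of_integers. abs_norm f = 1 \<and> sq f \<noteq> 1}"

lemma nonunit_or_unit_cases:
  assumes "f \<in> ring_of_integers" "f \<noteq> 0"
  shows "abs_norm f \<ge> 2 \<or> f \<in> torsion \<or> f \<in> nontorsion_units"
proof (cases "abs_norm f = 1")
  case True
  then show ?thesis using assms by (auto simp: torsion_def nontorsion_units_def abs_norm_sq)
qed (use integer_nonunit[OF assms] in blast)

text \<open>For \<open>t = f + \<tau> f\<close> and \<open>n = f * \<tau> f\<close> in \<open>K\<close>, the discriminant \<open>t\<^sup>2 - 4 n\<close> gives
  \<open>(2 A - |t|\<^sup>2)\<^sup>2 = |t\<^sup>2 - 4 n|\<^sup>2\<close>, so \<open>A\<close> is a root of \<open>X\<^sup>2 - |t|\<^sup>2 X - m\<close> with an integer \<open>m\<close>, and few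
  pairs \<open>(|t|\<^sup>2, m)\<close> are possible for \<open>A < 2.56\<close>. In the first of them \<open>t\<^sup>2\<close> times the conjugate of \<open>n\<close> is a
  sixth root of unity.\<close>

lemma minimal_trace_cases:
  assumes f: "f \<in> ring_of_integers" "abs_norm f = 1" "sq f \<noteq> 1"
  shows "trace_sq f > 2"
    and "trace_sq f \<ge> 256 / 100 \<or> (trace_sq f)\<^sup>2 - 2 * trace_sq f = 1 \<or>
      ((trace_sq f)\<^sup>2 - trace_sq f = 3 \<and> (\<exists>\<zeta>\<in>torsion. \<zeta> * \<zeta> = \<zeta> - 1))"
proof -
  define A where "A = trace_sq f"
  have f0: "f \<noteq> 0" using f(2) by (auto simp: abs_norm_sq sq_simps)
  have ne: "sq f \<noteq> sq' f"
  proof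
    assume "sq f = sq' f"
    then have "(sq f)\<^sup>2 = 1" using f(2) by (simp add: abs_norm_sq power2_eq_square)
    then show False using f(3) sq_simps(13)[of f] by (simp add: power2_eq_1_iff)
  qed
  then have "diff_sq f > 0" by (simp add: diff_sq_def)
  then have "(diff_sq f)\<^sup>2 > 0" by simp
  then have "A\<^sup>2 > 2\<^sup>2" using diff_sq_square[of f] f(2) by (simp add: A_def)
  then show A2: "trace_sq f > 2"
    using trace_sq_ge[OF f(1) f0] unfolding A_def by (metis order_le_less order_less_irrefl)
  obtain t where t: "f + \<tau> f = \<iota> t" using trace_in by blast
  obtain n where n: "f * \<tau> f = \<iota> n" using norm_in by blast
  have tO: "\<iota> t \<in> ring_of_integers" and nO: "\<iota> n \<in> ring_of_integers"
    unfolding t[symmetric] n[symmetric] using f(1) by (auto intro!: ring_of_integers_closed simp: \<tau>_integer)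
  \<comment> \<open>As the conjugate of n lies in K, z below is the image of an integer of K, so 2
    Re z is an integer.\<close>
  obtain n' where n': "\<iota> n' \<in> ring_of_integers" "\<sigma> (\<iota> n') = cnj (\<sigma> (\<iota> n))"
    using conjugate_integer[OF nO] by blast
  define T where "T = \<sigma> (\<iota> t)"
  define N where "N = \<sigma> (\<iota> n)"
  have T: "T = \<sigma> f + \<sigma> (\<tau> f)" and N: "N = \<sigma> f * \<sigma> (\<tau> f)"
    unfolding T_def N_def t[symmetric] n[symmetric] by (simp_all add: \<sigma>_simps)
  obtain k :: nat where k: "(cmod T)\<^sup>2 = real k"
    using subfield_integer_abs(1)[OF tO] unfolding T_def by (elim Nats_cases)
  have N1: "(cmod N)\<^sup>2 = 1"
    using f(2) unfolding N by (simp add: abs_norm_sq sq_def sq'_def cmod_\<sigma>' norm_mult power_mult_distrib)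
  define z where "z = T\<^sup>2 * cnj N"
  define \<zeta> where "\<zeta> = \<iota> (t * t * n')"
  have \<zeta>O: "\<zeta> \<in> ring_of_integers"
    unfolding \<zeta>_def field_embedding_simps[OF emb(1)] using tO n'(1) by (intro ring_of_integers_closed)
  have \<zeta>: "\<sigma> \<zeta> = z"
    unfolding \<zeta>_def z_def T_def N_def
    by (simp add: field_embedding_simps[OF emb(1)] \<sigma>_simps n'(2) power2_eq_square)
  have "2 * Re z \<in> \<int>"
    using subfield_integer_abs(2)[of "t * t * n'"] \<zeta>O \<zeta> unfolding \<zeta>_def by simp
  then obtain j :: int where j: "2 * Re z = of_int j" by (elim Ints_cases)
  have z1: "(cmod z)\<^sup>2 = (real k)\<^sup>2"
    using N1 k by (simp add: z_def norm_mult power_mult_distrib norm_power)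
  have D: "(\<sigma> f - \<sigma> (\<tau> f))\<^sup>2 = T\<^sup>2 - 4 * N"
    unfolding T N by (simp add: power2_eq_square algebra_simps)
  have A: "2 * A = real k + (cmod (\<sigma> f - \<sigma> (\<tau> f)))\<^sup>2"
    using cmod_parallelogram[of "\<sigma> f" "\<sigma> (\<tau> f)"] k
    unfolding A_def trace_sq_def sq_def sq'_def cmod_\<sigma>' T by simp
  have "((cmod (\<sigma> f - \<sigma> (\<tau> f)))\<^sup>2)\<^sup>2 = (cmod (T\<^sup>2 - 4 * N))\<^sup>2"
    unfolding D[symmetric] by (simp add: norm_power)
  also have "\<dots> = (cmod (T\<^sup>2))\<^sup>2 + 16 * (cmod N)\<^sup>2 - 8 * Re z"
    unfolding z_def cmod_power2 by (simp add: power2_eq_square algebra_simps)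
  also have "\<dots> = (real k)\<^sup>2 + 16 - 4 * of_int j"
    using k N1 j by (simp add: norm_power)
  finally have "(2 * A - real k)\<^sup>2 = (real k)\<^sup>2 + 16 - 4 * of_int j" using A by simp
  then have quad: "A\<^sup>2 - real k * A = of_int (4 - j)"
    by (simp add: power2_eq_square algebra_simps)
  have kA: "real k \<le> 2 * A" using A by simp
  have k0: "k \<noteq> 0"
  proof
    assume "k = 0"
    then have "T = 0" using k by simp
    then have "\<sigma> (\<tau> f) = - \<sigma> f" unfolding T by (simp add: eq_neg_iff_add_eq_0 add.commute)
    then have "sq' f = sq f" by (simp add: sq_def sq'_def cmod_\<sigma>')
    then show False using ne by simp
  qed
  have A2': "A > 2" using A2 by (simp add: A_def)
  show "trace_sq f \<ge> 256 / 100 \<or> (trace_sq f)\<^sup>2 - 2 * trace_sq f = 1 \<or>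
      ((trace_sq f)\<^sup>2 - trace_sq f = 3 \<and> (\<exists>\<zeta>\<in>torsion. \<zeta> * \<zeta> = \<zeta> - 1))"
  proof (cases "A \<ge> 256 / 100")
    case True
    then show ?thesis by (simp add: A_def)
  next
    case False
    define m where "m = 4 - j"
    have m: "A\<^sup>2 - real k * A = of_int m" using quad by (simp add: m_def)
    have up: "A\<^sup>2 < (256 / 100 + 2) * A - 2 * (256 / 100)"
    proof -
      have "0 < (A - 2) * (256 / 100 - A)" using A2' False by (intro mult_pos_pos) auto
      also have "\<dots> = (256 / 100 + 2) * A - 2 * (256 / 100) - A\<^sup>2" by (simp add: power2_eq_square field_simps)
      finally show ?thesis by simp
    qed
    have lo: "(A - 2)\<^sup>2 > 0" using A2' by simp
    then have lo: "A\<^sup>2 > 4 * A - 4" by (simp add: power2_eq_square algebra_simps)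
    \<comment> \<open>For each k the bounds on A confine the integer m to an interval containing at
      most one integer; for k = 5 the condition k \<le> 2 A, that is A \<ge> 5/2, is used as
      well.\<close>
    have "k < 6" using kA False by simp
    then have "k = 1 \<or> k = 2 \<or> k = 3 \<or> k = 4 \<or> k = 5" using k0 by linarith
    then consider "k = 1" "m = 3" | "k = 2" "m = 1"
    proof (elim disjE)
      assume k: "k = 1"
      have "2 < real_of_int m" "real_of_int m < 4" using m up lo k A2' False by auto
      then have "m = 3" by linarith
      then show ?thesis using k that by blast
    next
      assume k: "k = 2"
      have "0 < real_of_int m" "real_of_int m < 2" using m up lo k A2' False by auto
      then have "m = 1" by linarith
      then show ?thesis using k that by blast
    next
      assume k: "k = 3"
      have "- 2 < real_of_int m" "real_of_int m < - 1" using m up lo k A2' False by auto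
      then have "m > - 2" "m < - 1" by linarith+
      then show ?thesis by linarith
    next
      assume k: "k = 4"
      have "- 4 < real_of_int m" "real_of_int m < - 3" using m up lo k A2' False by auto
      then have "m > - 4" "m < - 3" by linarith+
      then show ?thesis by linarith
    next
      assume k: "k = 5"
      have "0 \<le> (A - 5 / 2)\<^sup>2" by simp
      then have "- 7 < real_of_int m" "real_of_int m < - 6"
        using m k kA False mult_nonneg_nonneg[of "A - 5 / 2" "256 / 100 - A"] by (auto simp: power2_eq_square algebra_simps)
      then have "m > - 7" "m < - 6" by linarith+
      then show ?thesis by linarith
    qed
    then show ?thesis
    proof cases
      case 1
      have cz: "(cmod z)\<^sup>2 = 1" using z1 1(1) by simp
      have re: "Re z = 1 / 2" using j 1(2) by (simp add: m_def)
      have im: "Im z * Im z = 3 / 4" using cz re unfolding cmod_power2 by (simp add: power2_eq_square)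
      have "z * z = z - 1" by (rule complex_eqI) (simp_all add: re im)
      then have "\<sigma> (\<zeta> * \<zeta>) = \<sigma> (\<zeta> - 1)" by (simp add: \<sigma>_simps \<zeta>)
      then have "\<zeta> * \<zeta> = \<zeta> - 1" unfolding field_embedding_simps(10)[OF emb(2)] .
      moreover have "sq \<zeta> = 1" using cz by (simp add: sq_def \<zeta>)
      moreover from this have "sq' \<zeta> = 1" by (simp add: sq_def sq'_def cmod_\<sigma>' \<zeta>_def \<tau>_\<iota>)
      ultimately have "\<exists>\<zeta>\<in>torsion. \<zeta> * \<zeta> = \<zeta> - 1" using \<zeta>O by (auto simp: torsion_def)
      then show ?thesis using m 1 by (simp add: A_def)
    next
      case 2
      then show ?thesis using m by (simp add: A_def)
    qed
  qed
qed

lemma card_torsion_ge_6: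
  assumes "finite (torsion :: 'a set)" and \<zeta>: "\<zeta> \<in> torsion" "\<zeta> * \<zeta> = \<zeta> - 1"
  shows "card (torsion :: 'a set) \<ge> 6"
proof -
  have one: "1 \<in> torsion" by (simp add: torsion_def sq_simps ring_of_integers_closed)
  have neg: "- x \<in> torsion" if "x \<in> torsion" for x
    using that by (simp add: torsion_def sq_simps ring_of_integers_closed)
  have "\<zeta> - 1 \<in> torsion" using \<zeta> unfolding \<zeta>(2)[symmetric]
    by (simp add: torsion_def sq_simps ring_of_integers_closed)
  then have sub: "{1, - 1, \<zeta>, - \<zeta>, \<zeta> - 1, 1 - \<zeta>} \<subseteq> torsion"
    using one neg[OF one] \<zeta>(1) neg[OF \<zeta>(1)] neg[of "\<zeta> - 1"] by simp
  have bad: "\<zeta> \<noteq> 0" "\<zeta> \<noteq> 1" "\<zeta> \<noteq> - 1" "\<zeta> \<noteq> 2" "2 * \<zeta> \<noteq> 1"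
  proof -
    show "\<zeta> \<noteq> 0" "\<zeta> \<noteq> 1" "\<zeta> \<noteq> - 1" "\<zeta> \<noteq> 2" using \<zeta>(2) by auto
    show "2 * \<zeta> \<noteq> 1"
    proof
      assume "2 * \<zeta> = 1"
      moreover have "(2 * \<zeta>) * (2 * \<zeta>) = 4 * (\<zeta> * \<zeta>)" by simp
      moreover have "4 * (\<zeta> * \<zeta>) = 2 * (2 * \<zeta>) - 4" unfolding \<zeta>(2) by (simp add: algebra_simps)
      ultimately show False by simp
    qed
  qed
  have "card {1, - 1, \<zeta>, - \<zeta>, \<zeta> - 1, 1 - \<zeta>} = 6"
  proof -
    have "(1::'a) \<noteq> - 1" "1 \<noteq> \<zeta>" "1 \<noteq> - \<zeta>" "1 \<noteq> \<zeta> - 1" "1 \<noteq> 1 - \<zeta>" "- 1 \<noteq> \<zeta>" "- 1 \<noteq> - \<zeta>" "- 1 \<noteq> \<zeta> - 1"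
      "- 1 \<noteq> 1 - \<zeta>" "\<zeta> \<noteq> - \<zeta>" "\<zeta> \<noteq> \<zeta> - 1" "\<zeta> \<noteq> 1 - \<zeta>" "- \<zeta> \<noteq> \<zeta> - 1" "- \<zeta> \<noteq> 1 - \<zeta>" "\<zeta> - 1 \<noteq> 1 - \<zeta>"
      using bad \<open>2 * \<zeta> \<noteq> 1\<close> by (auto simp: algebra_simps eq_neg_iff_add_eq_0 minus_equation_iff)
    then show ?thesis by simp
  qed
  then show ?thesis using card_mono[OF assms(1) sub] by simp
qed

end

section \<open>Torsion and the unit of least trace\<close>

context quadratic_over_imaginary_quadratic
begin

lemma trace_lattice: "quadratic_lattice (ring_of_integers :: 'a set) trace_sq"
  using integer_lattice[of 1] by (simp add: trace_sq_def[abs_def])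

lemma torsion_integer: "x \<in> torsion \<Longrightarrow> x \<in> ring_of_integers"
  by (simp add: torsion_def)

lemma torsion_nonzero: "x \<in> torsion \<Longrightarrow> x \<noteq> 0"
  by (auto simp: torsion_def sq_simps)

lemma torsion_trace: "x \<in> torsion \<Longrightarrow> trace_sq x = 2"
  by (simp add: torsion_def trace_sq_def)

lemma finite_torsion: "finite torsion"
proof -
  interpret quadratic_lattice "ring_of_integers :: 'a set" trace_sq by (rule trace_lattice)
  show ?thesis
    by (rule finite_subset[OF _ card_ball(1)[of 3]]) (auto simp: torsion_integer torsion_trace)
qed

lemma one_torsion: "1 \<in> torsion"
  by (simp add: torsion_def sq_simps ring_of_integers_closed)

lemma torsion_inverse:
  assumes "x \<in> torsion" shows "inverse x \<in> torsion"
proof -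
  have "abs_norm x = 1" using assms by (simp add: torsion_def abs_norm_sq)
  then show ?thesis using assms inverse_integer[of x] by (simp add: torsion_def sq_simps)
qed

lemma card_torsion_ge_2: "card torsion \<ge> 2"
proof -
  have "- 1 \<in> torsion" by (simp add: torsion_def sq_simps ring_of_integers_closed)
  then have "card {1, - 1::'a} \<le> card torsion" using one_torsion by (intro card_mono finite_torsion) auto
  then show ?thesis by simp
qed

lemma nontorsion_unit_facts:
  assumes "f \<in> nontorsion_units"
  shows "f \<in> ring_of_integers" "f \<noteq> 0" "sq f > 0" "sq' f = 1 / sq f" "trace_sq f = sq f + 1 / sq f"
    "(diff_sq f)\<^sup>2 = (trace_sq f)\<^sup>2 - 4" "inverse f \<in> nontorsion_units" "trace_sq (inverse f) = trace_sq f"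
    "diff_sq (inverse f) = diff_sq f"
proof -
  have f: "f \<in> ring_of_integers" "abs_norm f = 1" "sq f \<noteq> 1"
    using assms by (auto simp: nontorsion_units_def)
  show "f \<in> ring_of_integers" by fact
  show f0: "f \<noteq> 0" using f(2) by (auto simp: abs_norm_sq sq_simps)
  show pos: "sq f > 0" by (rule sq_pos[OF f0])
  show inv: "sq' f = 1 / sq f" using f(2) pos by (simp add: abs_norm_sq field_simps)
  then show tr: "trace_sq f = sq f + 1 / sq f" by (simp add: trace_sq_def)
  show "(diff_sq f)\<^sup>2 = (trace_sq f)\<^sup>2 - 4" using diff_sq_square[of f] f(2) by simp
  show "inverse f \<in> nontorsion_units"
    using f inverse_integer[OF f(1,2)] pos by (simp add: nontorsion_units_def abs_norm_sq sq_simps inv)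
  show "trace_sq (inverse f) = trace_sq f"
    unfolding trace_sq_def sq_simps inv using pos by simp
  show "diff_sq (inverse f) = diff_sq f"
    unfolding diff_sq_def sq_simps inv using pos by (simp add: abs_minus_commute)
qed

text \<open>Integers of bounded trace lie in a finite ball, so the minimum is attained, and f or its
  inverse has \<open>sq\<close> above 1. Up to torsion this f is a fundamental unit.\<close>

lemma minimal_unit:
  assumes "nontorsion_units \<noteq> {}"
  obtains f where "f \<in> nontorsion_units" "sq f > 1" "\<And>g. g \<in> nontorsion_units \<Longrightarrow> trace_sq f \<le> trace_sq g"
proof -
  interpret quadratic_lattice "ring_of_integers :: 'a set" trace_sq by (rule trace_lattice)
  obtain f0 where f0: "f0 \<in> nontorsion_units" using assms by blast
  define S where "S = {g \<in> nontorsion_units. trace_sq g \<le> trace_sq f0}"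
  obtain m :: nat where m: "trace_sq f0 < real m" using reals_Archimedean2 by blast
  have m0: "m > 0" using m nonneg[of f0] by (cases m) auto
  have "real m \<le> (real m)\<^sup>2" using m0 by (simp add: power2_eq_square)
  then have "trace_sq f0 < 2 * (real m)\<^sup>2" using m zero_le_power2[of "real m"] by linarith
  also have "\<dots> = (real (2 * m))\<^sup>2 / 2" by (simp add: power_mult_distrib)
  finally have "trace_sq f0 < (real (2 * m))\<^sup>2 / 2" .
  then have "S \<subseteq> {x \<in> ring_of_integers. trace_sq x < (real (2 * m))\<^sup>2 / 2}"
    by (auto simp: S_def nontorsion_unit_facts(1) simp del: of_nat_mult)
  then have fin: "finite S" using card_ball(1)[of "2 * m"] m0 by (meson finite_subset mult_pos_pos zero_less_numeral)
  have "S \<noteq> {}" using f0 by (auto simp: S_def)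
  then obtain g where g: "g \<in> S" "\<forall>h\<in>S. trace_sq g \<le> trace_sq h"
    using ex_min_if_finite[of "trace_sq ` S"] fin by (metis (no_types, lifting) arg_min_if_finite not_le)
  have gm: "trace_sq g \<le> trace_sq h" if "h \<in> nontorsion_units" for h
    using g that by (cases "trace_sq h \<le> trace_sq f0") (auto simp: S_def)
  have gN: "g \<in> nontorsion_units" using g by (simp add: S_def)
  show thesis
  proof (cases "sq g > 1")
    case True
    then show ?thesis using that gN gm by blast
  next
    case False
    then have "sq g < 1" using gN by (simp add: nontorsion_units_def)
    then have "sq (inverse g) > 1" using nontorsion_unit_facts(3)[OF gN] by (simp add: sq_simps)
    then show ?thesis
      using that[of "inverse g"] nontorsion_unit_facts(7,8)[OF gN] gm by simp
  qed
qed

text \<open>Together with the torsion these elements are summed exactly; all others are only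
  bounded.\<close>

definition basic_units :: "'a \<Rightarrow> 'a set" where
  "basic_units f = (*) f ` torsion \<union> (*) (inverse f) ` torsion"

lemma basic_units_facts:
  assumes f: "f \<in> nontorsion_units" "sq f > 1"
  shows "basic_units f \<subseteq> nontorsion_units" "finite (basic_units f)" "card (basic_units f) = 2 * card torsion"
    "basic_units f \<inter> torsion = {}"
    "\<And>h :: 'a \<Rightarrow> real. (\<And>x y. sq x = sq y \<Longrightarrow> sq' x = sq' y \<Longrightarrow> h x = h y) \<Longrightarrow>
      sum h (torsion \<union> basic_units f) = real (card torsion) * (h 1 + h f + h (inverse f))"
proof -
  note F = nontorsion_unit_facts[OF f(1)]
  have *: "(*) g ` torsion \<subseteq> nontorsion_units" if g: "g \<in> nontorsion_units" for g
    using g by (auto simp: nontorsion_units_def torsion_def abs_norm_sq sq_simps ring_of_integers_closed)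
  show sub: "basic_units f \<subseteq> nontorsion_units"
    unfolding basic_units_def using *[OF f(1)] *[OF F(7)] by blast
  show fin: "finite (basic_units f)" by (simp add: basic_units_def finite_torsion)
  have disj: "(*) f ` torsion \<inter> (*) (inverse f) ` torsion = {}"
  proof -
    have "sq x > 1" if "x \<in> (*) f ` torsion" for x using that f(2) by (auto simp: sq_simps torsion_def)
    moreover have "sq x < 1" if "x \<in> (*) (inverse f) ` torsion" for x
      using that f(2) by (auto simp: sq_simps torsion_def)
    ultimately show ?thesis by force
  qed
  have inj: "inj_on ((*) g) torsion" if "g \<noteq> 0" for g using that by (auto simp: inj_on_def)
  show "card (basic_units f) = 2 * card torsion"
    unfolding basic_units_def using F(2)
    by (subst card_Un_disjoint) (auto simp: finite_torsion disj card_image inj)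
  show disj2: "basic_units f \<inter> torsion = {}"
    using sub by (auto simp: nontorsion_units_def torsion_def)
  show "sum h (torsion \<union> basic_units f) = real (card torsion) * (h 1 + h f + h (inverse f))"
    if h: "\<And>x y. sq x = sq y \<Longrightarrow> sq' x = sq' y \<Longrightarrow> h x = h y" for h :: "'a \<Rightarrow> real"
  proof -
    have 1: "sum h ((*) g ` torsion) = real (card torsion) * h g" if "g \<noteq> 0" for g
    proof -
      have "sum h ((*) g ` torsion) = (\<Sum>x\<in>torsion. h (g * x))"
        by (subst sum.reindex[OF inj[OF that]]) simp
      also have "\<dots> = (\<Sum>x\<in>torsion. h g)"
        by (intro sum.cong refl h) (auto simp: sq_simps torsion_def)
      finally show ?thesis by simp
    qed
    have "sum h torsion = real (card torsion) * h 1"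
    proof -
      have "sum h torsion = (\<Sum>x\<in>torsion. h 1)"
        by (intro sum.cong refl h) (auto simp: sq_simps torsion_def)
      then show ?thesis by simp
    qed
    moreover have "sum h (basic_units f) = real (card torsion) * h f + real (card torsion) * h (inverse f)"
      unfolding basic_units_def using F(2) 1[of f] 1[of "inverse f"]
      by (subst sum.union_disjoint) (auto simp: finite_torsion disj)
    ultimately show ?thesis
      using disj2 fin finite_torsion by (subst sum.union_disjoint) (auto simp: algebra_simps)
  qed
qed

text \<open>If \<open>sq g\<close> lies between \<open>sq f\<close> and its square, then g / f is an
  integer of norm 1 which is torsion or has smaller trace than f. Inversion handles
  \<open>sq g\<close> below 1.\<close>

lemma other_units:
  assumes f: "f \<in> nontorsion_units" "sq f > 1" "\<And>g. g \<in> nontorsion_units \<Longrightarrow> trace_sq f \<le> trace_sq g"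
    and g: "g \<in> nontorsion_units" "g \<notin> basic_units f"
  shows "sq g \<ge> (sq f)\<^sup>2 \<or> sq g \<le> 1 / (sq f)\<^sup>2"
proof -
  have main: "sq g \<ge> (sq f)\<^sup>2" if g: "g \<in> nontorsion_units" "g \<notin> basic_units f" "sq g > 1" for g
  proof (rule ccontr)
    note F = nontorsion_unit_facts[OF f(1)] and G = nontorsion_unit_facts[OF g(1)]
    assume less: "\<not> sq g \<ge> (sq f)\<^sup>2"
    have strict: "x + 1 / x < y + 1 / y" if "1 \<le> x" "x < y" for x y :: real
    proof -
      have "y + 1 / y - (x + 1 / x) = (y - x) * (x * y - 1) / (x * y)"
        using that by (simp add: field_simps)
      moreover have "1 < x * y" using that less_1_mult[of x y] by (cases "x = 1") auto
      ultimately have "y + 1 / y - (x + 1 / x) > 0" using that by simp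
      then show ?thesis by simp
    qed
    have ge: "sq g \<ge> sq f"
      using strict[of "sq g" "sq f"] f(3)[OF g(1)] g(3) unfolding F(5) G(5) by force
    define h where "h = g * inverse f"
    have hO: "h \<in> ring_of_integers" "abs_norm h = 1"
      using g(1) F(7) by (auto simp: h_def nontorsion_units_def abs_norm_mult intro: ring_of_integers_closed)
    have sqh: "sq h = sq g / sq f" by (simp add: h_def sq_simps)
    have gh: "g = f * h" using F(2) by (simp add: h_def)
    show False
    proof (cases "sq h = 1")
      case True
      then have "h \<in> torsion" using hO by (simp add: torsion_def abs_norm_sq)
      then show False using g(2) gh by (auto simp: basic_units_def)
    next
      case False
      then have hN: "h \<in> nontorsion_units" using hO by (simp add: nontorsion_units_def)
      have "1 \<le> sq h" "sq h < sq f"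
        using ge less f(2) by (simp_all add: sqh field_simps power2_eq_square)
      then have "trace_sq h < trace_sq f"
        using strict[of "sq h" "sq f"] nontorsion_unit_facts(5)[OF hN] F(5) by simp
      then show False using f(3)[OF hN] by simp
    qed
  qed
  show ?thesis
  proof (cases "sq g > 1")
    case True
    then show ?thesis using main g by blast
  next
    case False
    note G = nontorsion_unit_facts[OF g(1)]
    have "sq (inverse g) > 1"
      using False g(1) G(3) by (simp add: nontorsion_units_def sq_simps less_le)
    moreover have "inverse g \<notin> basic_units f"
    proof
      assume "inverse g \<in> basic_units f"
      then obtain x where x: "x \<in> torsion" "inverse g = f * x \<or> inverse g = inverse f * x"
        by (auto simp: basic_units_def)
      then have "g = inverse f * inverse x \<or> g = f * inverse x"
        by (metis inverse_inverse_eq inverse_mult_distrib)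
      then show False using g(2) torsion_inverse[OF x(1)] by (auto simp: basic_units_def)
    qed
    ultimately have "1 / sq g \<ge> (sq f)\<^sup>2" using main[OF G(7)] by (simp add: sq_simps)
    then show ?thesis using G(3) f(2) by (simp add: field_simps)
  qed
qed

end

section \<open>Comparison with the trivial divisor\<close>

text \<open>The divisor \<open>(O, (p, 1/p)\<^sup>1\<^sup>/\<^sup>2)\<close>, for which 1 is a shortest vector. Weights are normalised so that the
  shortest vectors of the trivial divisor have weight 1.\<close>

locale distorted_integers = quadratic_over_imaginary_quadratic \<iota> \<sigma> \<sigma>' \<tau>
  for \<iota> :: "'k::field_char_0 \<Rightarrow> 'a::field_char_0" and \<sigma> \<sigma>' \<tau> +
  fixes p d :: real
  assumes p: "p > 0" "p \<noteq> 1" and d_def: "2 * (1 + d) = p + 1 / p"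
    and shortest: "\<And>x. x \<in> ring_of_integers \<Longrightarrow> x \<noteq> 0 \<Longrightarrow> p + 1 / p \<le> p * sq x + 1 / p * sq' x"
    and d_less: "d < 1 / 4"
begin

definition energy :: "'a \<Rightarrow> real" where "energy x = p * sq x + 1 / p * sq' x"
definition weight :: "'a \<Rightarrow> real" where "weight x = exp (- (2 * pi) * (energy x - 2))"
definition weight0 :: "'a \<Rightarrow> real" where "weight0 x = exp (- (2 * pi) * (trace_sq x - 2))"
definition s :: real where "s = sqrt (2 * d + d\<^sup>2)"

sublocale L0: quadratic_lattice ring_of_integers trace_sq by (rule trace_lattice)
sublocale Lt: quadratic_lattice ring_of_integers energy
  unfolding energy_def[abs_def] by (rule integer_lattice[OF p(1)])

lemma d_pos: "d > 0"
proof -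
  have "0 < (p - 1)\<^sup>2 / p" using p by simp
  also have "\<dots> = 2 * d" using d_def p(1) by (simp add: field_simps power2_eq_square)
  finally show ?thesis by simp
qed

lemma s: "s \<ge> 0" "s\<^sup>2 = 2 * d + d\<^sup>2" "\<bar>(p - 1 / p) / 2\<bar> = s"
proof -
  show "s \<ge> 0" "s\<^sup>2 = 2 * d + d\<^sup>2" using d_pos by (simp_all add: s_def)
  have "((p - 1 / p) / 2)\<^sup>2 = ((p + 1 / p) / 2)\<^sup>2 - 1"
    using p(1) by (simp add: field_simps power2_eq_square)
  also have "\<dots> = 2 * d + d\<^sup>2" unfolding d_def[symmetric] by (simp add: power2_eq_square field_simps)
  finally have "((p - 1 / p) / 2)\<^sup>2 = 2 * d + d\<^sup>2" .
  then show "\<bar>(p - 1 / p) / 2\<bar> = s" unfolding s_def by (metis real_sqrt_abs)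
qed

text \<open>Splits the form into parts even and odd under replacing p by 1 / p; \<tau> changes the
  sign of the odd part.\<close>

lemma energy_eq: "energy x = trace_sq x * (1 + d) + (sq x - sq' x) * ((p - 1 / p) / 2)"
proof -
  have d: "(p + 1 / p) / 2 = 1 + d" using d_def by simp
  have "p * a + q * b = (a + b) * ((p + q) / 2) + (a - b) * ((p - q) / 2)" for a b q :: real
    by (simp add: field_simps)
  then show ?thesis unfolding energy_def trace_sq_def d[symmetric] .
qed

lemma energy_\<tau>: "energy (\<tau> x) = trace_sq x * (1 + d) - (sq x - sq' x) * ((p - 1 / p) / 2)"
proof -
  have "sq (\<tau> x) - sq' (\<tau> x) = - (sq x - sq' x)" "trace_sq (\<tau> x) = trace_sq x"
    by (simp_all add: trace_sq_def sq_simps)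
  then show ?thesis unfolding energy_eq[of "\<tau> x"] by (simp only: mult_minus_left diff_conv_add_uminus)
qed

lemma energy_cases:
  "(energy x = trace_sq x * (1 + d) + diff_sq x * s \<and> energy (\<tau> x) = trace_sq x * (1 + d) - diff_sq x * s) \<or>
   (energy x = trace_sq x * (1 + d) - diff_sq x * s \<and> energy (\<tau> x) = trace_sq x * (1 + d) + diff_sq x * s)"
proof -
  have "\<bar>(sq x - sq' x) * ((p - 1 / p) / 2)\<bar> = diff_sq x * s"
    unfolding abs_mult s(3) by (simp add: diff_sq_def)
  then have "(sq x - sq' x) * ((p - 1 / p) / 2) = diff_sq x * s \<or> (sq x - sq' x) * ((p - 1 / p) / 2) = - (diff_sq x * s)"
    by linarith
  then show ?thesis unfolding energy_\<tau> unfolding energy_eq by auto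
qed

lemma weight_average: "(weight x + weight (\<tau> x)) / 2 - weight0 x = gain (trace_sq x) (diff_sq x) d"
proof -
  define A where "A = trace_sq x"
  define B where "B = diff_sq x"
  have "weight x + weight (\<tau> x) = exp (- (2 * pi) * (A * (1 + d) + B * s - 2)) + exp (- (2 * pi) * (A * (1 + d) - B * s - 2))"
    using energy_cases[of x] unfolding weight_def A_def[symmetric] B_def[symmetric] by auto
  also have "exp (- (2 * pi) * (A * (1 + d) + B * s - 2)) = exp (- (2 * pi) * (A - 2)) * exp (- (2 * pi) * A * d) * exp (- (2 * pi * B * s))"
    unfolding exp_add[symmetric] by (rule arg_cong[of _ _ exp]) (simp add: algebra_simps)
  also have "exp (- (2 * pi) * (A * (1 + d) - B * s - 2)) = exp (- (2 * pi) * (A - 2)) * exp (- (2 * pi) * A * d) * exp (2 * pi * B * s)"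
    unfolding exp_add[symmetric] by (rule arg_cong[of _ _ exp]) (simp add: algebra_simps)
  finally have "(weight x + weight (\<tau> x)) / 2 = exp (- (2 * pi) * (A - 2)) * (exp (- (2 * pi) * A * d) * cosh (2 * pi * B * s))"
    unfolding cosh_field_def by (simp add: algebra_simps)
  then show ?thesis
    unfolding gain_def weight0_def s_def A_def[symmetric] B_def[symmetric] by (simp add: right_diff_distrib)
qed

lemma two_pi_ge: "2 * pi \<ge> 4" "2 * pi * (715 / 1000) \<ge> 4"
  using pi_bounds by simp_all

lemma weight_exp: "weight x = exp (8 * pi / 2) * exp (- (2 * pi) * energy x)"
  "weight0 x = exp (8 * pi / 2) * exp (- (2 * pi) * trace_sq x)"
  unfolding weight_def weight0_def exp_add[symmetric] by (simp_all add: algebra_simps)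

lemma summable_weight: "weight summable_on (ring_of_integers - {0})" "weight0 summable_on (ring_of_integers - {0})"
proof -
  show "weight summable_on (ring_of_integers - {0})"
    unfolding weight_exp(1)[abs_def]
    by (rule summable_on_subset_banach[OF summable_on_cmult_right[OF Lt.summable_exp[OF two_pi_ge(1)]]]) auto
  show "weight0 summable_on (ring_of_integers - {0})"
    unfolding weight_exp(2)[abs_def]
    by (rule summable_on_subset_banach[OF summable_on_cmult_right[OF L0.summable_exp[OF two_pi_ge(1)]]]) auto
qed

lemma sum_weight0_le:
  assumes "finite X" "X \<subseteq> ring_of_integers - {0}"
  shows "sum weight0 X \<le> infsum weight0 (ring_of_integers - {0})"
  by (rule finite_sum_le_infsum[OF summable_weight(2) assms]) (simp add: weight0_def)

text \<open>For d bounded away from 0. Short vectors are those of the distorted form, and the terms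
  of the trivial divisor outside \<open>X\<close> are dropped.\<close>

lemma direct_comparison:
  assumes X: "finite X" "X \<subseteq> ring_of_integers - {0}"
    and r: "\<And>x. x \<in> Lt.short - X \<Longrightarrow> weight x \<le> r" "card (Lt.short - X) \<le> N" "r \<ge> 0"
    and less: "sum weight X + real N * r + 33 / 100000 < sum weight0 X"
  shows "infsum weight (ring_of_integers - {0}) < infsum weight0 (ring_of_integers - {0})"
proof -
  have "infsum weight (ring_of_integers - {0}) \<le> sum weight X + real N * r +
      exp (8 * pi / 2) * (exp (- 4 * (2 * pi)) * (81 + 256 * exp (- (2 * pi) / 2) + 1 / 1000))"
    by (rule Lt.infsum_le_short[OF summable_weight(1) X r two_pi_ge(1)]) (simp_all add: weight_exp)
  also have "\<dots> \<le> sum weight X + real N * r + 33 / 100000"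
    using tail_constants(2) by simp
  also note less
  also note sum_weight0_le[OF X]
  finally show ?thesis .
qed

text \<open>As \<tau> permutes the nonzero integers, the weights may be averaged over it, and the
  two sums differ by the sum of all gains. Short vectors are those of the trivial divisor, and all
  bounds are proportional to d.\<close>

lemma gain_comparison:
  assumes d: "d \<le> 3 / 100" and X: "finite X" "X \<subseteq> ring_of_integers - {0}"
    and M: "\<And>x. x \<in> L0.short - X \<Longrightarrow> gain (trace_sq x) (diff_sq x) d \<le> M * d"
      "card (L0.short - X) \<le> N" "M \<ge> 0"
    and less: "(\<Sum>x\<in>X. gain (trace_sq x) (diff_sq x) d) + (real N * M + 136 / 100) * d < 0"
  shows "infsum weight (ring_of_integers - {0}) < infsum weight0 (ring_of_integers - {0})"
proof -
  define G where "G x = gain (trace_sq x) (diff_sq x) d" for x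
  let ?O = "ring_of_integers - {0} :: 'a set"
  have bij: "bij_betw \<tau> ?O ?O"
    by (rule bij_betwI[where g = \<tau>]) (auto simp: \<tau>_integer \<tau>_simps \<tau>_\<tau>)
  have s1: "(\<lambda>x. weight (\<tau> x)) summable_on ?O"
    using summable_on_reindex_bij_betw[OF bij, of weight] summable_weight(1) by simp
  have eqs: "infsum (\<lambda>x. weight (\<tau> x)) ?O = infsum weight ?O"
    by (rule infsum_reindex_bij_betw[OF bij])
  have s2: "(\<lambda>x. (weight x + weight (\<tau> x)) / 2) summable_on ?O"
    using summable_on_cmult_left[OF summable_on_add[OF summable_weight(1) s1], of "1 / 2"] by simp
  have "infsum (\<lambda>x. (weight x + weight (\<tau> x)) * (1 / 2)) ?O = infsum (\<lambda>x. weight x + weight (\<tau> x)) ?O * (1 / 2)"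
    by (rule infsum_cmult_left') 
  also have "\<dots> = infsum weight ?O"
    using infsum_add[OF summable_weight(1) s1] eqs by simp
  finally have av: "infsum (\<lambda>x. (weight x + weight (\<tau> x)) / 2) ?O = infsum weight ?O" by simp
  have Geq: "G = (\<lambda>x. (weight x + weight (\<tau> x)) / 2 - weight0 x)"
    by (rule ext) (simp add: G_def weight_average)
  have s3: "(\<lambda>x. - weight0 x) summable_on ?O" using summable_weight(2) by (simp add: summable_on_uminus)
  have Gs: "G summable_on ?O"
    using summable_on_add[OF s2 s3] unfolding Geq by simp
  have diff: "infsum G ?O = infsum weight ?O - infsum weight0 ?O"
    using infsum_add[OF s2 s3] av unfolding Geq infsum_uminus by simp
  have "infsum G ?O \<le> sum G X + real N * (M * d) + (d * (50 / 3 * exp (2 * pi * (1715 / 1000)))) *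
      (exp (- 4 * (2 * pi * (715 / 1000))) * (81 + 256 * exp (- (2 * pi * (715 / 1000)) / 2) + 1 / 1000))"
  proof (rule L0.infsum_le_short[OF Gs X])
    show "G x \<le> M * d" if "x \<in> L0.short - X" for x using M(1)[OF that] by (simp add: G_def)
    show "G x \<le> d * (50 / 3 * exp (2 * pi * (1715 / 1000))) * exp (- (2 * pi * (715 / 1000)) * trace_sq x)"
      if x: "x \<in> ring_of_integers" "trace_sq x \<ge> 4" "x \<notin> X" for x
    proof -
      have "x \<noteq> 0" using x(2) by (auto simp: trace_sq_def sq_simps)
      then have "(diff_sq x)\<^sup>2 \<le> (trace_sq x)\<^sup>2 - 4"
        unfolding diff_sq_square using abs_norm_ge_1[OF x(1)] by simp
      from gain_tail[OF less_imp_le[OF d_pos] d x(2) _ this] show ?thesis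
        by (simp add: G_def diff_sq_def mult.assoc)
    qed
  qed (use M d_pos two_pi_ge in auto)
  also have "(d * (50 / 3 * exp (2 * pi * (1715 / 1000)))) *
      (exp (- 4 * (2 * pi * (715 / 1000))) * (81 + 256 * exp (- (2 * pi * (715 / 1000)) / 2) + 1 / 1000)) =
      d * (50 / 3 * exp (2 * pi * (1715 / 1000)) *
      (exp (- 4 * (2 * pi * (715 / 1000))) * (81 + 256 * exp (- (2 * pi * (715 / 1000)) / 2) + 1 / 1000)))"
    by (simp only: mult.assoc)
  also have "\<dots> \<le> d * (136 / 100)"
    by (intro mult_left_mono tail_constants(1)) (use d_pos in simp)
  finally have "infsum G ?O \<le> sum G X + (real N * M + 136 / 100) * d"
    by (simp add: algebra_simps)
  also have "\<dots> < 0" using less by (simp add: G_def)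
  finally show ?thesis using diff by simp
qed

end

section \<open>Small and large distortion\<close>

context distorted_integers
begin

lemma torsion_values:
  assumes "x \<in> torsion"
  shows "energy x = 2 * (1 + d)" "weight x = exp (- (4 * pi) * d)" "weight0 x = 1"
    "gain (trace_sq x) (diff_sq x) d = exp (- (4 * pi) * d) - 1"
proof -
  have x: "sq x = 1" "sq' x = 1" using assms by (simp_all add: torsion_def)
  then have tr: "trace_sq x = 2" "diff_sq x = 0" by (simp_all add: trace_sq_def diff_sq_def)
  show e: "energy x = 2 * (1 + d)" using x d_def by (simp add: energy_def)
  have "- (2 * pi) * (2 * (1 + d) - 2) = - (4 * pi) * d" by (simp add: algebra_simps)
  then show "weight x = exp (- (4 * pi) * d)" unfolding weight_def e by simp
  show "weight0 x = 1" by (simp add: weight0_def tr)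
  show "gain (trace_sq x) (diff_sq x) d = exp (- (4 * pi) * d) - 1"
    unfolding gain_def tr by (simp add: mult.assoc)
qed

lemma torsion_subset:
  "torsion \<subseteq> ring_of_integers - {0}" "torsion \<subseteq> L0.short" "torsion \<subseteq> Lt.short"
  using d_less torsion_nonzero[of 0]
  by (auto simp: L0.short_def Lt.short_def torsion_integer torsion_trace torsion_values(1))

lemma energy_inverse: "f \<in> nontorsion_units \<Longrightarrow> energy (inverse f) = energy (\<tau> f)"
  using nontorsion_unit_facts(3,4)[of f] by (simp add: energy_def sq_simps)

lemma basic_units_values:
  assumes f: "f \<in> nontorsion_units" and x: "x \<in> basic_units f"
  shows "trace_sq x = trace_sq f" "energy x = energy f \<or> energy x = energy (\<tau> f)"
proof -
  obtain t where t: "t \<in> torsion" "x = f * t \<or> x = inverse f * t" using x by (auto simp: basic_units_def)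
  have *: "sq t = 1" "sq' t = 1" using t(1) by (simp_all add: torsion_def)
  have "sq x = sq f \<and> sq' x = sq' f \<or> sq x = sq (inverse f) \<and> sq' x = sq' (inverse f)"
    using t(2) by (auto simp: sq_simps(1,2) *)
  then show "trace_sq x = trace_sq f" "energy x = energy f \<or> energy x = energy (\<tau> f)"
    using nontorsion_unit_facts(8)[OF f] energy_inverse[OF f] by (auto simp: trace_sq_def energy_def)
qed

text \<open>\<open>F\<close> is the net loss per root of unity: its own loss minus the gains of f
  and of the inverse of f.\<close>

lemma basic_units_sums:
  assumes f: "f \<in> nontorsion_units" "sq f > 1"
  defines "X \<equiv> torsion \<union> basic_units f"
    and "F \<equiv> 1 - exp (- (4 * pi) * d) - 2 * gain (trace_sq f) (diff_sq f) d"
  shows "finite X" "X \<subseteq> ring_of_integers - {0}" "card X = 3 * card torsion"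
    "(\<Sum>x\<in>X. gain (trace_sq x) (diff_sq x) d) = - (real (card torsion) * F)"
    "sum weight X = real (card torsion) * (exp (- (4 * pi) * d) + weight f + weight (\<tau> f))"
    "sum weight0 X - sum weight X = real (card torsion) * F"
    "sum weight0 X \<ge> real (card torsion)"
proof -
  note U = basic_units_facts[OF f] and N = nontorsion_unit_facts[OF f(1)]
  show "finite X" by (simp add: X_def U(2) finite_torsion)
  show "X \<subseteq> ring_of_integers - {0}"
    using torsion_subset(1) U(1) nontorsion_unit_facts(1,2) unfolding X_def by blast
  show "card X = 3 * card torsion"
    unfolding X_def using U(2,3,4) finite_torsion by (subst card_Un_disjoint) auto
  show "(\<Sum>x\<in>X. gain (trace_sq x) (diff_sq x) d) = - (real (card torsion) * F)"
  proof -
    have "(\<Sum>x\<in>X. gain (trace_sq x) (diff_sq x) d) = real (card torsion) * (gain (trace_sq 1) (diff_sq 1) d +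
        gain (trace_sq f) (diff_sq f) d + gain (trace_sq (inverse f)) (diff_sq (inverse f)) d)"
      unfolding X_def by (rule U(5)) (simp add: trace_sq_def diff_sq_def)
    then show ?thesis
      unfolding N(8,9) torsion_values(4)[OF one_torsion] F_def by (simp add: algebra_simps)
  qed
  have wi: "weight (inverse f) = weight (\<tau> f)" by (simp add: weight_def energy_inverse[OF f(1)])
  have "sum weight X = real (card torsion) * (weight 1 + weight f + weight (inverse f))"
    unfolding X_def by (rule U(5)) (simp add: weight_def energy_def)
  then show w: "sum weight X = real (card torsion) * (exp (- (4 * pi) * d) + weight f + weight (\<tau> f))"
    unfolding wi torsion_values(2)[OF one_torsion] .
  have "sum weight0 X = real (card torsion) * (weight0 1 + weight0 f + weight0 (inverse f))"
    unfolding X_def by (rule U(5)) (simp add: weight0_def trace_sq_def)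
  then have w0: "sum weight0 X = real (card torsion) * (1 + 2 * weight0 f)"
    unfolding torsion_values(3)[OF one_torsion] by (simp add: weight0_def N(8))
  have "weight f + weight (\<tau> f) = 2 * gain (trace_sq f) (diff_sq f) d + 2 * weight0 f"
    unfolding weight_average[of f, symmetric] by (simp add: field_simps)
  then have w': "sum weight X = real (card torsion) * (exp (- (4 * pi) * d) + 2 * gain (trace_sq f) (diff_sq f) d + 2 * weight0 f)"
    unfolding w by (simp only: add.assoc)
  show "sum weight0 X - sum weight X = real (card torsion) * F"
    unfolding w' w0 F_def by (simp add: algebra_simps)
  have "real (card torsion) * (1 + 2 * 0) \<le> real (card torsion) * (1 + 2 * weight0 f)"
    by (intro mult_left_mono add_left_mono) (auto simp: weight0_def)
  then show "sum weight0 X \<ge> real (card torsion)" unfolding w0 by simp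
qed

lemma other_units_trace:
  assumes f: "f \<in> nontorsion_units" "sq f > 1" "\<And>g. g \<in> nontorsion_units \<Longrightarrow> trace_sq f \<le> trace_sq g"
    and g: "g \<in> nontorsion_units" "g \<notin> basic_units f"
  shows "trace_sq g \<ge> (trace_sq f)\<^sup>2 - 2"
proof -
  note F = nontorsion_unit_facts[OF f(1)] and G = nontorsion_unit_facts[OF g(1)]
  have "1 \<le> (sq f)\<^sup>2" using f(2) by (simp add: one_le_power)
  then have "(sq f)\<^sup>2 + 1 / (sq f)\<^sup>2 \<le> sq g + 1 / sq g"
    using other_units[OF f g] G(3) by (intro add_inverse_mono) auto
  moreover have "(trace_sq f)\<^sup>2 - 2 = (sq f)\<^sup>2 + 1 / (sq f)\<^sup>2"
    unfolding F(5) using F(3) by (simp add: field_simps power2_eq_square)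
  ultimately show ?thesis using G(5) by simp
qed

lemma gain_nonunit_integer:
  assumes "x \<in> L0.short" "abs_norm x \<ge> 2" "d \<le> 3 / 100"
  shows "gain (trace_sq x) (diff_sq x) d \<le> 122 / 1000 * d"
proof (rule gain_nonunit)
  show "(diff_sq x)\<^sup>2 \<le> (trace_sq x)\<^sup>2 - 8" using assms(2) diff_sq_square[of x] by simp
  then show "8 \<le> (trace_sq x)\<^sup>2" using zero_le_power2[of "diff_sq x"] by linarith
qed (use assms d_pos L0.nonneg[of x] in \<open>auto simp: L0.short_def diff_sq_def\<close>)

text \<open>For small \<open>d\<close> both sides agree to leading order, so the sums are compared termwise, through \<^const>\<open>gain\<close>.\<close>

lemma small_distortion:
  assumes d: "d \<le> 3 / 100"
  shows "infsum weight (ring_of_integers - {0}) < infsum weight0 (ring_of_integers - {0})"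
proof (cases "\<exists>f\<in>nontorsion_units. trace_sq f < 4")
  case False
  show ?thesis
  proof (rule gain_comparison[OF d finite_torsion torsion_subset(1)])
    show "gain (trace_sq x) (diff_sq x) d \<le> 122 / 1000 * d" if x: "x \<in> L0.short - torsion" for x
      using nonunit_or_unit_cases[of x] False x gain_nonunit_integer[OF _ _ d, of x] by (auto simp: L0.short_def)
    show "card (L0.short - torsion) \<le> 28"
      using card_Diff_subset[OF finite_torsion torsion_subset(2)] L0.card_short card_torsion_ge_2 by simp
    have "(\<Sum>x\<in>torsion. gain (trace_sq x) (diff_sq x) d) = - (real (card torsion) * (1 - exp (- (4 * pi) * d)))"
      by (simp add: torsion_values(4) algebra_simps)
    moreover have "2 * (101 / 10 * d) \<le> real (card torsion) * (1 - exp (- (4 * pi) * d))"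
      using card_torsion_ge_2 torsion_loss_ge_linear(2)[of d] d d_pos by (intro mult_mono) auto
    ultimately show "(\<Sum>x\<in>torsion. gain (trace_sq x) (diff_sq x) d) + (real 28 * (122 / 1000) + 136 / 100) * d < 0"
      using d_pos by simp
  qed simp
next
  case True
  then obtain f where f: "f \<in> nontorsion_units" "sq f > 1" "\<And>g. g \<in> nontorsion_units \<Longrightarrow> trace_sq f \<le> trace_sq g"
    using minimal_unit by (metis empty_iff)
  have f4: "trace_sq f < 4" using True f(3) by force
  note F = nontorsion_unit_facts[OF f(1)] and S = basic_units_sums[OF f(1,2)]
  define X where "X = torsion \<union> basic_units f"
  have sub: "X \<subseteq> L0.short"
    using torsion_subset(2) basic_units_facts(1)[OF f(1,2)] basic_units_values(1)[OF f(1)] f4 nontorsion_unit_facts(1,2)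
    unfolding X_def L0.short_def by fastforce
  have fX: "finite X" using S(1) by (simp add: X_def)
  have card: "card (L0.short - X) \<le> 30 - 3 * card torsion"
    using card_Diff_subset[OF fX sub] S(3) L0.card_short by (simp add: X_def)
  have rest: "gain (trace_sq x) (diff_sq x) d \<le> M * d"
    if x: "x \<in> L0.short - X" and M: "M \<ge> 122 / 1000"
      and u: "x \<in> nontorsion_units \<Longrightarrow> gain (trace_sq x) (diff_sq x) d \<le> M * d" for x M
  proof -
    have "abs_norm x \<ge> 2 \<or> x \<in> nontorsion_units"
      using nonunit_or_unit_cases[of x] x by (auto simp: L0.short_def X_def)
    moreover have "122 / 1000 * d \<le> M * d" using M d_pos by (intro mult_right_mono) auto
    ultimately show ?thesis using gain_nonunit_integer[OF _ _ d, of x] u x by fastforce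
  qed
  have other: "gain (trace_sq x) (diff_sq x) d \<le> 312 / 1000 * d"
    "382 / 100 \<le> trace_sq x \<Longrightarrow> gain (trace_sq x) (diff_sq x) d \<le> 122 / 1000 * d"
    if "x \<in> L0.short" "x \<in> nontorsion_units" "33 / 10 \<le> trace_sq x" for x
    using gain_unit[OF less_imp_le[OF d_pos] d that(3), of "diff_sq x"] nontorsion_unit_facts(6)[OF that(2)] that(1)
    by (auto simp: L0.short_def diff_sq_def)
  have tr: "trace_sq x \<ge> (trace_sq f)\<^sup>2 - 2" if "x \<in> L0.short - X" "x \<in> nontorsion_units" for x
    using other_units_trace[OF f that(2)] that(1) by (simp add: X_def)
  have fu: "f \<in> ring_of_integers" "abs_norm f = 1" "sq f \<noteq> 1" using f(1) by (auto simp: nontorsion_units_def)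
  define G where "G = 1 - exp (- (4 * pi) * d) - 2 * gain (trace_sq f) (diff_sq f) d"
  have sumX: "(\<Sum>x\<in>X. gain (trace_sq x) (diff_sq x) d) = - (real (card torsion) * G)"
    using S(4) by (simp add: X_def G_def)
  have B: "diff_sq f \<ge> 0" by (simp add: diff_sq_def)
  note conclude = gain_comparison[OF d fX S(2)[folded X_def]]
  consider (tight) "(trace_sq f)\<^sup>2 - trace_sq f = 3" "\<exists>\<zeta>\<in>torsion. \<zeta> * \<zeta> = \<zeta> - 1"
    | (wide) "(trace_sq f)\<^sup>2 - 2 \<ge> 382 / 100" "G \<ge> 22 / 10 * d"
  proof -
    consider "trace_sq f \<ge> 256 / 100" | "(trace_sq f)\<^sup>2 - 2 * trace_sq f = 1"
      | "(trace_sq f)\<^sup>2 - trace_sq f = 3" "\<exists>\<zeta>\<in>torsion. \<zeta> * \<zeta> = \<zeta> - 1"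
      using minimal_trace_cases(2)[OF fu] by blast
    then show thesis
    proof cases
      case 1
      have "(256 / 100)\<^sup>2 \<le> (trace_sq f)\<^sup>2" using 1 by (intro power_mono) auto
      then have "(trace_sq f)\<^sup>2 - 2 \<ge> 382 / 100" by (simp add: power2_eq_square)
      then show ?thesis
        using wide unit_loss_large[OF 1 less_imp_le[OF f4] B F(6) less_imp_le[OF d_pos] d] by (simp add: G_def)
    next
      case 2
      have "trace_sq f \<ge> 241 / 100"
      proof (rule ccontr)
        assume "\<not> ?thesis"
        then have "(trace_sq f - 1)\<^sup>2 < (141 / 100)\<^sup>2" using minimal_trace_cases(1)[OF fu] by (intro power_strict_mono) auto
        then show False using 2 by (simp add: power2_eq_square algebra_simps)
      qed
      then have "(trace_sq f)\<^sup>2 - 2 \<ge> 382 / 100" using 2 by simp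
      then show ?thesis
        using wide unit_loss_silver(1)[OF 2 minimal_trace_cases(1)[OF fu] B F(6) less_imp_le[OF d_pos] _ d] d by (simp add: G_def)
    next
      case 3
      then show ?thesis by (rule tight)
    qed
  qed
  then show ?thesis
  proof cases
    case tight
    have c6: "card torsion \<ge> 6" using tight(2) card_torsion_ge_6[OF finite_torsion] by blast
    have A: "trace_sq f \<ge> 23 / 10"
    proof (rule ccontr)
      assume "\<not> ?thesis"
      then have "(trace_sq f - 1 / 2)\<^sup>2 < (18 / 10)\<^sup>2" using minimal_trace_cases(1)[OF fu] by (intro power_strict_mono) auto
      then show False using tight(1) by (simp add: power2_eq_square algebra_simps)
    qed
    show ?thesis
    proof (rule conclude)
      show "gain (trace_sq x) (diff_sq x) d \<le> 312 / 1000 * d" if x: "x \<in> L0.short - X" for x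
      proof (rule rest[OF x])
        assume "x \<in> nontorsion_units"
        then show "gain (trace_sq x) (diff_sq x) d \<le> 312 / 1000 * d"
          using other(1)[of x] tr[OF x] x tight(1) A by simp
      qed simp
      show "card (L0.short - X) \<le> 12" using card c6 by simp
      \<comment> \<open>6 * 0.87 = 5.22 against 12 * 0.312 + 1.36 = 5.104.\<close>
      have "6 * (87 / 100 * d) \<le> real (card torsion) * G"
        using c6 unit_loss_tight(2)[OF tight(1) minimal_trace_cases(1)[OF fu] B F(6) less_imp_le[OF d_pos] _ d] d d_pos
        by (intro mult_mono) (auto simp: G_def)
      then show "(\<Sum>x\<in>X. gain (trace_sq x) (diff_sq x) d) + (real 12 * (312 / 1000) + 136 / 100) * d < 0"
        unfolding sumX using d_pos by simp
    qed simp
  next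
    case wide
    show ?thesis
    proof (rule conclude)
      show "gain (trace_sq x) (diff_sq x) d \<le> 122 / 1000 * d" if x: "x \<in> L0.short - X" for x
      proof (rule rest[OF x])
        assume "x \<in> nontorsion_units"
        then show "gain (trace_sq x) (diff_sq x) d \<le> 122 / 1000 * d"
          using other(2)[of x] tr[OF x] x wide(1) by simp
      qed simp
      show "card (L0.short - X) \<le> 24" using card card_torsion_ge_2 by simp
      \<comment> \<open>2 * 2.2 = 4.4 against 24 * 0.122 + 1.36 = 4.288.\<close>
      have "2 * (22 / 10 * d) \<le> real (card torsion) * G"
        using card_torsion_ge_2 wide(2) d_pos by (intro mult_mono) auto
      then show "(\<Sum>x\<in>X. gain (trace_sq x) (diff_sq x) d) + (real 24 * (122 / 1000) + 136 / 100) * d < 0"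
        unfolding sumX using d_pos by simp
    qed simp
  qed
qed

lemma weight_le:
  assumes "energy x \<ge> 2 + c" "exp (- (2 * pi) * c) \<le> r" shows "weight x \<le> r"
proof -
  have "weight x \<le> exp (- (2 * pi) * c)" unfolding weight_def using assms(1) by (simp add: mult_left_mono_neg)
  then show ?thesis using assms(2) by linarith
qed

lemma energy_nonunit:
  assumes "abs_norm x \<ge> 2" shows "energy x \<ge> 28284 / 10000"
  unfolding energy_def
proof (rule add_ge_of_mult_ge)
  have "(p * sq x) * (1 / p * sq' x) = abs_norm x" using p(1) by (simp add: abs_norm_sq)
  then show "((28284 / 10000) / 2)\<^sup>2 \<le> (p * sq x) * (1 / p * sq' x)" using assms by (simp add: power2_eq_square)
qed (use p(1) sq_simps(13,14)[of x] in auto)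

text \<open>Minimality of 1 against \<open>f\<close> and its inverse confines \<open>p\<^sup>2\<close> to the interval from \<open>1/|\<sigma> f|\<^sup>2\<close> to \<open>|\<sigma> f|\<^sup>2\<close>,
  which keeps the square and higher powers of \<open>f\<close> away from the minimum.\<close>

lemma other_units_energy:
  assumes f: "f \<in> nontorsion_units" "sq f > 1" "\<And>g. g \<in> nontorsion_units \<Longrightarrow> trace_sq f \<le> trace_sq g"
    and g: "g \<in> nontorsion_units" "g \<notin> basic_units f"
  shows "(energy g)\<^sup>2 \<ge> trace_sq f ^ 3 - 3 * trace_sq f + 2"
proof -
  note F = nontorsion_unit_facts[OF f(1)] and G = nontorsion_unit_facts[OF g(1)]
  define a where "a = sq f"
  have a: "a > 1" using f(2) by (simp add: a_def)
  then have a0: "0 < a" by simp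
  have F': "inverse f \<in> ring_of_integers" "inverse f \<noteq> 0"
    using nontorsion_unit_facts(1)[OF F(7)] F(2) by auto
  have "p + 1 / p \<le> p * a + 1 / (p * a)"
    using shortest[OF F(1,2)] unfolding F(4) a_def by simp
  moreover have "p * a + 1 / (p * a) - (p + 1 / p) = (a - 1) * (p\<^sup>2 * a - 1) / (p * a)"
    using p(1) a by (simp add: field_simps power2_eq_square)
  ultimately have "0 \<le> (a - 1) * (p\<^sup>2 * a - 1) / (p * a)" by linarith
  then have lo: "1 \<le> p\<^sup>2 * a"
    using a p(1) mult_pos_pos[OF p(1) a0] by (auto simp: zero_le_divide_iff zero_le_mult_iff)
  have "p + 1 / p \<le> p / a + a / p"
    using shortest[OF F'] unfolding sq_simps F(4) a_def by simp
  moreover have "p / a + a / p - (p + 1 / p) = (a - 1) * (a - p\<^sup>2) / (p * a)"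
    using p(1) a by (simp add: field_simps power2_eq_square)
  ultimately have "0 \<le> (a - 1) * (a - p\<^sup>2) / (p * a)" by linarith
  then have hi: "p\<^sup>2 \<le> a"
    using a p(1) mult_pos_pos[OF p(1) a0] by (auto simp: zero_le_divide_iff zero_le_mult_iff)
  define z where "z = p * sq g"
  have z: "z > 0" using p(1) G(3) by (simp add: z_def)
  have e: "energy g = z + 1 / z" unfolding energy_def z_def G(4) by simp
  have "a ^ 3 \<le> z\<^sup>2 \<or> (0 < z\<^sup>2 \<and> z\<^sup>2 \<le> 1 / a ^ 3)"
  proof (cases "sq g \<ge> a\<^sup>2")
    case True
    have "1 * a ^ 3 \<le> (p\<^sup>2 * a) * a ^ 3" using lo a by (intro mult_right_mono) auto
    also have "\<dots> = (p * a\<^sup>2)\<^sup>2" by (simp add: power2_eq_square power3_eq_cube)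
    also have "\<dots> \<le> z\<^sup>2" unfolding z_def using True p(1) by (intro power_mono mult_left_mono) auto
    finally show ?thesis by simp
  next
    case False
    then have "sq g \<le> 1 / a\<^sup>2" using other_units[OF f g] by (simp add: a_def)
    then have "z\<^sup>2 \<le> (p * (1 / a\<^sup>2))\<^sup>2" unfolding z_def using p(1) G(3) by (intro power_mono mult_left_mono) auto
    also have "\<dots> = p\<^sup>2 * (1 / a ^ 4)" by (simp add: power_mult_distrib power_divide power_mult[symmetric])
    also have "\<dots> \<le> a * (1 / a ^ 4)" using hi a by (intro mult_right_mono) auto
    also have "\<dots> = 1 / a ^ 3" using a by (simp add: eval_nat_numeral)
    finally show ?thesis using z by simp
  qed
  then have "a ^ 3 + 1 / a ^ 3 \<le> z\<^sup>2 + 1 / z\<^sup>2" using a by (intro add_inverse_mono) (auto simp: one_le_power)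
  also have "\<dots> = (energy g)\<^sup>2 - 2" unfolding e using z by (simp add: field_simps power2_eq_square)
  also have "a ^ 3 + 1 / a ^ 3 = trace_sq f ^ 3 - 3 * trace_sq f"
    unfolding F(5) a_def[symmetric] using a by (simp add: field_simps power3_eq_cube)
  finally show ?thesis by simp
qed

text \<open>The net loss now exceeds a fixed amount, which must pay for all weights outside
  \<open>X\<close>. For the two smallest traces the bound on d makes the basic units short, so only
  30 - 3 \<open>card torsion\<close> of the short vectors remain unknown.\<close>

lemma large_distortion:
  assumes d: "d \<ge> 3 / 100"
  shows "infsum weight (ring_of_integers - {0}) < infsum weight0 (ring_of_integers - {0})"
proof (cases "nontorsion_units = {}")
  case True
  show ?thesis
  proof (rule direct_comparison[OF finite_torsion torsion_subset(1)])
    show "weight x \<le> 55 / 10000" if x: "x \<in> Lt.short - torsion" for x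
    proof (rule weight_le[OF _ exp_constants(2)])
      have "abs_norm x \<ge> 2" using nonunit_or_unit_cases[of x] True x by (auto simp: Lt.short_def)
      then show "2 + 8284 / 10000 \<le> energy x" using energy_nonunit[of x] by simp
    qed
    show "card (Lt.short - torsion) \<le> 28"
      using card_Diff_subset[OF finite_torsion torsion_subset(3)] Lt.card_short card_torsion_ge_2 by simp
    have "exp (- (4 * pi) * d) \<le> exp (- (4 * pi) * (3 / 100))" using d by simp
    also have "\<dots> \<le> 697 / 1000" using torsion_loss_ge_linear(2)[of "3 / 100"] by simp
    finally have "2 * (303 / 1000) \<le> real (card torsion) * (1 - exp (- (4 * pi) * d))"
      using card_torsion_ge_2 by (intro mult_mono) auto
    moreover have "sum weight torsion = real (card torsion) * exp (- (4 * pi) * d)" "sum weight0 torsion = real (card torsion)"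
      by (simp_all add: torsion_values)
    ultimately show "sum weight torsion + real 28 * (55 / 10000) + 33 / 100000 < sum weight0 torsion"
      by (simp add: right_diff_distrib)
  qed simp
next
  case False
  then obtain f where f: "f \<in> nontorsion_units" "sq f > 1" "\<And>g. g \<in> nontorsion_units \<Longrightarrow> trace_sq f \<le> trace_sq g"
    using minimal_unit by metis
  note F = nontorsion_unit_facts[OF f(1)] and S = basic_units_sums[OF f(1,2)]
  have fu: "f \<in> ring_of_integers" "abs_norm f = 1" "sq f \<noteq> 1" using f(1) by (auto simp: nontorsion_units_def)
  define A where "A = trace_sq f"
  define B where "B = diff_sq f"
  define X where "X = torsion \<union> basic_units f"
  note S' = S[folded X_def]
  have A2: "A > 2" using minimal_trace_cases(1)[OF fu] by (simp add: A_def)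
  have B: "B \<ge> 0" "B\<^sup>2 = A\<^sup>2 - 4" using F(6) by (simp_all add: A_def B_def diff_sq_def)
  have \<tau>f: "\<tau> f \<in> ring_of_integers" "\<tau> f \<noteq> 0" using F(1,2) by (simp_all add: \<tau>_integer \<tau>_simps)
  have "energy f \<ge> 2 * (1 + d)" "energy (\<tau> f) \<ge> 2 * (1 + d)"
    using shortest[OF F(1,2)] shortest[OF \<tau>f] d_def by (simp_all add: energy_def)
  then have low: "2 * (1 + d) \<le> A * (1 + d) - B * s"
    using energy_cases[of f] by (auto simp: A_def B_def)
  \<comment> \<open>Squaring B s \<le> (A - 2) (1 + d) and cancelling A - 2. Equality occurs when f
    or \<tau> f is as short as 1.\<close>
  have c: "4 * (1 + d)\<^sup>2 \<le> A + 2"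
  proof -
    have "B * s \<le> (A - 2) * (1 + d)" using low by (simp add: algebra_simps)
    then have "(B * s)\<^sup>2 \<le> ((A - 2) * (1 + d))\<^sup>2" using B(1) s(1) by (intro power_mono) auto
    then have "(A - 2) * ((A + 2) * ((1 + d)\<^sup>2 - 1)) \<le> (A - 2) * ((A - 2) * (1 + d)\<^sup>2)"
      unfolding power_mult_distrib B(2) s(2) by (simp add: power2_eq_square algebra_simps)
    then have "(A + 2) * ((1 + d)\<^sup>2 - 1) \<le> (A - 2) * (1 + d)\<^sup>2"
      using A2 by (simp add: mult_le_cancel_left)
    then show ?thesis by (simp add: algebra_simps)
  qed
  have high: "energy x \<le> A * (1 + d) + B * s" if "x \<in> basic_units f" for x
  proof -
    have "B * s \<ge> 0" using B(1) s(1) by simp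
    then show ?thesis
      using basic_units_values(2)[OF f(1) that] energy_cases[of f] unfolding A_def[symmetric] B_def[symmetric] by auto
  qed
  have rest: "weight x \<le> r"
    if x: "x \<in> Lt.short - X" and r: "exp (- (2 * pi) * (8284 / 10000)) \<le> r" "exp (- (2 * pi) * e) \<le> r"
      and e: "(2 + e)\<^sup>2 \<le> A ^ 3 - 3 * A + 2" for x r e
  proof -
    have "abs_norm x \<ge> 2 \<or> x \<in> nontorsion_units"
      using nonunit_or_unit_cases[of x] x by (auto simp: Lt.short_def X_def)
    then show ?thesis
    proof
      assume "abs_norm x \<ge> 2"
      then show ?thesis using energy_nonunit[of x] by (intro weight_le[OF _ r(1)]) simp
    next
      assume "x \<in> nontorsion_units"
      then have "A ^ 3 - 3 * A + 2 \<le> (energy x)\<^sup>2"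
        using other_units_energy[OF f, of x] x by (auto simp: A_def X_def)
      then have "2 + e \<le> energy x" using e Lt.nonneg[of x] by (intro power2_le_imp_le[of "2 + e"]) auto
      then show ?thesis by (rule weight_le[OF _ r(2)])
    qed
  qed
  have subset: "X \<subseteq> Lt.short" if "A * (1 + d) + B * s < 4"
  proof
    fix x assume "x \<in> X"
    then show "x \<in> Lt.short"
    proof (cases "x \<in> torsion")
      case False
      then have x: "x \<in> basic_units f" using \<open>x \<in> X\<close> by (simp add: X_def)
      then have "x \<in> nontorsion_units" using basic_units_facts(1)[OF f(1,2)] by blast
      then show ?thesis using high[OF x] that nontorsion_unit_facts(1,2)[of x] by (simp add: Lt.short_def)
    qed (use torsion_subset(3) in blast)
  qed
  have card: "card (Lt.short - X) \<le> 30 - 3 * card torsion" if "A * (1 + d) + B * s < 4"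
    using card_Diff_subset[OF S'(1) subset[OF that]] S'(3) Lt.card_short by simp
  have wide: "(2 + 8284 / 10000)\<^sup>2 \<le> A ^ 3 - 3 * A + 2" if "A \<ge> 24 / 10"
  proof -
    have "(14 / 10)\<^sup>2 * (44 / 10) \<le> (A - 1)\<^sup>2 * (A + 2)" using that by (intro mult_mono power_mono) auto
    also have "\<dots> = A ^ 3 - 3 * A + 2" by (simp add: power2_eq_square power3_eq_cube algebra_simps)
    finally show ?thesis by (simp add: power2_eq_square)
  qed
  consider (large) "A \<ge> 256 / 100" | (silver) "A\<^sup>2 - 2 * A = 1"
    | (tight) "A\<^sup>2 - A = 3" "\<exists>\<zeta>\<in>torsion. \<zeta> * \<zeta> = \<zeta> - 1"
    using minimal_trace_cases(2)[OF fu] unfolding A_def by blast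
  then show ?thesis
  proof cases
    case large
    show ?thesis
    proof (rule direct_comparison[OF S'(1,2)])
      show "weight x \<le> 55 / 10000" if "x \<in> Lt.short - X" for x
        by (rule rest[OF that exp_constants(2) exp_constants(2) wide]) (use large in simp)
      \<comment> \<open>Here d may be so large that the basic units are not short, so only the
        torsion is subtracted from 30.\<close>
      have "card (Lt.short - X) \<le> card (Lt.short - torsion)"
        by (intro card_mono finite_Diff Lt.finite_short) (auto simp: X_def)
      then show "card (Lt.short - X) \<le> 28"
        using card_Diff_subset[OF finite_torsion torsion_subset(3)] Lt.card_short card_torsion_ge_2 by simp
      have "exp (- (4 * pi) * d) + weight f + weight (\<tau> f) \<le> 9225 / 10000"
        using two_units_bound[OF large B d s(1,2) low] energy_cases[of f]
        unfolding weight_def A_def[symmetric] B_def[symmetric] by auto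
      then have "2 * (775 / 10000) \<le> real (card torsion) * (1 - (exp (- (4 * pi) * d) + weight f + weight (\<tau> f)))"
        using card_torsion_ge_2 by (intro mult_mono) auto
      also have "\<dots> = real (card torsion) - sum weight X" unfolding S'(5) by (simp only: right_diff_distrib mult_1_right)
      finally show "sum weight X + real 28 * (55 / 10000) + 33 / 100000 < sum weight0 X"
        using S'(7) by simp
    qed simp
  next
    case silver
    have Alo: "A \<ge> 24 / 10"
    proof (rule ccontr)
      assume "\<not> ?thesis"
      then have "(A - 1)\<^sup>2 < (14 / 10)\<^sup>2" using A2 by (intro power_strict_mono) auto
      then show False using silver by (simp add: power2_eq_square algebra_simps)
    qed
    have Ahi: "A \<le> 241422 / 100000"
    proof (rule ccontr)
      assume "\<not> ?thesis"
      then have "(141422 / 100000)\<^sup>2 < (A - 1)\<^sup>2" by (intro power_strict_mono) auto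
      then show False using silver by (simp add: power2_eq_square algebra_simps)
    qed
    have dhi: "d \<le> 506 / 10000"
    proof (rule ccontr)
      assume "\<not> ?thesis"
      then have "(10506 / 10000)\<^sup>2 < (1 + d)\<^sup>2" by (intro power_strict_mono) auto
      then show False using c Ahi by (simp add: power2_eq_square)
    qed
    have "B \<le> 14 / 10" by (rule power2_le_imp_le) (use B(2) silver Ahi in \<open>simp_all add: power2_eq_square\<close>)
    moreover have "s\<^sup>2 \<le> (33 / 100)\<^sup>2"
      using mult_mono[OF dhi dhi] d_pos dhi unfolding s(2) by (simp add: power2_eq_square)
    then have "s \<le> 33 / 100" by (rule power2_le_imp_le) simp
    ultimately have "B * s \<le> 14 / 10 * (33 / 100)" using B(1) s(1) by (intro mult_mono) auto
    moreover have "A * (1 + d) \<le> 241422 / 100000 * (10506 / 10000)" using Ahi dhi A2 d_pos by (intro mult_mono) auto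
    ultimately have sub: "A * (1 + d) + B * s < 4" by simp
    show ?thesis
    proof (rule direct_comparison[OF S'(1,2)])
      show "weight x \<le> 55 / 10000" if "x \<in> Lt.short - X" for x
        by (rule rest[OF that exp_constants(2) exp_constants(2) wide[OF Alo]])
      show "card (Lt.short - X) \<le> 24" using card[OF sub] card_torsion_ge_2 by simp
      \<comment> \<open>0.133 against 24 * 0.0055 + 0.00033 = 0.13233.\<close>
      have "2 * (665 / 10000) \<le> real (card torsion) * (1 - exp (- (4 * pi) * d) - 2 * gain A B d)"
        using card_torsion_ge_2 unit_loss_silver(2)[OF silver A2 B less_imp_le[OF d_pos] dhi d] by (intro mult_mono) auto
      then show "sum weight X + real 24 * (55 / 10000) + 33 / 100000 < sum weight0 X"
        using S'(6) by (simp add: A_def B_def)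
    qed simp
  next
    case tight
    have c6: "card torsion \<ge> 6" using tight(2) card_torsion_ge_6[OF finite_torsion] by blast
    have Alo: "A \<ge> 229 / 100"
    proof (rule ccontr)
      assume "\<not> ?thesis"
      then have "(A - 1 / 2)\<^sup>2 < (179 / 100)\<^sup>2" using A2 by (intro power_strict_mono) auto
      then show False using tight(1) by (simp add: power2_eq_square algebra_simps)
    qed
    have Ahi: "A \<le> 230278 / 100000"
    proof (rule ccontr)
      assume "\<not> ?thesis"
      then have "(180278 / 100000)\<^sup>2 < (A - 1 / 2)\<^sup>2" by (intro power_strict_mono) auto
      then show False using tight(1) by (simp add: power2_eq_square algebra_simps)
    qed
    have dhi: "d \<le> 372 / 10000"
    proof (rule ccontr)
      assume "\<not> ?thesis"
      then have "(10372 / 10000)\<^sup>2 < (1 + d)\<^sup>2" by (intro power_strict_mono) auto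
      then show False using c Ahi by (simp add: power2_eq_square)
    qed
    have "B \<le> 12 / 10" by (rule power2_le_imp_le) (use B(2) tight(1) Ahi in \<open>simp_all add: power2_eq_square\<close>)
    moreover have "s\<^sup>2 \<le> (33 / 100)\<^sup>2"
      using mult_mono[OF dhi dhi] d_pos dhi unfolding s(2) by (simp add: power2_eq_square)
    then have "s \<le> 33 / 100" by (rule power2_le_imp_le) simp
    ultimately have "B * s \<le> 12 / 10 * (33 / 100)" using B(1) s(1) by (intro mult_mono) auto
    moreover have "A * (1 + d) \<le> 230278 / 100000 * (10372 / 10000)" using Ahi dhi A2 d_pos by (intro mult_mono) auto
    ultimately have sub: "A * (1 + d) + B * s < 4" by simp
    have cube: "A ^ 3 - 3 * A + 2 = A + 5"
    proof -
      have "A ^ 3 = A * (A\<^sup>2)" by (simp add: power2_eq_square power3_eq_cube)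
      also have "\<dots> = A\<^sup>2 + 3 * A" using tight(1) by (simp add: algebra_simps power2_eq_square)
      finally show ?thesis using tight(1) by simp
    qed
    show ?thesis
    proof (rule direct_comparison[OF S'(1,2)])
      \<comment> \<open>The bound rests on (2 + 7/10)^2 = 7.29 \<le> A + 5.\<close>
      show "weight x \<le> 1231 / 100000" if "x \<in> Lt.short - X" for x
        by (rule rest[OF that _ exp_constants(3)])
          (use exp_constants(2) Alo cube in \<open>simp_all add: power2_eq_square\<close>)
      show "card (Lt.short - X) \<le> 12" using card[OF sub] c6 by simp
      \<comment> \<open>At d = 3/100: 0.1494 against 12 * 0.01231 + 0.00033 = 0.14805.\<close>
      have "6 * (83 / 100 * d) \<le> real (card torsion) * (1 - exp (- (4 * pi) * d) - 2 * gain A B d)"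
        using c6 unit_loss_tight(1)[OF tight(1) A2 B less_imp_le[OF d_pos] dhi] d_pos by (intro mult_mono) auto
      then show "sum weight X + real 12 * (1231 / 100000) + 33 / 100000 < sum weight0 X"
        using S'(6) d by (simp add: A_def B_def)
    qed simp
  qed
qed

end

section \<open>From divisors to the distorted ring of integers\<close>

context quadratic_over_imaginary_quadratic
begin

definition nonzero_theta :: "'a set \<Rightarrow> real \<Rightarrow> real \<Rightarrow> real" where
  "nonzero_theta I p q = (\<Sum>\<^sub>\<infinity>x\<in>I - {0}. exp (- (2 * pi) * (p * sq x + q * sq' x - 2)))"

lemma nonzero_theta_summable:
  assumes I: "fractional_ideal I" and pq: "p > 0" "q > 0" "p * q * ideal_norm I = 1"
  shows "(\<lambda>x. exp (- (2 * pi) * (p * sq x + q * sq' x - 2))) summable_on (I - {0})"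
    "(\<lambda>x. exp (- (2 * pi) * (p * sq x + q * sq' x))) summable_on I"
proof -
  interpret quadratic_lattice I "\<lambda>x. p * sq x + q * sq' x" by (rule ideal_lattice[OF I pq])
  show s: "(\<lambda>x. exp (- (2 * pi) * (p * sq x + q * sq' x))) summable_on I"
    using pi_bounds by (intro summable_exp) simp
  have "(\<lambda>x. exp (- (2 * pi) * (p * sq x + q * sq' x - 2))) =
      (\<lambda>x. exp (4 * pi) * exp (- (2 * pi) * (p * sq x + q * sq' x)))"
    unfolding exp_add[symmetric] by (simp add: algebra_simps)
  then show "(\<lambda>x. exp (- (2 * pi) * (p * sq x + q * sq' x - 2))) summable_on (I - {0})"
    using summable_on_subset_banach[OF summable_on_cmult_right[OF s, of "exp (4 * pi)"], of "I - {0}"] by simp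
qed

lemma k0_eq_nonzero_theta:
  assumes I: "fractional_ideal I" and u: "u1 > 0" "u2 > 0" "u1\<^sup>2 * u2\<^sup>2 * ideal_norm I = 1"
  shows "k0 \<sigma> \<sigma>' (I, u1, u2) = 1 + exp (- (4 * pi)) * nonzero_theta I (u1\<^sup>2) (u2\<^sup>2)"
proof -
  define g where "g x = exp (- (2 * pi) * (u1\<^sup>2 * sq x + u2\<^sup>2 * sq' x))" for x
  have pos: "u1\<^sup>2 > 0" "u2\<^sup>2 > 0" using u by simp_all
  have summ: "g summable_on I"
    unfolding g_def[abs_def] by (rule nonzero_theta_summable(2)[OF I pos u(3)])
  have "exp (- pi * (divisor_norm \<sigma> \<sigma>' (I, u1, u2) x)\<^sup>2) = g x" for x
  proof -
    have "(divisor_norm \<sigma> \<sigma>' (I, u1, u2) x)\<^sup>2 = 2 * (u1\<^sup>2 * sq x + u2\<^sup>2 * sq' x)"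
      by (simp add: FR_norm_def sq_def sq'_def norm_mult power_mult_distrib)
    then show ?thesis unfolding g_def by (simp only: mult.assoc mult_minus_left mult.left_commute[of pi])
  qed
  then have "k0 \<sigma> \<sigma>' (I, u1, u2) = infsum g I"
    unfolding k0_def fst_conv by presburger
  also have "infsum g I = g 0 + infsum g (I - {0})"
  proof -
    have "insert 0 (I - {0}) = I" using I by (auto simp: fractional_ideal_def)
    then show ?thesis
      using infsum_insert[of g "I - {0}" 0] summable_on_subset_banach[OF summ, of "I - {0}"] by simp
  qed
  also have "g 0 = 1" by (simp add: g_def sq_simps)
  also have "infsum g (I - {0}) = exp (- (4 * pi)) * nonzero_theta I (u1\<^sup>2) (u2\<^sup>2)"
    unfolding nonzero_theta_def infsum_cmult_right'[symmetric]
  proof (rule infsum_cong)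
    show "g x = exp (- (4 * pi)) * exp (- (2 * pi) * (u1\<^sup>2 * sq x + u2\<^sup>2 * sq' x - 2))" for x
      unfolding exp_add[symmetric] g_def by (rule arg_cong[of _ _ exp]) (simp add: algebra_simps)
  qed
  finally show ?thesis .
qed

lemma nonzero_theta_trivial_ge: "nonzero_theta ring_of_integers 1 1 \<ge> 2"
proof -
  have "sum (\<lambda>x. exp (- (2 * pi) * (1 * sq x + 1 * sq' x - 2))) {1, - 1} \<le> nonzero_theta ring_of_integers 1 1"
    unfolding nonzero_theta_def
    by (rule finite_sum_le_infsum[OF nonzero_theta_summable(1)])
      (auto simp: fractional_ideal_ring_of_integers ideal_norm_ring_of_integers ring_of_integers_closed(4,6))
  then show ?thesis by (simp add: sq_simps)
qed

text \<open>30 * 0.044 and the tail stay below 2, which 1 and -1 alone contribute for the trivial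
  divisor.\<close>

lemma nonzero_theta_sparse:
  assumes I: "fractional_ideal I" and pq: "p > 0" "q > 0" "p * q * ideal_norm I = 1"
    and sparse: "\<And>x. x \<in> I \<Longrightarrow> x \<noteq> 0 \<Longrightarrow> p * sq x + q * sq' x \<ge> 5 / 2"
  shows "nonzero_theta I p q < nonzero_theta ring_of_integers 1 1"
proof -
  interpret quadratic_lattice I "\<lambda>x. p * sq x + q * sq' x" by (rule ideal_lattice[OF I pq])
  have "nonzero_theta I p q \<le> sum (\<lambda>x. exp (- (2 * pi) * (p * sq x + q * sq' x - 2))) {} + real 30 * (44 / 1000) +
      exp (8 * pi / 2) * (exp (- 4 * (2 * pi)) * (81 + 256 * exp (- (2 * pi) / 2) + 1 / 1000))"
    unfolding nonzero_theta_def
  proof (rule infsum_le_short[OF nonzero_theta_summable(1)[OF I pq]])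
    show "exp (- (2 * pi) * (p * sq x + q * sq' x - 2)) \<le> 44 / 1000" if "x \<in> short - {}" for x
    proof -
      have "exp (- (2 * pi) * (p * sq x + q * sq' x - 2)) \<le> exp (- (2 * pi) * (1 / 2))"
        using sparse[of x] that by (simp add: short_def mult_left_mono_neg)
      then show ?thesis using exp_constants(1) by linarith
    qed
    show "card (short - {}) \<le> 30" using card_short by simp
    show "exp (- (2 * pi) * (p * sq x + q * sq' x - 2)) \<le> exp (8 * pi / 2) * exp (- (2 * pi) * (p * sq x + q * sq' x))" for x
      unfolding exp_add[symmetric] by (simp add: algebra_simps)
  qed (use pi_bounds in auto)
  also have "\<dots> < 2" using tail_constants(2) by simp
  finally show ?thesis using nonzero_theta_trivial_ge by linarith
qed

lemma nonzero_theta_distorted: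
  assumes p: "p > 0" "p \<noteq> 1" "p + 1 / p < 5 / 2"
    and shortest: "\<And>x. x \<in> ring_of_integers \<Longrightarrow> x \<noteq> 0 \<Longrightarrow> p + 1 / p \<le> p * sq x + 1 / p * sq' x"
  shows "nonzero_theta ring_of_integers p (1 / p) < nonzero_theta ring_of_integers 1 1"
proof -
  interpret distorted_integers \<iota> \<sigma> \<sigma>' \<tau> p "(p + 1 / p) / 2 - 1"
    by unfold_locales (use assms in auto)
  have "infsum weight (ring_of_integers - {0}) < infsum weight0 (ring_of_integers - {0})"
    using small_distortion large_distortion by linarith
  then show ?thesis
    by (simp add: nonzero_theta_def weight_def[abs_def] weight0_def[abs_def] energy_def trace_sq_def)
qed

lemma trivial_divisor_carrier: "(trivial_divisor :: 'a divisor) \<in> carrier arakelov_divisors0"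
  by (simp add: trivial_divisor_def arakelov_divisors0_def arakelov_divisors_def
      fractional_ideal_ring_of_integers ideal_norm_ring_of_integers)

lemma divisor_class_shift:
  assumes D: "(I, u1, u2) \<in> carrier arakelov_divisors0" and f: "f \<noteq> 0"
    and D': "((*) (inverse f) ` I, cmod (\<sigma> f) * u1, cmod (\<sigma>' f) * u2) \<in> carrier arakelov_divisors0"
  shows "divisor_class \<sigma> \<sigma>' ((*) (inverse f) ` I, cmod (\<sigma> f) * u1, cmod (\<sigma>' f) * u2) =
    divisor_class \<sigma> \<sigma>' (I, u1, u2)"
proof -
  define shift where "shift g = ((*) (inverse g) ` I, cmod (\<sigma> g) * u1, cmod (\<sigma>' g) * u2)" for g
  have "(*) f ` {g. g \<noteq> 0} = {g. g \<noteq> 0}"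
  proof (intro equalityI subsetI)
    fix g assume "g \<in> {g :: 'a. g \<noteq> 0}"
    then show "g \<in> (*) f ` {g. g \<noteq> 0}" using f by (intro image_eqI[of _ _ "inverse f * g"]) auto
  qed (use f in auto)
  moreover have "((*) (inverse g) ` (*) (inverse f) ` I, cmod (\<sigma> g) * (cmod (\<sigma> f) * u1), cmod (\<sigma>' g) * (cmod (\<sigma>' f) * u2)) =
      shift (f * g)" for g
    by (simp add: shift_def image_image \<sigma>_simps \<sigma>'_simps norm_mult mult_ac)
  ultimately show ?thesis
    unfolding divisor_class_eq[OF D] divisor_class_eq[OF D'] unfolding shift_def[symmetric]
    by (metis (no_types, lifting) image_cong image_image)
qed

theorem h0_less_trivial:
  assumes D: "D \<in> carrier arakelov_divisors0"
    and ne: "divisor_class \<sigma> \<sigma>' D \<noteq> divisor_class \<sigma> \<sigma>' trivial_divisor"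
  shows "h0 \<sigma> \<sigma>' D < h0 \<sigma> \<sigma>' trivial_divisor"
proof -
  obtain I u1 u2 where DI: "D = (I, u1, u2)" by (cases D) auto
  have I: "fractional_ideal I" and u: "u1 > 0" "u2 > 0" and ln0: "ln (u1\<^sup>2 * u2\<^sup>2 * ideal_norm I) = 0"
    using D by (simp_all add: DI arakelov_divisors0_def arakelov_divisors_def)
  \<comment> \<open>Positivity of the ideal norm lets the vanishing logarithm force its argument to
    be 1.\<close>
  have "u1\<^sup>2 * u2\<^sup>2 * ideal_norm I > 0" using u ideal_norm_pos[OF I] by simp
  then have pq: "u1\<^sup>2 * u2\<^sup>2 * ideal_norm I = 1" using ln0 by simp
  have pos: "u1\<^sup>2 > 0" "u2\<^sup>2 > 0" using u by simp_all
  have h0_less: "h0 \<sigma> \<sigma>' (J, v1, v2) < h0 \<sigma> \<sigma>' trivial_divisor"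
    if J: "fractional_ideal J" "v1 > 0" "v2 > 0" "v1\<^sup>2 * v2\<^sup>2 * ideal_norm J = 1"
      and less: "nonzero_theta J (v1\<^sup>2) (v2\<^sup>2) < nonzero_theta ring_of_integers 1 1" for J v1 v2
  proof -
    have triv: "k0 \<sigma> \<sigma>' trivial_divisor = 1 + exp (- (4 * pi)) * nonzero_theta ring_of_integers 1 1"
      using k0_eq_nonzero_theta[OF fractional_ideal_ring_of_integers, of 1 1]
      by (simp add: trivial_divisor_def ideal_norm_ring_of_integers)
    have "nonzero_theta J (v1\<^sup>2) (v2\<^sup>2) \<ge> 0" unfolding nonzero_theta_def by (intro infsum_nonneg) simp
    then have "k0 \<sigma> \<sigma>' (J, v1, v2) > 0"
      unfolding k0_eq_nonzero_theta[OF J] by (intro add_pos_nonneg) auto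
    moreover have "k0 \<sigma> \<sigma>' (J, v1, v2) < k0 \<sigma> \<sigma>' trivial_divisor"
      unfolding k0_eq_nonzero_theta[OF J] triv using less by simp
    ultimately show ?thesis unfolding h0_def by simp
  qed
  define Q where "Q x = u1\<^sup>2 * sq x + u2\<^sup>2 * sq' x" for x
  show ?thesis
  proof (cases "\<forall>x\<in>I. x \<noteq> 0 \<longrightarrow> Q x \<ge> 5 / 2")
    case True
    then show ?thesis
      unfolding DI by (intro h0_less I u pq nonzero_theta_sparse[OF I pos pq]) (auto simp: Q_def)
  next
    case False
    interpret quadratic_lattice I Q
      unfolding Q_def[abs_def] by (rule ideal_lattice[OF I pos pq])
    define S where "S = {x \<in> I. x \<noteq> 0 \<and> Q x < 5 / 2}"
    have "finite S" "S \<noteq> {}"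
      using card_ball(1)[of 3] False by (auto simp: S_def elim!: finite_subset[rotated])
    then obtain f where "f \<in> S" and minS: "\<forall>g\<in>S. Q f \<le> Q g"
      using arg_min_if_finite[of S Q] by (metis not_le)
    then have f: "f \<in> I" "f \<noteq> 0" "Q f < 5 / 2" by (auto simp: S_def)
    have min: "Q f \<le> Q g" if "g \<in> I" "g \<noteq> 0" for g
      using minS that f(3) by (cases "Q g < 5 / 2") (auto simp: S_def)
    define p where "p = u1\<^sup>2 * sq f"
    define n where "n = coset_index I ((*) f ` ring_of_integers)"
    have prod: "p * (u2\<^sup>2 * sq' f) = real n" and n1: "n \<ge> 1"
      using ideal_index_eq[OF I pq f(1,2)] unfolding p_def n_def by simp_all
    have p0: "p > 0" using pos sq_pos[OF f(2)] by (simp add: p_def)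
    \<comment> \<open>Index at least 2 would give the form the value 2 sqrt 2 or more at f, which
      exceeds 5/2.\<close>
    have "n = 1"
    proof (rule ccontr)
      assume "n \<noteq> 1"
      then have "(5 / 2 / 2)\<^sup>2 \<le> p * (u2\<^sup>2 * sq' f)" using n1 unfolding prod by (simp add: power2_eq_square)
      then have "p + u2\<^sup>2 * sq' f \<ge> 5 / 2"
        using p0 sq_simps(14)[of f] by (intro add_ge_of_mult_ge) auto
      then show False using f(3) by (simp add: Q_def p_def)
    qed
    then have q: "u2\<^sup>2 * sq' f = 1 / p" using prod p0 by (simp add: field_simps)
    have "I = (*) f ` ring_of_integers"
    proof (rule coset_index_1[OF subgroup])
      have "additive_subgroup ((*) f ` ring_of_integers)"
        unfolding additive_subgroup_def
      proof (intro conjI ballI)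
        show "0 \<in> (*) f ` ring_of_integers" by (rule image_eqI[of _ _ 0]) (simp_all add: ring_of_integers_closed)
        fix x y assume "x \<in> (*) f ` ring_of_integers" "y \<in> (*) f ` ring_of_integers"
        then obtain a b where "x = f * a" "y = f * b" "a \<in> ring_of_integers" "b \<in> ring_of_integers" by blast
        then show "x - y \<in> (*) f ` ring_of_integers"
          by (intro image_eqI[of _ _ "a - b"]) (simp_all add: right_diff_distrib ring_of_integers_closed(3))
      qed
      then show "additive_subgroup ((*) f ` ring_of_integers)" .
      show "(*) f ` ring_of_integers \<subseteq> I" by (rule fractional_ideal_principal_subset[OF I f(1)])
      show "coset_index I ((*) f ` ring_of_integers) = 1" using \<open>n = 1\<close> by (simp add: n_def)
    qed
    then have O: "(*) (inverse f) ` I = ring_of_integers" using f(2) by (simp add: image_image mult.assoc[symmetric])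
    define v1 where "v1 = cmod (\<sigma> f) * u1"
    define v2 where "v2 = cmod (\<sigma>' f) * u2"
    have v: "v1 > 0" "v2 > 0" using u f(2) by (simp_all add: v1_def v2_def \<sigma>_simps \<sigma>'_simps)
    have v2: "v1\<^sup>2 = p" "v2\<^sup>2 = 1 / p"
      using q by (simp_all add: v1_def v2_def p_def power_mult_distrib sq_def sq'_def mult.commute)
    have "h0 \<sigma> \<sigma>' (ring_of_integers, v1, v2) < h0 \<sigma> \<sigma>' trivial_divisor"
    proof (rule h0_less[OF fractional_ideal_ring_of_integers v])
      show "v1\<^sup>2 * v2\<^sup>2 * ideal_norm (ring_of_integers :: 'a set) = 1"
        using p0 by (simp add: v2 ideal_norm_ring_of_integers)
      show "nonzero_theta ring_of_integers (v1\<^sup>2) (v2\<^sup>2) < nonzero_theta ring_of_integers 1 1"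
        unfolding v2
      proof (rule nonzero_theta_distorted[OF p0])
        \<comment> \<open>With p = 1 the principal shift by f turns the divisor into the trivial
          one; this is where the assumption on the classes enters.\<close>
        show "p \<noteq> 1"
        proof
          assume "p = 1"
          then have "v1 = 1" "v2 = 1" using v v2 by (auto simp: power2_eq_1_iff)
          then have "((*) (inverse f) ` I, cmod (\<sigma> f) * u1, cmod (\<sigma>' f) * u2) = trivial_divisor"
            by (simp add: O v1_def v2_def trivial_divisor_def)
          then show False
            using divisor_class_shift[OF D[unfolded DI] f(2)] trivial_divisor_carrier ne unfolding DI by simp
        qed
        show "p + 1 / p < 5 / 2" using f(3) q by (simp add: Q_def p_def)
        show "p + 1 / p \<le> p * sq x + 1 / p * sq' x" if x: "x \<in> ring_of_integers" "x \<noteq> 0" for x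
        proof -
          have "f * x \<in> I" using fractional_ideal_principal_subset[OF I f(1)] x(1) by blast
          then have "Q f \<le> Q (f * x)" using min x(2) f(2) by simp
          also have "Q (f * x) = p * sq x + (u2\<^sup>2 * sq' f) * sq' x"
            unfolding Q_def p_def sq_simps by simp
          also have "Q f = p + u2\<^sup>2 * sq' f" by (simp add: Q_def p_def)
          finally show ?thesis unfolding q .
        qed
      qed
    qed
    then show ?thesis
      using h0_principal_shift[OF emb(2,3) f(2), of I u1 u2] unfolding O DI v1_def v2_def by simp
  qed
qed

end

theorem theorem1p1:
  fixes \<iota> :: "'k::field_char_0 \<Rightarrow> 'a::field_char_0"
    and \<sigma> \<sigma>' :: "'a \<Rightarrow> complex"
  assumes K_quadratic: "extension_degree (of_rat :: rat \<Rightarrow> 'k) = 2"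
    and K_complex: "\<And>\<tau> :: 'k \<Rightarrow> complex. field_embedding \<tau> \<Longrightarrow> \<not> range \<tau> \<subseteq> \<real>"
    and F_over_K: "field_embedding \<iota>" "extension_degree \<iota> = 2"
    and infinite_primes: "field_embedding \<sigma>" "field_embedding \<sigma>'" "\<sigma>' \<noteq> \<sigma>" "\<sigma>' \<noteq> cnj \<circ> \<sigma>"
  shows "\<forall>C \<in> carrier (Pic0 \<sigma> \<sigma>').
    C \<noteq> divisor_class \<sigma> \<sigma>' trivial_divisor \<longrightarrow>
    h0_Pic \<sigma> \<sigma>' C < h0_Pic \<sigma> \<sigma>' (divisor_class \<sigma> \<sigma>' trivial_divisor)"
proof (intro ballI impI)
  fix C assume C: "C \<in> carrier (Pic0 \<sigma> \<sigma>')" "C \<noteq> divisor_class \<sigma> \<sigma>' trivial_divisor"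
  obtain \<tau> where "quadratic_over_imaginary_quadratic \<iota> \<sigma> \<sigma>' \<tau>"
    using quadratic_over_imaginary_quadratic_exists[OF assms] by blast
  then interpret quadratic_over_imaginary_quadratic \<iota> \<sigma> \<sigma>' \<tau> .
  obtain D where D: "D \<in> carrier arakelov_divisors0" "C = divisor_class \<sigma> \<sigma>' D"
    using C(1) unfolding carrier_Pic0 by blast
  show "h0_Pic \<sigma> \<sigma>' C < h0_Pic \<sigma> \<sigma>' (divisor_class \<sigma> \<sigma>' trivial_divisor)"
    using h0_less_trivial[OF D(1)] C(2)
    unfolding D(2) h0_Pic_divisor_class[OF emb(2,3) D(1)] h0_Pic_divisor_class[OF emb(2,3) trivial_divisor_carrier] .
qed

end
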